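(* Let $p$ be a prime and let $W$ be a DVR with quotient field $\mathbb{Q}(X)$ such that $W\cap\mathbb{Q}=\mathbb{Z}_{(p)}$. Then: (1) $W=\mathbb{Z}_{(p),\alpha,\delta}$ for some admissible pair $(\alpha,\delta)\in\mathbb{C}_p^{\mathrm{br}}\times(\mathbb{Q}\cup\{\infty\})$; in this case $X\in W$ if and only if $(\alpha,\delta)\in\mathbb{O}_p^{\mathrm{br}}\times(\mathbb{Q}_{\ge0}\cup\{\infty\})$. (2) $W$ is residually transcendental over $\mathbb{Z}_{(p)}$ if and only if $\delta<\infty$, and $W$ is residually algebraic over $\mathbb{Z}_{(p)}$ if and only if $\delta=\infty$ and $\alpha$ is transcendental over $\mathbb{Q}$. Consequently, the set of DVRs of $\mathbb{Q}(X)$ residually algebraic over $\mathbb{Z}_{(p)}$ is $\{\mathbb{Z}_{(p),\alpha,\infty}:\alpha\in\mathbb{C}_p^{\mathrm{br}},\ \alpha\text{ transcendental over }\mathbb{Q}\}$, and the set of DVRs of $\mathbb{Q}(X)$ residually transcendental over $\mathbb{Z}_{(p)}$ is $\{\mathbb{Z}_{(p),\alpha,\delta}:(\alpha,\delta)\in\overline{\mathbb{Q}_p}\times\mathbb{Q}\}$.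
   Context: Fix a prime $p$. $\mathbb{Q}_p$ is the field of $p$-adic numbers, $\overline{\mathbb{Q}_p}$ a fixed algebraic closure, $v_p$ the unique extension of the $p$-adic valuation to $\overline{\mathbb{Q}_p}$, $\mathbb{C}_p$ the completion of $\overline{\mathbb{Q}_p}$ (valuation still $v_p$), $\mathbb{O}_p=\{x\in\mathbb{C}_p:v_p(x)\ge0\}$. $\mathbb{C}_p^{\mathrm{br}}$ is the set of $\alpha\in\mathbb{C}_p$ such that the ramification index of $\mathbb{Q}_p(\alpha)/\mathbb{Q}_p$ (the index of $\mathbb{Z}=v_p(\mathbb{Q}_p^* )$ in $v_p(\mathbb{Q}_p(\alpha)^* )$) is finite, and $\mathbb{O}_p^{\mathrm{br}}=\mathbb{O}_p\cap\mathbb{C}_p^{\mathrm{br}}$. A pair $(\alpha,\delta)\in\mathbb{C}_p\times(\mathbb{Q}\cup\{\infty\})$ is admissible if: when $\delta\in\mathbb{Q}$, $\alpha\in\overline{\mathbb{Q}_p}$; when $\delta=\infty$, $\alpha$ is transcendental over $\mathbb{Q}$. For an admissible pair with $\delta\in\mathbb{Q}$, $v_{p,\alpha,\delta}$ is the monomial valuation on $\mathbb{C}_p(X)$ given on polynomials by $v_{p,\alpha,\delta}(\sum_i a_i(X-\alpha)^i)=\min_i\{v_p(a_i)+i\delta\}$ ($a_i\in\mathbb{C}_p$); for $\delta=\infty$, $v_{p,\alpha,\infty}(\varphi)=v_p(\varphi(\alpha))$ for $\varphi\in\mathbb{Q}(X)$. Set $\mathbb{Z}_{(p),\alpha,\delta}=\{\varphi\in\mathbb{Q}(X):v_{p,\alpha,\delta}(\varphi)\ge0\}$.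 An extension $W$ of $\mathbb{Z}_{(p)}$ to $\mathbb{Q}(X)$ is residually algebraic/transcendental if its residue field is algebraic/transcendental over $\mathbb{Z}/p\mathbb{Z}$. *)

theory Defs
  imports Complex_Main "HOL-Computational_Algebra.Polynomial" "HOL-Computational_Algebra.Fraction_Field"
    "HOL-Computational_Algebra.Primes" "HOL-Library.Extended_Real"
begin

type_synonym QX = "rat poly fract"

definition constQX :: "rat \<Rightarrow> QX" where
  "constQX c = Fract [:c:] 1"

definition varX :: QX where
  "varX = Fract [:0, 1:] 1"

definition Zloc :: "nat \<Rightarrow> rat set" where
  "Zloc p = {c. \<not> int p dvd snd (quotient_of c)}"

definition is_DVR_QX :: "QX set \<Rightarrow> bool" where
  "is_DVR_QX W \<longleftrightarrow> (\<exists>w :: QX \<Rightarrow> int.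
      (\<forall>x y. x \<noteq> 0 \<longrightarrow> y \<noteq> 0 \<longrightarrow> w (x * y) = w x + w y) \<and>
      (\<forall>x y. x \<noteq> 0 \<longrightarrow> y \<noteq> 0 \<longrightarrow> x + y \<noteq> 0 \<longrightarrow> w (x + y) \<ge> min (w x) (w y)) \<and>
      (\<forall>n. \<exists>x. x \<noteq> 0 \<and> w x = n) \<and>
      W = {x. x = 0 \<or> w x \<ge> 0})"

definition max_ideal :: "QX set \<Rightarrow> QX set" where
  "max_ideal W = {x \<in> W. x = 0 \<or> inverse x \<notin> W}"

(* Residue field W/m algebraic over Z/pZ: every residue class is a root of a
   nonzero polynomial over F_p (lifted to an integer polynomial whose reduction
   mod p is nonzero). *)
definition res_algebraic :: "nat \<Rightarrow> QX set \<Rightarrow> bool" where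
  "res_algebraic p W \<longleftrightarrow> (\<forall>x \<in> W. \<exists>f :: int poly.
      (\<exists>i. \<not> int p dvd coeff f i) \<and>
      poly (map_poly (\<lambda>a. constQX (of_int a)) f) x \<in> max_ideal W)"

definition res_transcendental :: "nat \<Rightarrow> QX set \<Rightarrow> bool" where
  "res_transcendental p W \<longleftrightarrow> \<not> res_algebraic p W"

definition padic_val_rat :: "nat \<Rightarrow> rat \<Rightarrow> int" where
  "padic_val_rat p q = (case quotient_of q of (a, b) \<Rightarrow>
       int (multiplicity (int p) a) - int (multiplicity (int p) b))"

definition alg_over_Q :: "'k::field_char_0 \<Rightarrow> bool" where
  "alg_over_Q x \<longleftrightarrow> (\<exists>f :: rat poly. f \<noteq> 0 \<and> poly (map_poly of_rat f) x = 0)"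

(* (k, v) is (a copy of) C_p with its valuation v_p:
   a complete, algebraically closed valued field of characteristic 0 whose
   valuation restricts to the p-adic valuation on Q and in which the algebraic
   numbers (= an algebraic closure of Q) are dense.  These properties
   characterise C_p up to isometric isomorphism. *)
definition is_Cp :: "nat \<Rightarrow> ('k::field_char_0 \<Rightarrow> ereal) \<Rightarrow> bool" where
  "is_Cp p v \<longleftrightarrow>
     (\<forall>x. v x = \<infinity> \<longleftrightarrow> x = 0) \<and> (\<forall>x. v x \<noteq> -\<infinity>) \<and>
     (\<forall>x y. v (x * y) = v x + v y) \<and>
     (\<forall>x y. v (x + y) \<ge> min (v x) (v y)) \<and>
     (\<forall>q. q \<noteq> 0 \<longrightarrow> v (of_rat q) = ereal (of_int (padic_val_rat p q))) \<and>
     (\<forall>s :: nat \<Rightarrow> 'k. (\<forall>M::real. \<exists>N. \<forall>m\<ge>N. \<forall>n\<ge>N. v (s m - s n) \<ge> ereal M) \<longrightarrow>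
        (\<exists>l. \<forall>M::real. \<exists>N. \<forall>n\<ge>N. v (s n - l) \<ge> ereal M)) \<and>
     (\<forall>f :: 'k poly. degree f > 0 \<longrightarrow> (\<exists>x. poly f x = 0)) \<and>
     (\<forall>x. \<forall>M::real. \<exists>y. alg_over_Q y \<and> v (x - y) \<ge> ereal M)"

definition Qp :: "('k::field_char_0 \<Rightarrow> ereal) \<Rightarrow> 'k set" where
  "Qp v = {x. \<forall>M::real. \<exists>q. v (x - of_rat q) \<ge> ereal M}"

definition Qp_bar :: "('k::field_char_0 \<Rightarrow> ereal) \<Rightarrow> 'k set" where
  "Qp_bar v = {x. \<exists>f :: 'k poly. f \<noteq> 0 \<and> (\<forall>i. coeff f i \<in> Qp v) \<and> poly f x = 0}"

definition Qp_adj :: "('k::field_char_0 \<Rightarrow> ereal) \<Rightarrow> 'k \<Rightarrow> 'k set" where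
  "Qp_adj v a = {poly f a / poly g a | f g. (\<forall>i. coeff f i \<in> Qp v) \<and>
                   (\<forall>i. coeff g i \<in> Qp v) \<and> poly g a \<noteq> 0}"

(* C_p^br: the index of Z in v(Q_p(alpha)^* ) is finite *)
definition Cp_br :: "('k::field_char_0 \<Rightarrow> ereal) \<Rightarrow> 'k set" where
  "Cp_br v = {a. finite ((\<lambda>r. {r + real_of_int n | n. True}) `
                   {real_of_ereal (v y) | y. y \<in> Qp_adj v a \<and> y \<noteq> 0})}"

definition Op :: "('k::field_char_0 \<Rightarrow> ereal) \<Rightarrow> 'k set" where
  "Op v = {x. v x \<ge> 0}"

(* delta \<in> Q \<union> {\<infinity>} is encoded as rat option, None = \<infinity> *)
definition admissible :: "('k::field_char_0 \<Rightarrow> ereal) \<Rightarrow> 'k \<Rightarrow> rat option \<Rightarrow> bool" where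
  "admissible v a d \<longleftrightarrow> (case d of Some _ \<Rightarrow> a \<in> Qp_bar v | None \<Rightarrow> \<not> alg_over_Q a)"

definition val_pad :: "('k::field_char_0 \<Rightarrow> ereal) \<Rightarrow> 'k \<Rightarrow> rat option \<Rightarrow> rat poly \<Rightarrow> ereal" where
  "val_pad v a d f = (case d of
      Some \<delta> \<Rightarrow> (INF i. v (coeff (pcompose (map_poly of_rat f) [:a, 1:]) i)
                        + ereal (real_of_rat \<delta> * real i))
    | None \<Rightarrow> v (poly (map_poly of_rat f) a))"

(* Z_(p),alpha,delta = {phi in Q(X). v_{p,alpha,delta}(phi) >= 0},
   with v(f/g) = v(f) - v(g) *)
definition Zpad :: "('k::field_char_0 \<Rightarrow> ereal) \<Rightarrow> 'k \<Rightarrow> rat option \<Rightarrow> QX set" where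
  "Zpad v a d = {phi. \<exists>f g. g \<noteq> 0 \<and> phi = Fract f g \<and> val_pad v a d g \<le> val_pad v a d f}"

end

theory Submission
  imports Defs
begin

text \<open>
  Write \<open>w\<close> for the valuation of \<open>W\<close>, normalised by \<open>w(p) = 1\<close>. Since \<open>p\<close> is not a unit of the
  subring of \<open>\<complex>\<^sub>p(X)\<close> generated by \<open>O\<^sub>p\<close> and \<open>W\<close>, Chevalley's theorem gives a valuation ring \<open>V\<close> of
  \<open>\<complex>\<^sub>p(X)\<close> that lies over both. Each \<open>X - b\<close> with \<open>b\<close> algebraic has a value \<open>D(b)\<close> in \<open>V\<close>, and these
  values together with \<open>v\<^sub>p\<close> determine \<open>w\<close>, because polynomials over \<open>\<rat>\<close> split into linear factors.

  If \<open>D\<close> has a maximum \<open>\<delta> = D(a)\<close>, then \<open>D(b) = min(\<delta>, v\<^sub>p(a - b))\<close>, so \<open>w\<close> is the monomial valuation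
  \<open>v\<^sub>p\<^sub>,\<^sub>a\<^sub>,\<^sub>\<delta>\<close>. Otherwise every element of \<open>W\<close> is congruent to a constant modulo the maximal ideal of
  \<open>V\<close>, so \<open>W\<close> is residually algebraic. In that case every residue class has an approximate
  Teichmueller representative in \<open>W\<close>, hence with a uniformizer \<open>\<pi>\<close> and \<open>p = \<pi>\<^sup>e u\<close> every
  element of \<open>W\<close> is, modulo any power of \<open>p\<close>, a polynomial in \<open>\<pi>\<close> of degree less than \<open>e\<close> with coefficients
  in \<open>O\<^sub>p\<close>. Applied to \<open>\<pi>\<^sup>e\<close> this shows that \<open>\<pi>\<close>, and therefore \<open>X\<close>, is arbitrarily close to constants;
  so \<open>D\<close> is unbounded and \<open>w(f) = v\<^sub>p(f(\<alpha>))\<close> for the limit \<open>\<alpha>\<close> of these constants. The bound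
  \<open>e\<close> on the degree is where the discreteness of \<open>W\<close> enters.
\<close>

section \<open>Valuation rings\<close>

text \<open>Placing \<open>O_p\<close> and \<open>W\<close> in the single field C_p(X) makes it
  possible to compare X with constants without completing Q(X). The price is that \<open>V\<close>
  may have rank above one, so a real value has to be established for each element that needs one;
  \<open>X - b\<close> gets it by being algebraic over Q(X). The obstacle is that C_p is not
  spherically complete. When \<open>D\<close> has no maximum, the balls around \<open>b\<close> of
  radius \<open>D(b)\<close> shrink towards X, but for bounded \<open>D\<close> they may have empty
  intersection, and residual algebraicity does not exclude this. The expansion with fewer than
  \<open>e\<close> digits does: it makes a uniformizer nearly a root of a monic polynomial of degree
  \<open>e\<close> over \<open>O_p\<close>, and the roots of that polynomial are constants. Centres
  are taken algebraic over \<rat> and not merely over Q_p. They are still dense, and their finite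
  degree over \<rat> bounds the denominators of values, which gives discreteness in the converse
  direction.\<close>

locale valuation_ring =
  fixes V :: "'l::field set" and \<pi> :: 'l
  assumes one_in: "1 \<in> V"
    and diff_in: "x \<in> V \<Longrightarrow> y \<in> V \<Longrightarrow> x - y \<in> V"
    and mult_in: "x \<in> V \<Longrightarrow> y \<in> V \<Longrightarrow> x * y \<in> V"
    and total: "x \<in> V \<or> inverse x \<in> V"
    and pi_in: "\<pi> \<in> V" and pi_nz: "\<pi> \<noteq> 0"
    and inverse_pi: "inverse \<pi> \<notin> V"
begin

lemma zero_in: "0 \<in> V" using diff_in[OF one_in one_in] by simp
lemma uminus_in: "x \<in> V \<Longrightarrow> - x \<in> V" using diff_in[OF zero_in] by simp
lemma uminus_in_iff: "- x \<in> V \<longleftrightarrow> x \<in> V" using uminus_in[of x] uminus_in[of "-x"] by auto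
lemma add_in: "x \<in> V \<Longrightarrow> y \<in> V \<Longrightarrow> x + y \<in> V" using diff_in[of x "- y"] uminus_in[of y] by simp
lemma power_in: "x \<in> V \<Longrightarrow> x ^ n \<in> V" by (induction n) (auto intro: one_in mult_in)
lemma sum_in: "(\<And>i. i \<in> I \<Longrightarrow> f i \<in> V) \<Longrightarrow> sum f I \<in> V"
  by (induction I rule: infinite_finite_induct) (auto intro: zero_in add_in)
lemma of_nat_in: "of_nat n \<in> V" by (induction n) (auto intro: zero_in one_in add_in)
lemma of_int_in: "of_int n \<in> V"
  by (cases n rule: int_cases2) (auto simp: of_nat_in uminus_in)

definition "unit x \<longleftrightarrow> x \<noteq> 0 \<and> x \<in> V \<and> inverse x \<in> V"
definition "nonunits = {x \<in> V. \<not> unit x}"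

lemma unit_1: "unit 1" by (simp add: unit_def one_in)
lemma unit_mult: "unit x \<Longrightarrow> unit y \<Longrightarrow> unit (x * y)"
  by (auto simp: unit_def mult_in inverse_mult_distrib)
lemma unit_inverse: "unit x \<Longrightarrow> unit (inverse x)" by (auto simp: unit_def)
lemma unit_power: "unit x \<Longrightarrow> unit (x ^ n)" by (induction n) (auto intro: unit_1 unit_mult)
lemma unit_uminus: "unit (- x) \<longleftrightarrow> unit x" by (auto simp: unit_def uminus_in_iff)
lemma unit_divide: "unit x \<Longrightarrow> unit y \<Longrightarrow> unit (x / y)"
  by (simp add: divide_inverse unit_mult unit_inverse)
lemma notin_imp_inverse_nonunit: "x \<notin> V \<Longrightarrow> inverse x \<in> nonunits"
  using total[of x] by (auto simp: nonunits_def unit_def)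

lemma nonunits_mult: "x \<in> nonunits \<Longrightarrow> y \<in> V \<Longrightarrow> x * y \<in> nonunits"
proof -
  assume x: "x \<in> nonunits" and y: "y \<in> V"
  have "unit x" if u: "unit (x * y)"
  proof -
    have "inverse x = inverse (x * y) * y" using u by (simp add: unit_def)
    then have "inverse x \<in> V" using u y mult_in unfolding unit_def by metis
    then show ?thesis using u x by (auto simp: unit_def nonunits_def)
  qed
  then show ?thesis using x y by (auto simp: nonunits_def mult_in)
qed

lemma nonunits_add: assumes x: "x \<in> nonunits" and y: "y \<in> nonunits" shows "x + y \<in> nonunits"
proof -
  have main: "x + y \<in> nonunits" if x: "x \<in> nonunits" and y: "y \<noteq> 0" "y \<in> nonunits" "x / y \<in> V" for x y
  proof -
    have "x + y = y * (x / y + 1)" using y by (simp add: field_simps)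
    then show ?thesis using nonunits_mult[of y "x / y + 1"] y add_in one_in by metis
  qed
  show ?thesis
  proof (cases "x = 0 \<or> y = 0")
    case False
    have "x / y \<in> V \<or> y / x \<in> V" using total[of "x / y"] by (simp add: field_simps)
    then show ?thesis using main[OF x _ y] main[OF y _ x] False by (auto simp: add.commute)
  qed (use x y in auto)
qed

lemma nonunits_uminus: "x \<in> nonunits \<Longrightarrow> - x \<in> nonunits"
  by (auto simp: nonunits_def unit_uminus uminus_in)
lemma nonunits_diff: "x \<in> nonunits \<Longrightarrow> y \<in> nonunits \<Longrightarrow> x - y \<in> nonunits"
  using nonunits_add[of x "-y"] nonunits_uminus[of y] by simp
lemma nonunits_0: "0 \<in> nonunits" by (auto simp: nonunits_def unit_def zero_in)
lemma nonunits_sum: "(\<And>i. i \<in> I \<Longrightarrow> f i \<in> nonunits) \<Longrightarrow> sum f I \<in> nonunits"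
  by (induction I rule: infinite_finite_induct) (auto intro: nonunits_0 nonunits_add)
lemma one_notin_nonunits: "1 \<notin> nonunits" by (simp add: nonunits_def unit_1)
lemma nonunits_in: "x \<in> nonunits \<Longrightarrow> x \<in> V" by (simp add: nonunits_def)
lemma pi_nonunit: "\<pi> \<in> nonunits" using pi_in inverse_pi by (auto simp: nonunits_def unit_def)

lemma unit_1_add_nonunit: assumes "z \<in> nonunits" shows "unit (1 + z)"
proof (rule ccontr)
  assume "\<not> unit (1 + z)"
  moreover have "1 + z \<in> V" using assms by (auto intro: add_in one_in nonunits_in)
  ultimately have "1 + z - z \<in> nonunits" using assms by (intro nonunits_diff) (auto simp: nonunits_def)
  then show False using one_notin_nonunits by simp
qed

lemma poly_in: "(\<And>i. coeff f i \<in> V) \<Longrightarrow> x \<in> V \<Longrightarrow> poly f x \<in> V"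
  unfolding poly_altdef by (intro sum_in mult_in power_in) auto

lemma poly_diff_dvd: assumes "\<And>i. coeff f i \<in> V" "x \<in> V" "y \<in> V"
  shows "\<exists>c\<in>V. poly f x - poly f y = (x - y) * c"
  using assms(1)
proof (induction f)
  case (pCons a f)
  have c: "coeff f i \<in> V" for i using pCons.prems[of "Suc i"] by simp
  then obtain c where c: "c \<in> V" "poly f x - poly f y = (x - y) * c" "poly f y \<in> V"
    using pCons.IH poly_in[OF c assms(3)] by blast
  have "poly (pCons a f) x - poly (pCons a f) y = x * (poly f x - poly f y) + (x - y) * poly f y"
    by (simp add: algebra_simps)
  also have "\<dots> = (x - y) * (x * c + poly f y)" by (simp add: c(2) algebra_simps)
  finally show ?case using c assms by (auto intro!: bexI[of _ "x * c + poly f y"] add_in mult_in)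
qed (auto intro!: bexI[of _ 0] zero_in)

lemma poly_eq_mod_nonunits:
  assumes "\<And>i. coeff f i \<in> V" "x \<in> V" "y \<in> V" "x - y \<in> nonunits"
  shows "poly f x \<in> nonunits \<longleftrightarrow> poly f y \<in> nonunits"
proof -
  obtain c where "c \<in> V" "poly f x - poly f y = (x - y) * c" using poly_diff_dvd[OF assms(1-3)] by blast
  then have d: "poly f x - poly f y \<in> nonunits" using nonunits_mult assms by metis
  then show ?thesis using nonunits_add[OF d, of "poly f y"] nonunits_diff[OF _ d, of "poly f x"] by auto
qed

text \<open>Valuation rings are root closed: if \<open>x\<close> is outside \<open>V\<close>, its
  inverse is a nonunit, and \<open>inverse x ^ n * x ^ n = 1\<close> would be one too.\<close>

lemma nonunits_power_imp: assumes "x ^ n \<in> V" "n > 0" shows "x \<in> V"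
proof (rule ccontr)
  assume "x \<notin> V"
  then have "inverse x \<in> nonunits" by (rule notin_imp_inverse_nonunit)
  then have "inverse x ^ n \<in> nonunits" using \<open>n > 0\<close>
    by (cases n) (auto intro: nonunits_mult power_in nonunits_in)
  then have "inverse x ^ n * x ^ n \<in> nonunits" using assms nonunits_mult by blast
  moreover have "x \<noteq> 0" using \<open>x \<notin> V\<close> zero_in by auto
  ultimately show False using one_notin_nonunits by (simp flip: power_mult_distrib)
qed

lemma unit_power_iff: assumes "n > 0" shows "unit (x ^ n) \<longleftrightarrow> unit x"
proof
  assume u: "unit (x ^ n)"
  then have "inverse x ^ n \<in> V" by (simp add: unit_def power_inverse)
  then show "unit x" using u assms nonunits_power_imp[of x n] nonunits_power_imp[of "inverse x" n]
    by (simp add: unit_def)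
qed (rule unit_power)

lemma pi_powi_in_iff: "\<pi> powi n \<in> V \<longleftrightarrow> n \<ge> 0"
proof -
  have "inverse (\<pi> ^ n) \<notin> V" if "n > 0" for n
    using nonunits_power_imp[of "inverse \<pi>" n] that inverse_pi by (auto simp: power_inverse)
  then show ?thesis by (auto simp: power_int_def power_inverse power_in pi_in)
qed

text \<open>A valuation on the elements commensurable with \<open>\<pi>\<close>, normalised by \<open>\<pi> \<mapsto> 1\<close>.
  It is a relation because a valuation ring of higher rank leaves other elements without a value.\<close>

definition has_val :: "'l \<Rightarrow> real \<Rightarrow> bool" where
  "has_val y r \<longleftrightarrow> (\<exists>t s. t > 0 \<and> unit (y ^ t * \<pi> powi (- s)) \<and> r = of_int s / of_nat t)"

lemma has_valI: "t > 0 \<Longrightarrow> unit (y ^ t * \<pi> powi (- s)) \<Longrightarrow> r = of_int s / of_nat t \<Longrightarrow> has_val y r"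
  by (auto simp: has_val_def)

lemma has_val_nz: "has_val y r \<Longrightarrow> y \<noteq> 0" by (auto simp: has_val_def unit_def)

lemma has_val_rat: "has_val y r \<Longrightarrow> r \<in> \<rat>"
  by (auto simp: has_val_def)

lemma has_val_unit_iff: "has_val y 0 \<longleftrightarrow> unit y"
proof
  assume "has_val y 0"
  then show "unit y" by (auto simp: has_val_def unit_power_iff)
qed (auto intro!: has_valI[of 1 _ 0])

lemma has_val_pi: "has_val (\<pi> powi n) n"
  by (rule has_valI[of 1 _ n]) (simp_all add: unit_1 pi_nz flip: power_int_add)

lemma has_val_scale:
  assumes "t > 0" "unit (y ^ t * \<pi> powi (- s))"
  shows "unit (y ^ (t * n) * \<pi> powi (- (s * int n)))"
  using unit_power[OF assms(2), of n]
  by (simp add: power_mult_distrib power_mult power_int_mult flip: power_int_minus mult_minus_left)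

lemma has_val_mult: assumes "has_val x a" "has_val y b" shows "has_val (x * y) (a + b)"
proof -
  obtain t s where 1: "t > 0" "unit (x ^ t * \<pi> powi (- s))" "a = of_int s / of_nat t"
    using assms by (auto simp: has_val_def)
  obtain t' s' where 2: "t' > 0" "unit (y ^ t' * \<pi> powi (- s'))" "b = of_int s' / of_nat t'"
    using assms by (auto simp: has_val_def)
  have "unit ((x ^ (t * t') * \<pi> powi (- (s * int t'))) * (y ^ (t' * t) * \<pi> powi (- (s' * int t))))"
    using has_val_scale[OF 1(1,2)] has_val_scale[OF 2(1,2)] unit_mult by blast
  also have "\<dots> = (x * y) ^ (t * t') * \<pi> powi (- (s * int t' + s' * int t))"
    using pi_nz by (simp add: power_mult_distrib power_int_diff power_int_minus field_simps power_int_add)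
  finally show ?thesis using 1 2
    by (intro has_valI[of "t * t'" _ "s * int t' + s' * int t"]) (auto simp: field_simps)
qed

lemma has_val_inverse: assumes "has_val x a" shows "has_val (inverse x) (- a)"
proof -
  obtain t s where 1: "t > 0" "unit (x ^ t * \<pi> powi (- s))" "a = of_int s / of_nat t"
    using assms by (auto simp: has_val_def)
  have "unit (inverse x ^ t * \<pi> powi (- (- s)))"
    using unit_inverse[OF 1(2)] by (simp add: power_inverse power_int_minus field_simps)
  then show ?thesis using 1 by (intro has_valI[of t _ "- s"]) auto
qed

lemma has_val_divide: "has_val x a \<Longrightarrow> has_val y b \<Longrightarrow> has_val (x / y) (a - b)"
  using has_val_mult[of x a "inverse y" "- b"] has_val_inverse[of y b] by (simp add: divide_inverse)

lemma has_val_in_iff: assumes "has_val x a" shows "x \<in> V \<longleftrightarrow> a \<ge> 0"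
proof -
  obtain t s where 1: "t > 0" "unit (x ^ t * \<pi> powi (- s))" "a = of_int s / of_nat t"
    using assms by (auto simp: has_val_def)
  have eq: "x ^ t = (x ^ t * \<pi> powi (- s)) * \<pi> powi s"
    using pi_nz by (simp flip: power_int_add)
  have "x \<in> V" if "s \<ge> 0"
  proof -
    have "x ^ t \<in> V" by (subst eq) (use 1 that in \<open>auto simp: unit_def pi_powi_in_iff intro: mult_in\<close>)
    then show ?thesis using nonunits_power_imp 1 by blast
  qed
  moreover have "s \<ge> 0" if "x \<in> V"
  proof -
    have "\<pi> powi s = x ^ t * inverse (x ^ t * \<pi> powi (- s))"
      using has_val_nz[OF assms] by (simp add: power_int_minus)
    then have "\<pi> powi s \<in> V" using that 1 by (auto simp: unit_def intro!: mult_in power_in)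
    then show ?thesis by (simp add: pi_powi_in_iff)
  qed
  ultimately have "x \<in> V \<longleftrightarrow> s \<ge> 0" by blast
  then show ?thesis using 1 by (simp add: zero_le_divide_iff)
qed

lemma has_val_unique: assumes "has_val x a" "has_val x b" shows "a = b"
proof -
  have "has_val 1 (a - b)" "has_val 1 (b - a)"
    using has_val_divide assms has_val_nz[OF assms(1)] by fastforce+
  then have "a - b \<ge> 0" "b - a \<ge> 0" using one_in has_val_in_iff by blast+
  then show ?thesis by simp
qed

lemma has_val_nonunits_iff: assumes "has_val x a" shows "x \<in> nonunits \<longleftrightarrow> a > 0"
proof -
  have "unit x \<longleftrightarrow> a = 0" using has_val_unique[OF assms] assms has_val_unit_iff by metis
  then show ?thesis using has_val_in_iff[OF assms] by (auto simp: nonunits_def)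
qed

lemma has_val_uminus: "has_val x a \<Longrightarrow> has_val (- x) a"
  using has_val_mult[of x a "-1" 0] by (simp add: has_val_unit_iff unit_uminus unit_1)

lemma has_val_add_ge:
  assumes "has_val x a" "has_val y b" "has_val (x + y) c" shows "c \<ge> min a b"
proof -
  have main: "c \<ge> b" if "has_val x a" "has_val y b" "has_val (x + y) c" "a \<ge> b" for x y a b c
  proof -
    have "x / y \<in> V" using that has_val_in_iff[OF has_val_divide] by fastforce
    then have "x / y + 1 \<in> V" by (intro add_in one_in)
    moreover have "(x + y) / y = x / y + 1" using has_val_nz[OF that(2)] by (simp add: field_simps)
    ultimately show ?thesis using that has_val_in_iff[OF has_val_divide[of "x + y" c y b]] by simp
  qed
  show ?thesis using main[OF assms] main[OF assms(2,1)] assms(3) by (cases "a \<ge> b") (auto simp: add.commute)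
qed

lemma has_val_add_strict: assumes "has_val x a" "has_val y b" "a < b" shows "has_val (x + y) a"
proof -
  have "y / x \<in> nonunits" using has_val_nonunits_iff[OF has_val_divide[OF assms(2,1)]] assms by simp
  then have "has_val (1 + y / x) 0" by (simp add: has_val_unit_iff unit_1_add_nonunit)
  then have "has_val (x * (1 + y / x)) a" using has_val_mult[OF assms(1)] by fastforce
  moreover have "x * (1 + y / x) = x + y" using has_val_nz[OF assms(1)] by (simp add: distrib_left)
  ultimately show ?thesis by simp
qed

lemma ex_minimal_value:
  assumes "finite I" "I \<noteq> {}" "\<And>i. i \<in> I \<Longrightarrow> z i \<noteq> 0"
  shows "\<exists>j\<in>I. \<forall>i\<in>I. z i / z j \<in> V"
  using assms
proof (induction I rule: finite_ne_induct)
  case (insert x F)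
  then obtain j where j: "j \<in> F" "\<forall>i\<in>F. z i / z j \<in> V" by auto
  consider "z x / z j \<in> V" | "z j / z x \<in> V" using total[of "z x / z j"] by (auto simp: field_simps)
  then show ?case
  proof cases
    case 2
    have "z i / z x \<in> V" if "i \<in> F" for i
      using mult_in[OF _ 2, of "z i / z j"] j that insert.prems by simp
    then show ?thesis using insert.prems by (intro bexI[of _ x]) (auto simp: one_in)
  qed (use j in auto)
qed (simp add: one_in)

text \<open>If one term divided all others properly, division by it would write -1 as a sum of
  nonunits. Units replace equality of values here, since elements of a ring of higher rank need not
  have a real value.\<close>

lemma sum_zero_two_terms:
  assumes "finite I" "I \<noteq> {}" "\<And>i. i \<in> I \<Longrightarrow> z i \<noteq> 0" "sum z I = 0"
  shows "\<exists>i\<in>I. \<exists>j\<in>I. i \<noteq> j \<and> unit (z i / z j)"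
proof (rule ccontr)
  assume no: "\<not> ?thesis"
  obtain j where j: "j \<in> I" "\<forall>i\<in>I. z i / z j \<in> V" using ex_minimal_value[of I z] assms(1-3) by blast
  have "(\<Sum>i\<in>I - {j}. z i / z j) \<in> nonunits"
    by (rule nonunits_sum) (use j no in \<open>auto simp: nonunits_def\<close>)
  moreover have "(\<Sum>i\<in>I - {j}. z i / z j) = - 1"
  proof -
    have "(\<Sum>i\<in>I. z i / z j) = 0" using assms by (simp flip: sum_divide_distrib)
    then show ?thesis using sum.remove[OF assms(1) j(1), of "\<lambda>i. z i / z j"] assms(3)[OF j(1)]
      by (simp add: eq_neg_iff_add_eq_0 add.commute)
  qed
  ultimately show False using nonunits_uminus one_notin_nonunits by fastforce
qed

text \<open>The Newton polygon in disguise: two terms of \<open>poly G y\<close> must balance, so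
  \<open>y ^ (j - i)\<close> is a quotient of coefficients up to a unit. The slope has denominator
  at most \<open>degree G\<close>.\<close>

lemma root_two_terms:
  assumes "poly G y = 0" "G \<noteq> 0" "y \<noteq> 0"
  shows "\<exists>i j. i < j \<and> j \<le> degree G \<and> coeff G i \<noteq> 0 \<and> coeff G j \<noteq> 0
    \<and> unit (y ^ (j - i) * (coeff G j / coeff G i))"
proof -
  define I where "I = {i. i \<le> degree G \<and> coeff G i \<noteq> 0}"
  have "(\<Sum>i\<in>I. coeff G i * y ^ i) = poly G y"
    unfolding poly_altdef I_def by (rule sum.mono_neutral_left) auto
  moreover have "degree G \<in> I" using assms by (simp add: I_def)
  moreover have "finite I" by (simp add: I_def)
  ultimately have "\<exists>i\<in>I. \<exists>j\<in>I. i \<noteq> j \<and> unit (coeff G i * y ^ i / (coeff G j * y ^ j))"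
    using assms by (intro sum_zero_two_terms) (auto simp: I_def)
  then obtain i j where ij: "i \<in> I" "j \<in> I" "i \<noteq> j" "unit (coeff G i * y ^ i / (coeff G j * y ^ j))"
    by blast
  have main: ?thesis if "i < j" "i \<in> I" "j \<in> I" "unit (coeff G j * y ^ j / (coeff G i * y ^ i))" for i j
  proof -
    have "coeff G j * y ^ j / (coeff G i * y ^ i) = y ^ (j - i) * (coeff G j / coeff G i)"
      using that assms by (simp add: field_simps I_def flip: power_add)
    then show ?thesis using that by (intro exI[of _ i] exI[of _ j]) (auto simp: I_def)
  qed
  show ?thesis
  proof (cases "i < j")
    case True
    then show ?thesis using main[OF True ij(1,2)] unit_inverse[OF ij(4)] by simp
  next
    case False
    then show ?thesis using main[of j i] ij by simp
  qed
qed

text \<open>By the balance of two terms, a power of \<open>y\<close> is commensurable with a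
  quotient of coefficients. In this way values pass to algebraic elements even if \<open>V\<close>
  has higher rank.\<close>

lemma root_has_val:
  assumes "poly G y = 0" "G \<noteq> 0" "y \<noteq> 0"
    and coeffs: "\<And>i. coeff G i \<noteq> 0 \<Longrightarrow> \<exists>r. has_val (coeff G i) r"
  shows "\<exists>r. has_val y r"
proof -
  obtain i j where ij: "i < j" "coeff G i \<noteq> 0" "coeff G j \<noteq> 0"
    and u: "unit (y ^ (j - i) * (coeff G j / coeff G i))"
    using root_two_terms[OF assms(1-3)] by blast
  obtain a b where "has_val (coeff G i) a" "has_val (coeff G j) b" using coeffs ij by metis
  then have "has_val (y ^ (j - i) * (coeff G j / coeff G i) / (coeff G j / coeff G i)) (0 - (b - a))"
    using u by (intro has_val_divide) (auto simp: has_val_unit_iff)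
  then have "has_val (y ^ (j - i)) (a - b)" using ij by simp
  then obtain t s where ts: "t > 0" "unit ((y ^ (j - i)) ^ t * \<pi> powi (- s))"
    by (auto simp: has_val_def)
  then show ?thesis using ij by (intro exI has_valI[of "(j - i) * t" _ s]) (auto simp: power_mult)
qed

end

section \<open>Subrings and Chevalley's extension theorem\<close>

definition subring_set :: "'l::comm_ring_1 set \<Rightarrow> bool" where
  "subring_set A \<longleftrightarrow> 1 \<in> A \<and> (\<forall>x\<in>A. \<forall>y\<in>A. x - y \<in> A \<and> x * y \<in> A)"

lemma subring_setD:
  assumes "subring_set A"
  shows "1 \<in> A" "0 \<in> A" "\<And>x y. x \<in> A \<Longrightarrow> y \<in> A \<Longrightarrow> x - y \<in> A"
    "\<And>x y. x \<in> A \<Longrightarrow> y \<in> A \<Longrightarrow> x * y \<in> A"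
    "\<And>x. x \<in> A \<Longrightarrow> - x \<in> A" "\<And>x y. x \<in> A \<Longrightarrow> y \<in> A \<Longrightarrow> x + y \<in> A"
    "\<And>x n. x \<in> A \<Longrightarrow> x ^ n \<in> A"
proof -
  show d: "x - y \<in> A" if "x \<in> A" "y \<in> A" for x y
    using assms that by (auto simp: subring_set_def)
  show m: "x * y \<in> A" if "x \<in> A" "y \<in> A" for x y using assms that by (auto simp: subring_set_def)
  show one: "1 \<in> A" using assms by (simp add: subring_set_def)
  show z: "0 \<in> A" using d[OF one one] by simp
  show u: "- x \<in> A" if "x \<in> A" for x using d[OF z that] by simp
  show "x + y \<in> A" if "x \<in> A" "y \<in> A" for x y using d[OF that(1) u[OF that(2)]] by simp
  show "x ^ n \<in> A" if "x \<in> A" for x n by (induction n) (auto intro: one m that)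
qed

lemma subring_set_sum:
  "subring_set A \<Longrightarrow> (\<And>i. i \<in> I \<Longrightarrow> f i \<in> A) \<Longrightarrow> sum f I \<in> A"
  by (induction I rule: infinite_finite_induct) (auto intro: subring_setD)

lemma subring_set_poly:
  assumes "subring_set A" "\<And>i. coeff f i \<in> A" "x \<in> A" shows "poly f x \<in> A"
  unfolding poly_altdef using assms by (intro subring_set_sum) (auto intro: subring_setD)

definition coeffs_in :: "'l::comm_ring_1 set \<Rightarrow> 'l poly set" where
  "coeffs_in A = {f. \<forall>i. coeff f i \<in> A}"

lemma subring_set_coeffs_in:
  assumes A: "subring_set A" shows "subring_set (coeffs_in A)"
  unfolding subring_set_def coeffs_in_def
  by (auto simp: coeff_mult coeff_1 intro!: subring_set_sum[OF A] subring_setD[OF A])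

definition adjoin :: "'l::comm_ring_1 set \<Rightarrow> 'l \<Rightarrow> 'l set" where
  "adjoin A x = {poly f x | f. f \<in> coeffs_in A}"

lemma subring_adjoin: assumes "subring_set A" shows "subring_set (adjoin A x)"
  unfolding subring_set_def
proof safe
  note S = subring_setD[OF subring_set_coeffs_in[OF assms]]
  show "1 \<in> adjoin A x" unfolding adjoin_def by (rule CollectI, rule exI[of _ 1]) (simp add: S)
  fix y z assume "y \<in> adjoin A x" "z \<in> adjoin A x"
  then obtain f g where fg: "f \<in> coeffs_in A" "g \<in> coeffs_in A" "y = poly f x" "z = poly g x"
    by (auto simp: adjoin_def)
  show "y - z \<in> adjoin A x" unfolding adjoin_def
    by (rule CollectI, rule exI[of _ "f - g"]) (simp add: S fg)
  show "y * z \<in> adjoin A x" unfolding adjoin_def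
    by (rule CollectI, rule exI[of _ "f * g"]) (simp add: S fg)
qed

lemma subset_adjoin: assumes "subring_set A" shows "A \<subseteq> adjoin A x" "x \<in> adjoin A x"
proof -
  show "A \<subseteq> adjoin A x"
  proof
    fix a assume "a \<in> A"
    then show "a \<in> adjoin A x" unfolding adjoin_def coeffs_in_def
      using subring_setD(2)[OF assms]
      by (intro CollectI exI[of _ "[:a:]"]) (auto simp: coeff_pCons split: nat.splits)
  qed
  show "x \<in> adjoin A x" unfolding adjoin_def coeffs_in_def
    using subring_setD(1,2)[OF assms]
    by (intro CollectI exI[of _ "[:0, 1:]"]) (auto simp: coeff_pCons split: nat.splits)
qed

lemma Union_chain_subring:
  assumes "\<C> \<noteq> {}" "\<And>A. A \<in> \<C> \<Longrightarrow> subring_set A" "\<And>A B. A \<in> \<C> \<Longrightarrow> B \<in> \<C> \<Longrightarrow> A \<subseteq> B \<or> B \<subseteq> A"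
  shows "subring_set (\<Union>\<C>)"
  unfolding subring_set_def
proof (intro conjI ballI)
  show "1 \<in> \<Union>\<C>" using assms(1,2) subring_setD(1) by blast
  fix x y assume "x \<in> \<Union>\<C>" "y \<in> \<Union>\<C>"
  then obtain A where "A \<in> \<C>" "x \<in> A" "y \<in> A" using assms(3) by blast
  then show "x - y \<in> \<Union>\<C>" "x * y \<in> \<Union>\<C>" using assms(2)[of A] subring_setD(3,4) by blast+
qed

text \<open>If neither \<open>x\<close> nor \<open>inverse x\<close> lies in \<open>V\<close>, then by maximality \<open>inverse \<pi>\<close> is a polynomial in
  either of them. The step \<open>reduce\<close> uses one of these expressions to lower the degree of the other.\<close>

lemma maximal_subring_total:
  fixes \<pi> :: "'l::field"
  assumes V: "subring_set V" "\<pi> \<in> V" "\<pi> \<noteq> 0" "inverse \<pi> \<notin> V"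
    and max: "\<And>B. subring_set B \<Longrightarrow> V \<subseteq> B \<Longrightarrow> inverse \<pi> \<notin> B \<Longrightarrow> B = V"
  shows "x \<in> V \<or> inverse x \<in> V"
proof (rule ccontr)
  assume no: "\<not> ?thesis"
  then have "x \<noteq> 0" using subring_setD(2)[OF V(1)] by auto
  note V' = subring_setD[OF V(1)]
  have inv: "inverse \<pi> \<in> adjoin V z" if "z \<notin> V" for z
    using max[OF subring_adjoin[OF V(1)] subset_adjoin(1)[OF V(1)], of z] subset_adjoin(2)[OF V(1), of z] that
    by blast
  \<comment> \<open>Maximality puts \<open>\<pi>\<close> into the Jacobson radical. Otherwise
    \<open>inverse \<pi>\<close> is a polynomial in \<open>z\<close>, and clearing denominators
    gives \<open>inverse \<pi> * (1 - \<pi> * b) ^ n \<in> V\<close>. The power is 1 plus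
    \<open>\<pi>\<close> times an element of \<open>V\<close>, so \<open>inverse \<pi>\<close>
    itself would lie in \<open>V\<close>.\<close>
  have unit: "inverse (1 - \<pi> * b) \<in> V" if b: "b \<in> V" for b
  proof (rule ccontr)
    define z where "z = inverse (1 - \<pi> * b)"
    assume "\<not> inverse (1 - \<pi> * b) \<in> V"
    then have "z \<notin> V" by (simp add: z_def)
    then have nz: "1 - \<pi> * b \<noteq> 0" unfolding z_def using V'(2) by auto
    obtain f where f: "f \<in> coeffs_in V" "inverse \<pi> = poly f z" 
      using inv[OF \<open>z \<notin> V\<close>] by (auto simp: adjoin_def)
    define n where "n = degree f"
    have "inverse \<pi> * (1 - \<pi> * b) ^ n = (\<Sum>i\<le>n. coeff f i * (1 - \<pi> * b) ^ (n - i))"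
      unfolding f(2) poly_altdef n_def[symmetric] sum_distrib_right
      using nz by (intro sum.cong) (auto simp: z_def power_diff field_simps)
    also have "\<dots> \<in> V" using f(1) b V
      by (intro subring_set_sum[OF V(1)] V'(4,7)) (auto simp: coeffs_in_def intro!: V'(3,4) V'(1))
    finally have 1: "inverse \<pi> * (1 - \<pi> * b) ^ n \<in> V" .
    have "[:1, - b:] ^ n \<in> coeffs_in V"
      using b V'(1,2,5)
      by (intro subring_setD(7)[OF subring_set_coeffs_in[OF V(1)]])
        (auto simp: coeffs_in_def coeff_pCons split: nat.splits)
    moreover obtain a g where g: "[:1, - b:] ^ n = pCons a g" by (cases "[:1, - b:] ^ n") auto
    moreover have "coeff ([:1, - b:] ^ n) 0 = 1" by (simp flip: poly_0_coeff_0)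
    ultimately have a: "a = 1" and c: "[:1, - b:] ^ n \<in> coeffs_in V" by simp_all
    have "coeff g i = coeff ([:1, - b:] ^ n) (Suc i)" for i by (simp add: g)
    then have gV: "g \<in> coeffs_in V" using c by (simp add: coeffs_in_def)
    have "(1 - \<pi> * b) ^ n = 1 + \<pi> * poly g \<pi>"
      using arg_cong[OF g, of "\<lambda>f. poly f \<pi>"] a by simp
    then have "inverse \<pi> = inverse \<pi> * (1 - \<pi> * b) ^ n - poly g \<pi>"
      using V(3) by (simp add: field_simps)
    also have "\<dots> \<in> V" using gV V 1 by (auto simp: coeffs_in_def intro!: V'(3) subring_set_poly)
    finally show False using V by simp
  qed
  define P where "P n z \<longleftrightarrow> (\<exists>f \<in> coeffs_in V. degree f \<le> n \<and> inverse \<pi> = poly f z)" for n z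
  have reduce: "P (n - 1) z" if Pn: "P n z" "P m (inverse z)" and "m \<le> n" "n > 0" "z \<noteq> 0" for n m z
  proof -
    obtain f where f: "f \<in> coeffs_in V" "degree f \<le> n" "inverse \<pi> = poly f z"
      using Pn(1) unfolding P_def by blast
    obtain g where g: "g \<in> coeffs_in V" "degree g \<le> m" "inverse \<pi> = poly g (inverse z)"
      using Pn(2) unfolding P_def by blast
    \<comment> \<open>The constant coefficient of \<open>g\<close> contributes
      \<open>b * z ^ n\<close>. Moved to the left it leaves the factor
      \<open>inverse \<pi> * (1 - \<pi> * b)\<close>, whose inverse \<open>\<pi> * u\<close> lies in
      \<open>V\<close>; so \<open>z ^ n\<close> equals a polynomial \<open>h\<close> in
      \<open>z\<close> of lower degree, which replaces the top monomial of \<open>f\<close>.\<close>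
    define b where "b = coeff g 0"
    have bV: "b \<in> V" using g by (auto simp: coeffs_in_def b_def)
    define u where "u = inverse (1 - \<pi> * b)"
    have uV: "u \<in> V" using unit[OF bV] by (simp add: u_def)
    have nz: "1 - \<pi> * b \<noteq> 0" using V(3,4) bV inverse_unique[of \<pi> b] by auto
    have "inverse \<pi> * z ^ n = (\<Sum>j\<le>m. coeff g j * z ^ (n - j))"
      unfolding g(3) poly_altdef sum_distrib_right
    proof (rule sum.mono_neutral_cong_left)
      show "coeff g i * inverse z ^ i * z ^ n = coeff g i * z ^ (n - i)" if "i \<in> {..degree g}" for i
        using that g(2) \<open>m \<le> n\<close> \<open>z \<noteq> 0\<close> by (simp add: power_diff field_simps)
    qed (use g in \<open>auto intro: coeff_eq_0\<close>)
    moreover have "\<dots> = b * z ^ n + (\<Sum>j=1..m. coeff g j * z ^ (n - j))"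
      unfolding b_def by (simp add: sum.atLeast1_atMost_eq sum.atMost_shift)
    moreover have inv_b: "inverse \<pi> * (1 - \<pi> * b) = inverse \<pi> - b"
      using V(3) by (simp add: right_diff_distrib flip: mult.assoc)
    ultimately have "inverse \<pi> * (1 - \<pi> * b) * z ^ n = (\<Sum>j=1..m. coeff g j * z ^ (n - j))"
      using inv_b by (simp add: left_diff_distrib)
    then have zn: "z ^ n = \<pi> * u * (\<Sum>j=1..m. coeff g j * z ^ (n - j))"
      using nz V(3) by (simp add: u_def field_simps)
    define h where "h = smult (\<pi> * u) (\<Sum>j=1..m. monom (coeff g j) (n - j))"
    have hz: "poly h z = z ^ n" unfolding zn h_def by (simp add: poly_sum poly_monom)
    have deg_h: "degree h \<le> n - 1" unfolding h_def
      by (intro order.trans[OF degree_smult_le] degree_sum_le) (auto intro!: order.trans[OF degree_monom_le])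
    have hV: "h \<in> coeffs_in V" using g uV V(2) V'(2) unfolding h_def coeffs_in_def
      by (auto simp: coeff_sum intro!: V'(4) subring_set_sum[OF V(1)])
    define c where "c = coeff f n"
    define f' where "f' = (f - monom c n) + smult c h"
    have "degree (f - monom c n) \<le> n - 1"
      by (intro degree_le) (use f(2) \<open>n > 0\<close> in \<open>auto simp: c_def coeff_eq_0\<close>)
    then have "degree f' \<le> n - 1" unfolding f'_def
      using deg_h by (intro degree_add_le order.trans[OF degree_smult_le])
    moreover have "f' \<in> coeffs_in V" using f hV V'(2) unfolding f'_def c_def coeffs_in_def
      by (auto intro!: V'(3,4,6))
    moreover have "poly f' z = inverse \<pi>" by (simp add: f'_def hz poly_monom f(3))
    ultimately show ?thesis by (auto simp: P_def)
  qed
  \<comment> \<open>Descent on \<open>n + m\<close>: the larger degree is lowered, with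
    \<open>z\<close> and \<open>inverse z\<close> exchanged if necessary. Degree 0 cannot occur, as
    it would put \<open>inverse \<pi>\<close> into \<open>V\<close>.\<close>
  have "P n z \<Longrightarrow> P m (inverse z) \<Longrightarrow> z \<noteq> 0 \<Longrightarrow> z \<notin> V \<Longrightarrow> inverse z \<notin> V \<Longrightarrow> False" for n m z
  proof (induction "n + m" arbitrary: n m z rule: less_induct)
    case less
    have pos: "n > 0" if Pn: "P n z" for n z
    proof (rule ccontr)
      assume "\<not> n > 0"
      then obtain f where f: "f \<in> coeffs_in V" "degree f = 0" "inverse \<pi> = poly f z"
        using Pn by (auto simp: P_def)
      then obtain a where "f = [:a:]" by (metis degree_eq_zeroE)
      then have "inverse \<pi> = coeff f 0" using f by simp
      then show False using f V by (auto simp: coeffs_in_def)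
    qed
    show False
    proof (cases "m \<le> n")
      case True
      then show False using less.hyps[of "n - 1" m z] reduce[of n z m] less.prems pos[OF less.prems(1)]
        by auto
    next
      case False
      then have *: "P (m - 1) (inverse z)" "m - 1 + n < n + m"
        using reduce[of m "inverse z" n] less.prems pos[OF less.prems(2)] by auto
      show False by (rule less.hyps[OF *(2,1)]) (use less.prems in simp_all)
    qed
  qed
  moreover have "\<exists>n. P n z" if "z \<notin> V" for z
    using inv[OF that] unfolding P_def adjoin_def by auto
  ultimately show False using no \<open>x \<noteq> 0\<close> by blast
qed

text \<open>Instead of ordering pairs of a ring and an ideal, Zorn's lemma is applied to the rings
  that avoid \<open>inverse \<pi>\<close>. Unions of chains still avoid it, and maximality for this
  one condition forces totality.\<close>

theorem valuation_ring_extension: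
  fixes \<pi> :: "'l::field"
  assumes A: "subring_set A" "\<pi> \<in> A" "\<pi> \<noteq> 0" "inverse \<pi> \<notin> A"
  shows "\<exists>V. A \<subseteq> V \<and> valuation_ring V \<pi>"
proof -
  define \<A> where "\<A> = {B. subring_set B \<and> A \<subseteq> B \<and> inverse \<pi> \<notin> B}"
  have "\<exists>M\<in>\<A>. \<forall>X\<in>\<A>. M \<subseteq> X \<longrightarrow> X = M"
  proof (rule subset_Zorn_nonempty)
    show "\<A> \<noteq> {}" using A by (auto simp: \<A>_def)
    fix \<C> assume C: "\<C> \<noteq> {}" "subset.chain \<A> \<C>"
    then have "subring_set (\<Union>\<C>)"
      by (intro Union_chain_subring) (auto simp: \<A>_def subset.chain_def)
    moreover have "inverse \<pi> \<notin> \<Union>\<C>"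
      using C by (auto simp: \<A>_def subset.chain_def)
    moreover have "A \<subseteq> \<Union>\<C>"
    proof -
      obtain B where "B \<in> \<C>" using C by auto
      then show ?thesis using C unfolding subset.chain_def \<A>_def by blast
    qed
    ultimately show "\<Union>\<C> \<in> \<A>" by (simp add: \<A>_def)
  qed
  then obtain V where V: "V \<in> \<A>" "\<And>X. X \<in> \<A> \<Longrightarrow> V \<subseteq> X \<Longrightarrow> X = V" by auto
  have "valuation_ring V \<pi>"
  proof
    show "x \<in> V \<or> inverse x \<in> V" for x
      using V A by (intro maximal_subring_total[of V \<pi>]) (auto simp: \<A>_def)
  qed (use V A in \<open>auto simp: \<A>_def intro: subring_setD\<close>)
  then show ?thesis using V by (auto simp: \<A>_def)
qed

section \<open>Ring homomorphisms and polynomials\<close>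

locale comm_ring_homomorphism =
  fixes h :: "'a::comm_ring_1 \<Rightarrow> 'b::comm_ring_1"
  assumes hom_add: "h (x + y) = h x + h y" and hom_mult: "h (x * y) = h x * h y" and hom_1: "h 1 = 1"
begin

lemma hom_0: "h 0 = 0" using hom_add[of 0 0] by simp
lemma hom_uminus: "h (- x) = - h x" using hom_add[of x "-x"] by (simp add: hom_0 eq_neg_iff_add_eq_0 add.commute)
lemma hom_diff: "h (x - y) = h x - h y" using hom_add[of x "-y"] by (simp add: hom_uminus)
lemma hom_power: "h (x ^ n) = h x ^ n" by (induction n) (simp_all add: hom_1 hom_mult)
lemma hom_sum: "h (sum f I) = (\<Sum>i\<in>I. h (f i))"
  by (induction I rule: infinite_finite_induct) (simp_all add: hom_0 hom_add)
lemma hom_of_nat: "h (of_nat n) = of_nat n" by (induction n) (simp_all add: hom_0 hom_1 hom_add)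
lemma hom_of_int: "h (of_int n) = of_int n"
  by (cases n rule: int_cases2) (simp_all add: hom_of_nat hom_uminus)

lemma map_poly_hom_add: "map_poly h (f + g) = map_poly h f + map_poly h g"
  by (intro poly_eqI) (simp add: coeff_map_poly hom_0 hom_add)
lemma map_poly_hom_mult: "map_poly h (f * g) = map_poly h f * map_poly h g"
  by (intro poly_eqI) (simp add: coeff_map_poly hom_0 coeff_mult hom_sum hom_mult)
lemma map_poly_hom_const: "map_poly h [:c:] = [:h c:]" by (simp add: map_poly_pCons hom_0)
lemma map_poly_homomorphism: "comm_ring_homomorphism (map_poly h)"
  by unfold_locales (simp_all add: map_poly_hom_add map_poly_hom_mult hom_1)
lemma poly_map_poly_hom: "poly (map_poly h f) (h x) = h (poly f x)"
  by (induction f) (simp_all add: map_poly_pCons hom_0 hom_add hom_mult)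

lemma subring_set_range: "subring_set (range h)"
  unfolding subring_set_def by (auto simp flip: hom_1 hom_diff hom_mult)

end

interpretation of_rat_hom: comm_ring_homomorphism "of_rat :: rat \<Rightarrow> 'a::field_char_0"
  by unfold_locales (simp_all add: of_rat_add of_rat_mult)
interpretation of_rat_poly: comm_ring_homomorphism "map_poly (of_rat :: rat \<Rightarrow> 'a::field_char_0)"
  by (rule of_rat_hom.map_poly_homomorphism)

lemma map_poly_of_rat_eq_0_iff [simp]: "map_poly of_rat f = 0 \<longleftrightarrow> f = 0"
  by (rule map_poly_eq_0_iff) auto

lemma poly_eval_range_subring: "subring_set (range (\<lambda>f :: rat poly. poly (map_poly of_rat f) (a :: 'a::field_char_0)))"
proof -
  interpret comm_ring_homomorphism "\<lambda>f :: rat poly. poly (map_poly of_rat f) a"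
    by unfold_locales (simp_all add: of_rat_poly.hom_add of_rat_poly.hom_mult)
  show ?thesis by (rule subring_set_range)
qed

lemma coeff_pcompose_in_subring:
  assumes "subring_set A" "\<And>i. coeff f i \<in> A" "\<And>i. coeff g i \<in> A"
  shows "coeff (pcompose f g) i \<in> A"
  by (rule coeff_pcompose_semiring_closed) (use assms in \<open>auto intro: subring_setD(4,6,1,2)\<close>)

lemma fact_mult_Ints:
  assumes "of_nat k * r \<in> \<int>" "0 < k" "k \<le> n" shows "fact n * (r :: real) \<in> \<int>"
proof -
  have "k dvd fact n" using assms by (intro dvd_fact) auto
  then obtain l where "fact n = k * l" by auto
  then have "(fact n :: real) = of_nat k * of_nat l" by (metis of_nat_fact of_nat_mult)
  then have "fact n * r = of_nat l * (of_nat k * r)" by simp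
  then show ?thesis using assms(1) by (metis Ints_mult Ints_of_nat)
qed

section \<open>The field of $p$-adic complex numbers\<close>

locale padic_complex =
  fixes p :: nat and v :: "'k::field_char_0 \<Rightarrow> ereal"
  assumes prime_p: "prime p" and is_Cp: "is_Cp p v"
begin

lemma
  shows v_eq_infinity_iff: "v x = \<infinity> \<longleftrightarrow> x = 0" and v_neq_minf: "v x \<noteq> - \<infinity>"
    and v_mult: "v (x * y) = v x + v y" and v_add_ge: "v (x + y) \<ge> min (v x) (v y)"
    and v_of_rat: "q \<noteq> 0 \<Longrightarrow> v (of_rat q) = ereal (of_int (padic_val_rat p q))"
    and v_complete: "(\<And>M::real. \<exists>N::nat. \<forall>m\<ge>N. \<forall>n\<ge>N. v (s m - s n) \<ge> ereal M) \<Longrightarrow>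
        \<exists>l. \<forall>M::real. \<exists>N. \<forall>n\<ge>N. v (s n - l) \<ge> ereal M"
    and alg_closed: "degree (f :: 'k poly) > 0 \<Longrightarrow> \<exists>x. poly f x = 0"
    and dense: "\<exists>y. alg_over_Q y \<and> v (x - y) \<ge> ereal M"
proof -
  note C = is_Cp[unfolded is_Cp_def]
  show "v x = \<infinity> \<longleftrightarrow> x = 0" using C by (elim conjE) (erule allE)
  show "v x \<noteq> - \<infinity>" using C by (elim conjE) (erule allE)
  show "v (x * y) = v x + v y" using C by (elim conjE) simp
  show "v (x + y) \<ge> min (v x) (v y)" using C by (elim conjE) simp
  show "q \<noteq> 0 \<Longrightarrow> v (of_rat q) = ereal (of_int (padic_val_rat p q))" using C by (elim conjE) simp
  have "\<forall>s :: nat \<Rightarrow> 'k. (\<forall>M::real. \<exists>N. \<forall>m\<ge>N. \<forall>n\<ge>N. v (s m - s n) \<ge> ereal M) \<longrightarrow>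
        (\<exists>l. \<forall>M::real. \<exists>N. \<forall>n\<ge>N. v (s n - l) \<ge> ereal M)" using C by (elim conjE)
  then show "(\<And>M::real. \<exists>N::nat. \<forall>m\<ge>N. \<forall>n\<ge>N. v (s m - s n) \<ge> ereal M) \<Longrightarrow>
        \<exists>l. \<forall>M::real. \<exists>N. \<forall>n\<ge>N. v (s n - l) \<ge> ereal M" by blast
  have "\<forall>f :: 'k poly. degree f > 0 \<longrightarrow> (\<exists>x. poly f x = 0)" using C by (elim conjE)
  then show "degree (f :: 'k poly) > 0 \<Longrightarrow> \<exists>x. poly f x = 0" by blast
  have "\<forall>x. \<forall>M::real. \<exists>y. alg_over_Q y \<and> v (x - y) \<ge> ereal M" using C by (elim conjE)
  then show "\<exists>y. alg_over_Q y \<and> v (x - y) \<ge> ereal M" by blast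
qed

lemma v_0 [simp]: "v 0 = \<infinity>" by (simp add: v_eq_infinity_iff)

text \<open>Real values allow ordinary arithmetic. At 0 the default is \<open>vr 0 = 0\<close>, not
  infinity, hence the side conditions below.\<close>

definition vr :: "'k \<Rightarrow> real" where "vr x = real_of_ereal (v x)"

lemma v_eq_vr: "x \<noteq> 0 \<Longrightarrow> v x = ereal (vr x)"
  unfolding vr_def using v_eq_infinity_iff[of x] v_neq_minf[of x] by (cases "v x") auto

lemma v_ge_iff: "v x \<ge> ereal M \<longleftrightarrow> x = 0 \<or> vr x \<ge> M"
  by (cases "x = 0") (auto simp: v_eq_vr)
lemma v_gt_iff: "v x > ereal M \<longleftrightarrow> x = 0 \<or> vr x > M"
  by (cases "x = 0") (auto simp: v_eq_vr)
lemma v_nonneg_iff: "v x \<ge> 0 \<longleftrightarrow> x = 0 \<or> vr x \<ge> 0" using v_ge_iff[of 0 x] by (simp add: zero_ereal_def)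
lemma v_pos_iff: "v x > 0 \<longleftrightarrow> x = 0 \<or> vr x > 0" using v_gt_iff[of 0 x] by (simp add: zero_ereal_def)

lemma vr_mult: "x \<noteq> 0 \<Longrightarrow> y \<noteq> 0 \<Longrightarrow> vr (x * y) = vr x + vr y"
  using v_mult[of x y] by (simp add: v_eq_vr)
lemma vr_1 [simp]: "vr 1 = 0" using vr_mult[of 1 1] by simp
lemma vr_power: "x \<noteq> 0 \<Longrightarrow> vr (x ^ n) = n * vr x"
  by (induction n) (simp_all add: vr_mult algebra_simps)
lemma vr_inverse: "x \<noteq> 0 \<Longrightarrow> vr (inverse x) = - vr x"
  using vr_mult[of x "inverse x"] by simp
lemma vr_divide: "x \<noteq> 0 \<Longrightarrow> y \<noteq> 0 \<Longrightarrow> vr (x / y) = vr x - vr y"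
  by (simp add: divide_inverse vr_mult vr_inverse)
lemma vr_powi: "x \<noteq> 0 \<Longrightarrow> vr (x powi n) = n * vr x"
  by (simp add: power_int_def vr_power vr_inverse)
lemma vr_uminus [simp]: "vr (- x) = vr x"
proof (cases "x = 0")
  case False
  have "2 * vr (- 1) = vr ((- 1) ^ 2)" by (subst vr_power) auto
  then have "vr (- 1) = 0" by simp
  then show ?thesis using vr_mult[of "-1" x] False by simp
qed simp
lemma v_uminus [simp]: "v (- x) = v x" by (cases "x = 0") (auto simp: v_eq_vr)
lemma v_minus_commute: "v (x - y) = v (y - x)" using v_uminus[of "x - y"] by simp
lemma v_diff_ge: "v (x - y) \<ge> min (v x) (v y)" using v_add_ge[of x "- y"] by simp
lemma v_1 [simp]: "v 1 = 0" by (simp add: v_eq_vr zero_ereal_def)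

lemma v_add_eq: assumes "v x < v y" shows "v (x + y) = v x"
proof (rule antisym)
  show "v (x + y) \<ge> v x" using v_add_ge[of x y] assms by (auto simp: min_def split: if_splits)
  show "v (x + y) \<le> v x" using v_diff_ge[of "x + y" y] assms by (auto simp: min_def split: if_splits)
qed
lemma v_diff_eq: "v x < v y \<Longrightarrow> v (x - y) = v x" using v_add_eq[of x "- y"] by simp

lemma v_sum_ge: "(\<And>i. i \<in> I \<Longrightarrow> v (f i) \<ge> c) \<Longrightarrow> v (sum f I) \<ge> c"
proof (induction I rule: infinite_finite_induct)
  case (insert x F)
  then have "c \<le> min (v (f x)) (v (sum f F))" by simp
  also have "\<dots> \<le> v (f x + sum f F)" by (rule v_add_ge)
  finally show ?case using insert by simp
qed auto

lemma padic_p: "padic_val_rat p (of_nat p) = 1"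
  unfolding padic_val_rat_def using prime_p
  by (simp add: quotient_of_int[of "int p", simplified] multiplicity_self prime_gt_1_nat)

lemma padic_int: "n \<noteq> 0 \<Longrightarrow> padic_val_rat p (of_int n) = int (multiplicity (int p) n)"
  by (simp add: padic_val_rat_def)

lemma v_p: "v (of_nat p) = 1"
  using v_of_rat[of "of_nat p"] prime_p by (simp add: padic_p one_ereal_def)
lemma vr_p [simp]: "vr (of_nat p) = 1" by (simp add: vr_def v_p)
lemma p_pos [simp]: "0 < p" using prime_p by (simp add: prime_gt_0_nat)
lemma p_nz: "(of_nat p :: 'a::field_char_0) \<noteq> 0" using prime_p by auto

lemma vr_of_rat: "q \<noteq> 0 \<Longrightarrow> vr (of_rat q) = of_int (padic_val_rat p q)"
  by (simp add: vr_def v_of_rat)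

lemma padic_mult: "x \<noteq> 0 \<Longrightarrow> y \<noteq> 0 \<Longrightarrow> padic_val_rat p (x * y) = padic_val_rat p x + padic_val_rat p y"
  using vr_mult[of "of_rat x" "of_rat y"] by (simp add: vr_of_rat flip: of_rat_mult)
lemma padic_divide: "x \<noteq> 0 \<Longrightarrow> y \<noteq> 0 \<Longrightarrow> padic_val_rat p (x / y) = padic_val_rat p x - padic_val_rat p y"
  using vr_divide[of "of_rat x" "of_rat y"] by (simp add: vr_of_rat flip: of_rat_divide)
lemma Zloc_iff: "c \<in> Zloc p \<longleftrightarrow> c = 0 \<or> padic_val_rat p c \<ge> 0"
proof -
  obtain a b where ab: "quotient_of c = (a, b)" by (cases "quotient_of c")
  have b: "b > 0" and cop: "coprime a b" using ab quotient_of_denom_pos quotient_of_coprime by auto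
  have pr: "prime (int p)" using prime_p by simp
  show ?thesis
  proof (cases "c = 0")
    case False
    then have "a \<noteq> 0" using ab quotient_of_div by fastforce
    have "multiplicity (int p) a = 0" if "int p dvd b"
      using that cop pr by (meson coprime_common_divisor not_dvd_imp_multiplicity_0 not_prime_unit)
    moreover have "multiplicity (int p) b > 0 \<longleftrightarrow> int p dvd b"
      using prime_multiplicity_gt_zero_iff[of "int p" b] pr b by auto
    ultimately show ?thesis using ab False unfolding Zloc_def padic_val_rat_def
      using not_dvd_imp_multiplicity_0[of "int p" b] by force
  qed (use prime_p in \<open>auto simp: Zloc_def\<close>)
qed

lemma v_of_int_nonneg: "v (of_int n) \<ge> 0"
  using v_of_rat[of "of_int n"] by (cases "n = 0") (simp_all add: padic_int)
lemma v_of_int_unit: "\<not> int p dvd n \<Longrightarrow> v (of_int n) = 0"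
  using v_of_rat[of "of_int n"]
  by (cases "n = 0") (simp_all add: padic_int not_dvd_imp_multiplicity_0)
lemma v_of_int_pos: assumes "int p dvd n" shows "v (of_int n) \<ge> 1"
proof -
  obtain m where "n = int p * m" using assms by auto
  then have "v (of_int n :: 'k) = 1 + v (of_int m)" by (simp add: v_mult v_p)
  then show ?thesis using add_left_mono[OF v_of_int_nonneg[of m], of 1] by simp
qed

lemma mem_Op: "x \<in> Op v \<longleftrightarrow> v x \<ge> 0" by (simp add: Op_def)

sublocale O: valuation_ring "Op v" "of_nat p"
proof
  fix x y :: 'k
  show "x - y \<in> Op v" if "x \<in> Op v" "y \<in> Op v"
    using that v_diff_ge[of x y] by (auto simp: mem_Op min_def split: if_splits)
  show "x \<in> Op v \<or> inverse x \<in> Op v"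
    by (cases "x = 0") (auto simp: mem_Op v_nonneg_iff vr_inverse)
  show "x * y \<in> Op v" if "x \<in> Op v" "y \<in> Op v"
    using that by (simp add: v_mult mem_Op)
qed (auto simp: v_p v_nonneg_iff vr_inverse mem_Op)

lemma v_eq_0_iff: "v x = 0 \<longleftrightarrow> x \<noteq> 0 \<and> vr x = 0"
  by (cases "x = 0") (auto simp: v_eq_vr)

lemma O_unit_iff: "O.unit x \<longleftrightarrow> v x = 0"
  by (cases "x = 0") (auto simp: O.unit_def mem_Op v_nonneg_iff vr_inverse v_eq_0_iff)

lemma O_has_val: assumes "O.has_val x r" shows "x \<noteq> 0" "vr x = r"
proof -
  show "x \<noteq> 0" using assms by (rule O.has_val_nz)
  then show "vr x = r" using assms
    by (auto simp: O.has_val_def O_unit_iff v_eq_0_iff vr_mult vr_power vr_powi field_simps)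
qed

lemma O_has_val_of_rat: "q \<noteq> 0 \<Longrightarrow> O.has_val (of_rat q) (of_int (padic_val_rat p q))"
  by (rule O.has_valI[of 1 _ "padic_val_rat p q"])
    (auto simp: O_unit_iff v_eq_0_iff vr_mult vr_powi vr_of_rat p_nz)

lemma O_has_val_algebraic: assumes "alg_over_Q x" "x \<noteq> 0" shows "O.has_val x (vr x)"
proof -
  obtain f :: "rat poly" where f: "f \<noteq> 0" "poly (map_poly of_rat f) x = 0"
    using assms by (auto simp: alg_over_Q_def)
  have "\<exists>r. O.has_val x r"
    by (rule O.root_has_val[OF f(2)]) (use f assms O_has_val_of_rat in \<open>auto simp: coeff_map_poly\<close>)
  then show ?thesis using O_has_val by blast
qed

text \<open>An algebraic number that approximates \<open>x\<close> beyond \<open>vr x\<close> has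
  the same value, so all values of C_p are rational. This keeps constants commensurable with
  \<open>p\<close> in every ring lying over \<open>O_p\<close>.\<close>

lemma O_has_val_all: assumes "x \<noteq> 0" shows "O.has_val x (vr x)"
proof -
  obtain y where y: "alg_over_Q y" "v (x - y) \<ge> ereal (vr x + 1)" using dense by blast
  have "v x < ereal (vr x + 1)" using assms by (simp add: v_eq_vr)
  then have "v (x - (x - y)) = v x" using y by (intro v_diff_eq) (rule less_le_trans)
  then have "v y = v x" by simp
  moreover have "v y \<noteq> \<infinity>" unfolding \<open>v y = v x\<close> using assms v_eq_infinity_iff by blast
  ultimately have "y \<noteq> 0" "vr y = vr x" by (auto simp: vr_def)
  then have "O.has_val y (vr x)" using O_has_val_algebraic[OF y(1)] by simp
  then show ?thesis using \<open>vr y = vr x\<close> \<open>y \<noteq> 0\<close> assms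
    by (auto simp: O.has_val_def O_unit_iff v_eq_0_iff vr_mult vr_powi vr_power)
qed

lemma alg_over_Q_algebraic: "alg_over_Q (x :: 'k) \<Longrightarrow> algebraic x"
  unfolding alg_over_Q_def
  by (auto intro!: algebraicI'[of "map_poly of_rat f" for f] simp: coeff_map_poly)

text \<open>Some algebraic number \<open>y\<close> has the residue class of \<open>c\<close>. The
  primitive part of an integer polynomial vanishing at \<open>y\<close> does not vanish modulo
  \<open>p\<close>, so the residue field of C_p is algebraic over the prime field.\<close>

lemma residue_algebraic:
  assumes "v c \<ge> 0"
  shows "\<exists>P :: int poly. (\<exists>i. \<not> int p dvd coeff P i) \<and> v (poly (map_poly of_int P) c) > 0"
proof -
  obtain y where y: "alg_over_Q y" "v (c - y) \<ge> ereal 1" using dense by blast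
  obtain P0 :: "int poly" where P0: "P0 \<noteq> 0" "poly (map_poly of_int P0) y = 0"
    using algebraicE'[OF alg_over_Q_algebraic[OF y(1)]] by blast
  define P where "P = primitive_part P0"
  have "P0 = smult (content P0) P" by (simp add: P_def)
  then have "map_poly (of_int :: int \<Rightarrow> 'k) P0 = smult (of_int (content P0)) (map_poly of_int P)"
    by (metis map_poly_smult of_int_0 of_int_mult)
  then have Py: "poly (map_poly of_int P) y = 0" using P0 by simp
  have "content P = 1" using P0 by (simp add: P_def)
  then have "\<not> [:int p:] dvd P" using prime_p
    by (auto simp: const_poly_dvd_iff_dvd_content)
  then have "\<exists>i. \<not> int p dvd coeff P i" by (simp add: const_poly_dvd_iff)
  moreover have "v (poly (map_poly of_int P) c) > 0"
  proof -
    have yO: "v y \<ge> 0"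
    proof -
      have "0 \<le> min (v c) (v (c - y))" using y assms by (simp add: order.trans[of 0 "ereal 1"])
      also have "\<dots> \<le> v (c - (c - y))" by (rule v_diff_ge)
      finally show ?thesis by simp
    qed
    have "poly (map_poly of_int P) c \<in> O.nonunits"
    proof (rule O.poly_eq_mod_nonunits[where y = y, THEN iffD2])
      have "v (c - y) > 0" using less_le_trans[OF _ y(2), of 0] by simp
      then show "c - y \<in> O.nonunits" by (auto simp: O.nonunits_def O_unit_iff mem_Op)
    qed (use Py assms yO v_of_int_nonneg in \<open>auto simp: coeff_map_poly O.nonunits_0 mem_Op\<close>)
    then show ?thesis by (auto simp: O.nonunits_def O_unit_iff mem_Op order_less_le)
  qed
  ultimately show ?thesis by blast
qed

text \<open>Rational coefficients have integer values, so the slope \<open>vr y\<close> has a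
  denominator of at most \<open>n\<close>. The factorial clears all such denominators, uniformly in
  \<open>y\<close>.\<close>

lemma root_value_bounded_denominator:
  assumes G: "G \<noteq> 0" "degree G \<le> n" "poly (map_poly of_rat G) y = 0" and "y \<noteq> 0"
  shows "fact n * vr y \<in> \<int>"
proof -
  let ?G = "map_poly (of_rat :: rat \<Rightarrow> 'k) G"
  obtain i j where ij: "i < j" "j \<le> degree ?G" "coeff ?G i \<noteq> 0" "coeff ?G j \<noteq> 0"
    "O.unit (y ^ (j - i) * (coeff ?G j / coeff ?G i))"
    using O.root_two_terms[OF G(3)] assms by auto
  have deg: "degree ?G = degree G" by (rule degree_map_poly) auto
  have "vr (y ^ (j - i) * (coeff ?G j / coeff ?G i)) = 0" using ij by (simp add: O_unit_iff v_eq_0_iff)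
  then have "of_nat (j - i) * vr y = vr (coeff ?G i) - vr (coeff ?G j)"
    using ij \<open>y \<noteq> 0\<close> by (simp add: vr_mult vr_divide vr_power)
  then have "of_nat (j - i) * vr y \<in> \<int>"
    using ij by (auto simp: coeff_map_poly vr_of_rat)
  then show ?thesis by (rule fact_mult_Ints) (use ij G deg in auto)
qed

end

section \<open>Linear algebra over the rationals\<close>

lemma rat_vector_space: "vector_space (\<lambda>q x. of_rat q * (x :: 'a::field_char_0))"
  by unfold_locales (auto simp: algebra_simps of_rat_add of_rat_mult)

text \<open>The powers of \<open>a\<close> span a space of dimension at most
  \<open>degree A\<close>, in which the \<open>Suc n\<close> powers of \<open>y\<close> must be
  dependent. A single degree bound for all \<open>y\<close> in Q[a] yields a common denominator of
  their values.\<close>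

lemma power_basis_bounds_degree:
  fixes a :: "'a::field_char_0"
  assumes A: "A \<noteq> 0" "poly (map_poly of_rat A) a = 0" and y: "y = poly (map_poly of_rat f) a"
  shows "\<exists>G :: rat poly. G \<noteq> 0 \<and> degree G \<le> degree A \<and> poly (map_poly of_rat G) y = 0"
proof -
  interpret vs: vector_space "\<lambda>q x. of_rat q * (x :: 'a)" by (rule rat_vector_space)
  define n where "n = degree A"
  have "n > 0"
  proof (rule ccontr)
    assume "\<not> n > 0"
    then obtain c where "A = [:c:]" by (metis n_def degree_eq_zeroE gr0I)
    then show False using A by (simp add: map_poly_pCons)
  qed
  define S where "S = (\<lambda>i. y ^ i) ` {..n}"
  define T where "T = (\<lambda>i. a ^ i) ` {..<n}"
  have T: "finite T" "card T \<le> n" unfolding T_def using card_image_le[of "{..<n}"] by auto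
  have "y ^ i \<in> vs.span T" for i
  proof -
    define r where "r = f ^ i mod A"
    have "f ^ i = f ^ i div A * A + r" by (simp add: r_def)
    then have "y ^ i = poly (map_poly of_rat (f ^ i div A * A + r)) a"
      by (metis y of_rat_poly.hom_power poly_power)
    also have "\<dots> = poly (map_poly of_rat r) a"
      using A by (simp add: of_rat_poly.hom_add of_rat_poly.hom_mult)
    also have "\<dots> = (\<Sum>j\<le>degree r. of_rat (coeff r j) * a ^ j)"
      by (simp add: poly_altdef degree_map_poly coeff_map_poly)
    also have "\<dots> \<in> vs.span T"
    proof (rule vs.span_sum, rule vs.span_scale, rule vs.span_base)
      fix j assume "j \<in> {..degree r}"
      moreover have "degree r < n" using degree_mod_less'[of A "f ^ i"] A \<open>n > 0\<close>
        unfolding r_def n_def by (cases "f ^ i mod A = 0") auto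
      ultimately show "a ^ j \<in> T" by (auto simp: T_def)
    qed
    finally show ?thesis .
  qed
  then have span: "S \<subseteq> vs.span T" by (auto simp: S_def)
  show ?thesis
  proof (cases "inj_on (\<lambda>i. y ^ i) {..n}")
    case True
    then have "card S = Suc n" by (simp add: S_def card_image)
    then have "vs.dependent S" using vs.independent_span_bound[OF T(1) _ span] T(2) by auto
    then obtain u where u: "\<exists>x\<in>S. u x \<noteq> 0" "(\<Sum>x\<in>S. of_rat (u x) * x) = 0"
      using vs.dependent_finite[of S] by (auto simp: S_def)
    define G where "G = (\<Sum>i\<le>n. monom (u (y ^ i)) i)"
    have cG: "coeff G i = (if i \<le> n then u (y ^ i) else 0)" for i
      by (simp add: G_def coeff_sum)
    have "degree G \<le> n" by (rule degree_le) (simp add: cG)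
    moreover have "G \<noteq> 0" using u(1) cG by (auto simp: S_def) (metis coeff_0)
    moreover have "poly (map_poly of_rat G) y = (\<Sum>i\<le>n. of_rat (u (y ^ i)) * y ^ i)"
      by (simp add: G_def of_rat_poly.hom_sum poly_sum map_poly_monom poly_monom)
    then have "poly (map_poly of_rat G) y = 0" using u(2) True by (simp add: S_def sum.reindex)
    ultimately show ?thesis by (auto simp: n_def)
  next
    \<comment> \<open>Coinciding powers collapse in the set \<open>S\<close>, so independence of
      sets cannot detect them; in that case \<open>X ^ j - X ^ i\<close> has the root
      \<open>y\<close>.\<close>
    case False
    then obtain i j where ij: "i < j" "j \<le> n" "y ^ i = y ^ j"
      unfolding inj_on_def by (metis atMost_iff linorder_neqE_nat)
    define G where "G = monom 1 j - (monom 1 i :: rat poly)"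
    have "coeff G j = 1" using ij by (simp add: G_def)
    then have "G \<noteq> 0" by auto
    moreover have "degree G \<le> n" unfolding G_def
      using ij by (intro degree_diff_le) (auto intro: order.trans[OF degree_monom_le])
    moreover have "poly (map_poly of_rat G) y = 0"
      using ij by (simp add: G_def of_rat_poly.hom_diff map_poly_monom poly_monom)
    ultimately show ?thesis by (auto simp: n_def)
  qed
qed

text \<open>The identity on the line through 1 extends to the whole space. Such a retraction turns a
  relation over C_p into one over \<rat> and fixes the rational side of it.\<close>

lemma ex_rat_linear_functional:
  "\<exists>l :: 'a::field_char_0 \<Rightarrow> rat. (\<forall>x y. l (x + y) = l x + l y) \<and> (\<forall>q x. l (of_rat q * x) = q * l x) \<and> l 1 = 1"
proof -
  interpret vp: vector_space_pair "\<lambda>q x. of_rat q * (x :: 'a)" "(*) :: rat \<Rightarrow> rat \<Rightarrow> rat"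
    by (intro vector_space_pair.intro rat_vector_space) (unfold_locales, auto simp: algebra_simps)
  have "vp.vs1.independent {1}" by simp
  then obtain l where l: "Vector_Spaces.linear (\<lambda>q x. of_rat q * (x :: 'a)) (*) l" "\<forall>x\<in>{1}. l x = 1"
    using vp.linear_independent_extend[of "{1}" "\<lambda>_. 1"] by blast
  interpret l: Vector_Spaces.linear "\<lambda>q x. of_rat q * (x :: 'a)" "(*)" l by (rule l(1))
  show ?thesis using l(2) l.add l.scale by (intro exI[of _ l]) auto
qed

context padic_complex begin

lemma algebraic_values_discrete:
  assumes "alg_over_Q a"
  shows "\<exists>N>0. \<forall>f :: rat poly. poly (map_poly of_rat f) a \<noteq> 0 \<longrightarrow>
    of_nat N * vr (poly (map_poly of_rat f) a) \<in> \<int>"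
proof -
  obtain A :: "rat poly" where A: "A \<noteq> 0" "poly (map_poly of_rat A) a = 0"
    using assms by (auto simp: alg_over_Q_def)
  have "of_nat (fact (degree A)) * vr (poly (map_poly of_rat f) a) \<in> \<int>"
    if "poly (map_poly of_rat f) a \<noteq> 0" for f
    using power_basis_bounds_degree[OF A refl, of f] root_value_bounded_denominator that
    by (auto simp: of_nat_fact)
  then show ?thesis by (intro exI[of _ "fact (degree A)"]) auto
qed

end

section \<open>Monomial valuations\<close>

context padic_complex begin

lemma v_sum_gt: "(\<And>i. i \<in> I \<Longrightarrow> v (f i) > c) \<Longrightarrow> c < \<infinity> \<Longrightarrow> v (sum f I) > c"
proof (induction I rule: infinite_finite_induct)
  case (insert x F)
  then have "c < min (v (f x)) (v (sum f F))" by simp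
  also have "\<dots> \<le> v (f x + sum f F)" by (rule v_add_ge)
  finally show ?case using insert by simp
qed auto

text \<open>The minimum \<open>m\<close> of \<open>v(F\<^sub>j) + j \<delta>\<close> is attained first at \<open>j = i\<close>. Recording the first index makes the
  pair \<open>(i, m)\<close> additive under multiplication, since the corresponding term of a product cannot cancel.\<close>
definition first_min :: "real \<Rightarrow> 'k poly \<Rightarrow> nat \<Rightarrow> real \<Rightarrow> bool" where
  "first_min \<delta> F i m \<longleftrightarrow> v (coeff F i) = ereal (m - \<delta> * i) \<and>
     (\<forall>j. v (coeff F j) \<ge> ereal (m - \<delta> * j)) \<and> (\<forall>j<i. v (coeff F j) > ereal (m - \<delta> * j))"

lemma ex_first_min:
  assumes "F \<noteq> 0" shows "\<exists>i m. first_min \<delta> F i m"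
proof -
  define I where "I = {j. j \<le> degree F \<and> coeff F j \<noteq> 0}"
  define g where "g j = vr (coeff F j) + \<delta> * j" for j
  have I: "finite I" "degree F \<in> I" using assms by (auto simp: I_def)
  have cI: "coeff F j \<noteq> 0 \<longleftrightarrow> j \<in> I" for j by (auto simp: I_def intro: le_degree)
  define m where "m = Min (g ` I)"
  have ex: "\<exists>i. i \<in> I \<and> g i = m"
  proof -
    have "m \<in> g ` I" unfolding m_def using I by (intro Min_in) auto
    then show ?thesis by auto
  qed
  define i where "i = (LEAST i. i \<in> I \<and> g i = m)"
  have i: "i \<in> I" "g i = m" using LeastI_ex[OF ex] by (auto simp: i_def)
  have least: "g j \<noteq> m" if "j \<in> I" "j < i" for j using not_less_Least[of j] that by (auto simp: i_def)
  have ge: "g j \<ge> m" if "j \<in> I" for j using that I by (auto simp: m_def)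
  have "first_min \<delta> F i m" unfolding first_min_def
  proof (intro conjI allI impI)
    show "v (coeff F i) = ereal (m - \<delta> * i)" using i cI by (auto simp: v_eq_vr g_def)
    show "v (coeff F j) \<ge> ereal (m - \<delta> * j)" for j
      using ge[of j] cI[of j] by (auto simp: v_ge_iff g_def algebra_simps)
    show "v (coeff F j) > ereal (m - \<delta> * j)" if "j < i" for j
      using ge[of j] least[of j] cI[of j] that by (auto simp: v_gt_iff g_def algebra_simps)
  qed
  then show ?thesis by blast
qed

lemma first_min_unique: assumes "first_min \<delta> F i m" "first_min \<delta> F j n" shows "m = n" "i = j"
proof -
  have le: "m \<le> n" if "first_min \<delta> F i m" "first_min \<delta> F j n" for i j m n
  proof -
    have "ereal (m - \<delta> * j) \<le> v (coeff F j)" "v (coeff F j) = ereal (n - \<delta> * j)"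
      using that unfolding first_min_def by blast+
    then show ?thesis by simp
  qed
  show "m = n" using le[OF assms] le[OF assms(2,1)] by simp
  have "\<not> i < j" if "first_min \<delta> F i m" "first_min \<delta> F j m" for i j
  proof
    assume "i < j"
    then have "ereal (m - \<delta> * i) < v (coeff F i)" "v (coeff F i) = ereal (m - \<delta> * i)"
      using that unfolding first_min_def by blast+
    then show False by simp
  qed
  then show "i = j" using assms \<open>m = n\<close> by (meson linorder_neqE_nat)
qed

lemma first_min_mult:
  assumes F: "first_min \<delta> F i m" and G: "first_min \<delta> G j n"
  shows "first_min \<delta> (F * G) (i + j) (m + n)"
proof -
  have c: "ereal (m - \<delta> * s) + ereal (n - \<delta> * (k - s)) = ereal (m + n - \<delta> * k)" if "s \<le> k" for s k :: nat
    using that by (simp add: of_nat_diff algebra_simps)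
  have ge: "v (coeff F s * coeff G (k - s)) \<ge> ereal (m + n - \<delta> * k)" if "s \<le> k" for s k
    using F G unfolding c[OF that, symmetric] v_mult first_min_def by (intro add_mono) auto
  \<comment> \<open>Here one of the two factors comes before its first minimum, which makes the
    estimate strict. This covers every \<open>s\<close> if \<open>k < i + j\<close>, and every
    \<open>s\<close> except \<open>i\<close> if \<open>k = i + j\<close>.\<close>
  have gt: "v (coeff F s * coeff G (k - s)) > ereal (m + n - \<delta> * k)" if "s \<le> k" "s < i \<or> k - s < j" for s k
  proof -
    have "coeff F s * coeff G (k - s) = 0 \<or> vr (coeff F s * coeff G (k - s)) > m + n - \<delta> * k"
    proof (cases "coeff F s = 0 \<or> coeff G (k - s) = 0")
      case False
      have "vr (coeff F s) \<ge> m - \<delta> * s" "vr (coeff G (k - s)) \<ge> n - \<delta> * (k - s)"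
        "vr (coeff F s) > m - \<delta> * s \<or> vr (coeff G (k - s)) > n - \<delta> * (k - s)"
        using F G False that unfolding first_min_def v_ge_iff v_gt_iff by blast+
      then show ?thesis using False that(1) by (auto simp: vr_mult of_nat_diff algebra_simps)
    qed auto
    then show ?thesis by (auto simp: v_gt_iff)
  qed
  show ?thesis unfolding first_min_def coeff_mult
  proof (intro conjI allI impI)
    fix k
    show "v (\<Sum>s\<le>k. coeff F s * coeff G (k - s)) \<ge> ereal (m + n - \<delta> * k)"
      by (rule v_sum_ge) (use ge in auto)
    show "v (\<Sum>s\<le>k. coeff F s * coeff G (k - s)) > ereal (m + n - \<delta> * k)" if "k < i + j"
    proof (rule v_sum_gt)
      show "ereal (m + n - \<delta> * k) < v (coeff F s * coeff G (k - s))" if "s \<in> {..k}" for s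
        using that \<open>k < i + j\<close> by (intro gt) auto
    qed simp
  next
    let ?k = "i + j"
    have "v (coeff F i * coeff G (?k - i)) = ereal (m + n - \<delta> * ?k)"
      using F G by (simp add: v_mult first_min_def algebra_simps)
    moreover have "v (\<Sum>s\<in>{..?k} - {i}. coeff F s * coeff G (?k - s)) > ereal (m + n - \<delta> * ?k)"
    proof (rule v_sum_gt)
      fix s assume "s \<in> {..?k} - {i}"
      then show "ereal (m + n - \<delta> * ?k) < v (coeff F s * coeff G (?k - s))" by (intro gt) auto
    qed simp
    moreover have "(\<Sum>s\<le>?k. coeff F s * coeff G (?k - s)) =
        coeff F i * coeff G (?k - i) + (\<Sum>s\<in>{..?k} - {i}. coeff F s * coeff G (?k - s))"
      by (rule sum.remove) auto
    ultimately show "v (\<Sum>s\<le>?k. coeff F s * coeff G (?k - s)) = ereal (m + n - \<delta> * ?k)"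
      by (simp only: v_add_eq)
  qed
qed

lemma first_min_1: "first_min \<delta> 1 0 0"
  by (auto simp: first_min_def zero_ereal_def[symmetric] coeff_1)

lemma first_min_power: "first_min \<delta> F i m \<Longrightarrow> first_min \<delta> (F ^ n) (n * i) (n * m)"
proof (induction n)
  case (Suc n)
  then show ?case using first_min_mult[of \<delta> F i m "F ^ n" "n * i" "n * m"] by (simp add: algebra_simps)
qed (use first_min_1 in simp)

text \<open>The monomial valuation with centre \<open>a\<close>, here for real
  \<open>\<delta>\<close> and meaningful for \<open>F \<noteq> 0\<close>. The index in
  \<open>first_min\<close> serves to prove multiplicativity and is then forgotten.\<close>

definition gauss :: "real \<Rightarrow> 'k \<Rightarrow> 'k poly \<Rightarrow> real" where
  "gauss \<delta> a F = (THE m. \<exists>i. first_min \<delta> (pcompose F [:a, 1:]) i m)"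

lemma gauss_eqI: "first_min \<delta> (pcompose F [:a, 1:]) i m \<Longrightarrow> gauss \<delta> a F = m"
  unfolding gauss_def using first_min_unique by blast

lemma ex_first_min_gauss:
  assumes "F \<noteq> 0" shows "\<exists>i. first_min \<delta> (pcompose F [:a, 1:]) i (gauss \<delta> a F)"
proof -
  have "pcompose F [:a, 1:] \<noteq> 0" using assms by (auto simp: pcompose_eq_0)
  then show ?thesis using ex_first_min gauss_eqI by metis
qed

lemma gauss_mult: assumes "F \<noteq> 0" "G \<noteq> 0" shows "gauss \<delta> a (F * G) = gauss \<delta> a F + gauss \<delta> a G"
proof -
  obtain i j where "first_min \<delta> (pcompose F [:a, 1:]) i (gauss \<delta> a F)"
    "first_min \<delta> (pcompose G [:a, 1:]) j (gauss \<delta> a G)" using ex_first_min_gauss assms by blast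
  then show ?thesis by (intro gauss_eqI[of _ _ _ "i + j"]) (simp add: pcompose_mult first_min_mult)
qed

lemma gauss_add_ge:
  assumes "F \<noteq> 0" "G \<noteq> 0" "F + G \<noteq> 0"
  shows "gauss \<delta> a (F + G) \<ge> min (gauss \<delta> a F) (gauss \<delta> a G)"
proof -
  let ?F = "pcompose F [:a, 1:]" and ?G = "pcompose G [:a, 1:]"
  obtain i j k where 1: "first_min \<delta> ?F i (gauss \<delta> a F)" "first_min \<delta> ?G j (gauss \<delta> a G)"
    "first_min \<delta> (?F + ?G) k (gauss \<delta> a (F + G))"
    using ex_first_min_gauss[OF assms(1)] ex_first_min_gauss[OF assms(2)] ex_first_min_gauss[OF assms(3)]
    unfolding pcompose_add by blast
  have "ereal (min (gauss \<delta> a F) (gauss \<delta> a G) - \<delta> * k) \<le> min (v (coeff ?F k)) (v (coeff ?G k))"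
  proof (rule min.boundedI)
    show "ereal (min (gauss \<delta> a F) (gauss \<delta> a G) - \<delta> * k) \<le> v (coeff ?F k)"
    proof (rule order.trans)
      show "ereal (gauss \<delta> a F - \<delta> * k) \<le> v (coeff ?F k)"
        using 1(1) unfolding first_min_def by blast
    qed simp
    show "ereal (min (gauss \<delta> a F) (gauss \<delta> a G) - \<delta> * k) \<le> v (coeff ?G k)"
    proof (rule order.trans)
      show "ereal (gauss \<delta> a G - \<delta> * k) \<le> v (coeff ?G k)"
        using 1(2) unfolding first_min_def by blast
    qed simp
  qed
  also have "\<dots> \<le> v (coeff (?F + ?G) k)" unfolding coeff_add by (rule v_add_ge)
  also have "\<dots> = ereal (gauss \<delta> a (F + G) - \<delta> * k)" using 1(3) by (simp add: first_min_def)
  finally show ?thesis by simp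
qed

lemma gauss_const: "c \<noteq> 0 \<Longrightarrow> gauss \<delta> a [:c:] = vr c"
  by (rule gauss_eqI[of _ _ _ 0]) (auto simp: first_min_def v_eq_vr coeff_pCons split: nat.splits)

text \<open>Around \<open>a\<close> the polynomial is \<open>(a - b) + (X - a)\<close>. A valuation
  of Q(X) is later recognised as monomial because its values on linear factors obey this same
  formula.\<close>

lemma gauss_linear: "ereal (gauss \<delta> a [:- b, 1:]) = min (ereal \<delta>) (v (a - b))"
proof -
  have c: "pcompose [:- b, 1:] [:a, 1:] = [:a - b, 1:]" by (simp add: pcompose_pCons)
  show ?thesis
  proof (cases "v (a - b) \<le> ereal \<delta>")
    case True
    then have "a - b \<noteq> 0" by auto
    then have "first_min \<delta> [:a - b, 1:] 0 (vr (a - b))" using True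
      by (auto simp: first_min_def v_eq_vr coeff_pCons zero_ereal_def[symmetric] v_nonneg_iff v_ge_iff split: nat.splits)
    then show ?thesis using True \<open>a - b \<noteq> 0\<close> by (subst gauss_eqI[of _ _ _ 0]) (auto simp: c v_eq_vr)
  next
    case False
    then have "first_min \<delta> [:a - b, 1:] 1 \<delta>"
      by (auto simp: first_min_def coeff_pCons zero_ereal_def[symmetric] split: nat.splits)
    then show ?thesis using False by (subst gauss_eqI[of _ _ _ 1]) (auto simp: c)
  qed
qed

lemma val_pad_Some:
  assumes "f \<noteq> 0"
  shows "val_pad v a (Some \<delta>) f = ereal (gauss (of_rat \<delta>) a (map_poly of_rat f))"
proof -
  let ?F = "map_poly of_rat f :: 'k poly" and ?\<delta> = "of_rat \<delta> :: real"
  obtain i where i: "first_min ?\<delta> (pcompose ?F [:a, 1:]) i (gauss ?\<delta> a ?F)"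
    using ex_first_min_gauss[of ?F] assms by auto
  show ?thesis unfolding val_pad_def option.case
  proof (rule antisym)
    let ?g = "\<lambda>i. v (coeff (pcompose ?F [:a, 1:]) i) + ereal (?\<delta> * real i)"
    have "(INF i. ?g i) \<le> ?g i" by (rule INF_lower) simp
    also have "?g i = ereal (gauss ?\<delta> a ?F)" using i by (simp add: first_min_def)
    finally show "(INF i. ?g i) \<le> ereal (gauss ?\<delta> a ?F)" .
    show "ereal (gauss ?\<delta> a ?F) \<le> (INF i. ?g i)"
    proof (rule INF_greatest)
      fix j :: nat
      have "ereal (gauss ?\<delta> a ?F) = ereal (gauss ?\<delta> a ?F - ?\<delta> * j) + ereal (?\<delta> * j)" by simp
      also have "\<dots> \<le> ?g j" using i by (intro add_right_mono) (auto simp: first_min_def)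
      finally show "ereal (gauss ?\<delta> a ?F) \<le> ?g j" .
    qed
  qed
qed

lemma val_pad_0: "val_pad v a d 0 = \<infinity>"
  by (cases d) (auto simp: val_pad_def)

text \<open>Algebraic closedness as an induction rule. The proof runs over all polynomials whose
  roots are roots of \<open>F\<close>, so that each factor split off belongs to a root of
  \<open>F\<close>.\<close>

lemma split_induct [consumes 1, case_names const linear]:
  fixes F :: "'k poly"
  assumes "F \<noteq> 0" and "\<And>c. c \<noteq> 0 \<Longrightarrow> P [:c:]"
    and "\<And>b G. G \<noteq> 0 \<Longrightarrow> poly F b = 0 \<Longrightarrow> P G \<Longrightarrow> P ([:- b, 1:] * G)"
  shows "P F"
proof -
  have "P G" if "G \<noteq> 0" "\<And>b. poly G b = 0 \<Longrightarrow> poly F b = 0" for G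
    using that
  proof (induction "degree G" arbitrary: G)
    case 0
    then show ?case using assms(2) by (metis degree_eq_zeroE pCons_0_0)
  next
    case (Suc n)
    then obtain b where b: "poly G b = 0" using alg_closed[of G] by auto
    then obtain H where H: "G = [:- b, 1:] * H" by (metis poly_eq_0_iff_dvd dvdE)
    then have "H \<noteq> 0" using Suc by auto
    moreover have "degree G = Suc (degree H)" using H \<open>H \<noteq> 0\<close> by (subst H, subst degree_mult_eq) auto
    ultimately have "P H" using Suc H by (intro Suc.hyps(1)) auto
    then show ?case using H assms(3)[OF \<open>H \<noteq> 0\<close>] b Suc.prems by auto
  qed
  then show ?thesis using assms(1) by blast
qed

text \<open>A centre matters only up to distance \<open>\<delta>\<close>, since the values of linear
  factors do not change when it moves within that ball. By density the centre can then be chosen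
  algebraic over \<rat>.\<close>

lemma gauss_recenter:
  assumes "v (a - a') \<ge> ereal \<delta>" "F \<noteq> 0" shows "gauss \<delta> a F = gauss \<delta> a' F"
  using assms(2)
proof (induction F rule: split_induct)
  case (linear b G)
  have le: "min (ereal \<delta>) (v (a - b)) \<le> min (ereal \<delta>) (v (a' - b))" if "v (a - a') \<ge> ereal \<delta>" for a a'
  proof -
    have "min (ereal \<delta>) (v (a - b)) \<le> min (v (a - a')) (v (a - b))" using that by (intro min.mono) auto
    also have "\<dots> \<le> v (a' - b)" using v_diff_ge[of "a - b" "a - a'"] by (simp add: min.commute)
    finally show ?thesis by simp
  qed
  have "ereal (gauss \<delta> a [:- b, 1:]) = ereal (gauss \<delta> a' [:- b, 1:])"
    unfolding gauss_linear using le[OF assms(1)] le[of a' a] assms(1) v_minus_commute[of a a'] by (simp add: antisym)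
  then show ?case using linear by (simp add: gauss_mult del: mult_pCons_left)
qed (simp add: gauss_const)

end

section \<open>Valuations of $\mathbb{Q}(X)$\<close>

lemma Fract_eq_0_iff: "g \<noteq> 0 \<Longrightarrow> Fract f g = 0 \<longleftrightarrow> f = (0 :: 'a::idom)"
  by (simp add: Zero_fract_def eq_fract)

interpretation constQX: comm_ring_homomorphism constQX
  by unfold_locales (simp_all add: constQX_def One_fract_def one_pCons mult.commute)

lemma constQX_eq_0_iff [simp]: "constQX c = 0 \<longleftrightarrow> c = 0"
  by (simp add: constQX_def Fract_eq_0_iff)

text \<open>Functions on fractions are defined below through a chosen representative. The
  cross-multiplied equation makes their values independent of the choice.\<close>

lemma fract_choice:
  assumes "g \<noteq> 0"
  obtains f' g' where "(SOME (f', g'). g' \<noteq> 0 \<and> Fract f g = Fract f' g') = (f', g')"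
    "g' \<noteq> 0" "f * g' = f' * (g :: 'a::idom)"
proof -
  define P where "P = (\<lambda>(f', g'). g' \<noteq> 0 \<and> Fract f g = Fract f' g')"
  obtain f' g' where fg: "(SOME z. P z) = (f', g')" by (cases "SOME z. P z")
  have "P (SOME z. P z)" by (rule someI[of P "(f, g)"]) (simp add: P_def assms)
  then have "g' \<noteq> 0" "Fract f g = Fract f' g'" unfolding fg by (auto simp: P_def)
  then show ?thesis using that fg assms by (simp add: P_def eq_fract)
qed

locale idom_embedding = comm_ring_homomorphism h for h :: "'a::idom \<Rightarrow> 'b::field" +
  assumes hom_eq_0: "h x = 0 \<Longrightarrow> x = 0"
begin

definition fract_hom :: "'a fract \<Rightarrow> 'b" where
  "fract_hom x = (case (SOME (f, g). g \<noteq> 0 \<and> x = Fract f g) of (f, g) \<Rightarrow> h f / h g)"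

lemma hom_eq_0_iff: "h x = 0 \<longleftrightarrow> x = 0" using hom_eq_0 hom_0 by auto

lemma fract_hom_Fract: assumes "g \<noteq> 0" shows "fract_hom (Fract f g) = h f / h g"
proof -
  obtain f' g' where fg: "(SOME (f', g'). g' \<noteq> 0 \<and> Fract f g = Fract f' g') = (f', g')"
    "g' \<noteq> 0" "f * g' = f' * g" using fract_choice[OF assms] .
  have "h f * h g' = h f' * h g" using fg(3) by (simp flip: hom_mult)
  then have "h f / h g = h f' / h g'" using assms fg(2) by (simp add: hom_eq_0_iff field_simps)
  then show ?thesis by (simp add: fract_hom_def fg(1))
qed

lemma fract_hom: "comm_ring_homomorphism fract_hom"
proof
  fix x y :: "'a fract"
  obtain f g where x: "x = Fract f g" "g \<noteq> 0" by (cases x)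
  obtain f' g' where y: "y = Fract f' g'" "g' \<noteq> 0" by (cases y)
  show "fract_hom (x + y) = fract_hom x + fract_hom y"
    using x y by (simp add: fract_hom_Fract hom_add hom_mult hom_eq_0_iff add_frac_eq)
  show "fract_hom (x * y) = fract_hom x * fract_hom y"
    using x y by (simp add: fract_hom_Fract hom_mult)
qed (simp add: One_fract_def fract_hom_Fract hom_1)

lemma fract_hom_eq_0_iff: "fract_hom x = 0 \<longleftrightarrow> x = 0"
  by (cases x) (auto simp: fract_hom_Fract hom_eq_0_iff Fract_eq_0_iff)

end

section \<open>Valuations of Q(X) given by their values on Q[X]\<close>

locale poly_valuation =
  fixes p :: nat and m :: "rat poly \<Rightarrow> real"
  assumes m_mult: "f \<noteq> 0 \<Longrightarrow> g \<noteq> 0 \<Longrightarrow> m (f * g) = m f + m g"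
    and m_add_ge: "f \<noteq> 0 \<Longrightarrow> g \<noteq> 0 \<Longrightarrow> f + g \<noteq> 0 \<Longrightarrow> m (f + g) \<ge> min (m f) (m g)"
    and m_const: "c \<noteq> 0 \<Longrightarrow> m [:c:] = of_int (padic_val_rat p c)"

text \<open>With the ring read off from nonzero polynomials, two such rings are equal once the
  valuations agree there, where \<open>val_pad\<close> is defined and factorisation is
  available.\<close>

definition ring_of :: "(rat poly \<Rightarrow> real) \<Rightarrow> QX set" where
  "ring_of m = {Fract f g | f g. g \<noteq> 0 \<and> (f = 0 \<or> m g \<le> m f)}"

context poly_valuation begin

definition fval :: "QX \<Rightarrow> real" where
  "fval x = (case (SOME (f, g). g \<noteq> 0 \<and> x = Fract f g) of (f, g) \<Rightarrow> m f - m g)"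

lemma fval_Fract: assumes "f \<noteq> 0" "g \<noteq> 0" shows "fval (Fract f g) = m f - m g"
proof -
  obtain f' g' where fg: "(SOME (f', g'). g' \<noteq> 0 \<and> Fract f g = Fract f' g') = (f', g')"
    "g' \<noteq> 0" "f * g' = f' * g" using fract_choice[OF assms(2)] .
  then have "f' \<noteq> 0" using assms by auto
  then have "m f + m g' = m f' + m g" using m_mult[of f g'] m_mult[of f' g] assms fg by simp
  then show ?thesis by (simp add: fval_def fg(1))
qed

lemma QX_cases: obtains "x = 0" | f g where "f \<noteq> 0" "g \<noteq> 0" "x = Fract f g"
  by (cases x rule: Fract_cases) (metis Fract_eq_0_iff)

lemma fval_mult: "x \<noteq> 0 \<Longrightarrow> y \<noteq> 0 \<Longrightarrow> fval (x * y) = fval x + fval y"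
  by (cases x rule: QX_cases; cases y rule: QX_cases) (auto simp: fval_Fract m_mult)

lemma fval_add_ge:
  assumes "x \<noteq> 0" "y \<noteq> 0" "x + y \<noteq> 0" shows "fval (x + y) \<ge> min (fval x) (fval y)"
proof -
  obtain f g where x: "f \<noteq> 0" "g \<noteq> 0" "x = Fract f g" using assms by (cases x rule: QX_cases) auto
  obtain f' g' where y: "f' \<noteq> 0" "g' \<noteq> 0" "y = Fract f' g'" using assms by (cases y rule: QX_cases) auto
  have xy: "x + y = Fract (f * g' + f' * g) (g * g')" using x y by simp
  then have nz: "f * g' + f' * g \<noteq> 0" using assms(3) x y by (auto simp: Fract_eq_0_iff)
  have "m (f * g' + f' * g) \<ge> min (m (f * g')) (m (f' * g))" using nz x y by (intro m_add_ge) auto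
  then show ?thesis using nz x y unfolding xy by (simp add: fval_Fract m_mult min_def split: if_splits)
qed

lemma fval_const: "c \<noteq> 0 \<Longrightarrow> fval (constQX c) = of_int (padic_val_rat p c)"
  using m_const[of 1] m_const[of c] m_mult[of 1 1]
  by (simp add: constQX_def fval_Fract flip: one_pCons)

lemma m_1: "m 1 = 0" using m_mult[of 1 1] by simp

lemma fval_inverse: "x \<noteq> 0 \<Longrightarrow> fval (inverse x) = - fval x"
  using fval_mult[of x "inverse x"] fval_Fract[of 1 1] by (simp add: One_fract_def[symmetric] m_1)

lemma ring_of_iff: "x \<in> ring_of m \<longleftrightarrow> x = 0 \<or> fval x \<ge> 0"
proof
  assume "x \<in> ring_of m"
  then obtain f g where "g \<noteq> 0" "x = Fract f g" "f = 0 \<or> m g \<le> m f" by (auto simp: ring_of_def)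
  then show "x = 0 \<or> fval x \<ge> 0" by (cases "f = 0") (auto simp: fval_Fract Fract_eq_0_iff)
next
  assume a: "x = 0 \<or> fval x \<ge> 0"
  show "x \<in> ring_of m"
  proof (cases x rule: QX_cases)
    case 1
    then show ?thesis unfolding ring_of_def
      by (intro CollectI exI[of _ 0] exI[of _ 1]) (simp add: Zero_fract_def)
  next
    case (2 f g)
    then show ?thesis using a by (auto simp: ring_of_def fval_Fract Fract_eq_0_iff)
  qed
qed

lemma Fract_in_ring_of_iff: "g \<noteq> 0 \<Longrightarrow> Fract f g \<in> ring_of m \<longleftrightarrow> f = 0 \<or> m g \<le> m f"
  by (cases "f = 0") (auto simp: ring_of_iff Fract_eq_0_iff fval_Fract)

lemma max_ideal_iff: "x \<in> max_ideal (ring_of m) \<longleftrightarrow> x = 0 \<or> fval x > 0"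
  by (auto simp: max_ideal_def ring_of_iff fval_inverse)

text \<open>The value group lies in (1/N)\<int> and is nonzero because of \<open>c\<close>, hence it
  is infinite cyclic. As \<open>is_DVR_QX\<close> asks for a surjection onto \<int>, the values are
  multiplied by \<open>N\<close> and then divided by the least positive one,
  \<open>d\<close>.\<close>

lemma is_DVR_ring_of:
  assumes N: "N > 0" "\<And>f. f \<noteq> 0 \<Longrightarrow> of_nat N * m f \<in> \<int>" and c: "c \<noteq> 0" "padic_val_rat p c = 1"
  shows "is_DVR_QX (ring_of m)"
proof -
  have "of_nat N * fval x \<in> \<int>" if "x \<noteq> 0" for x
    using that N(2) by (cases x rule: QX_cases) (simp_all add: fval_Fract right_diff_distrib)
  then have "\<forall>x. \<exists>n. x \<noteq> 0 \<longrightarrow> of_nat N * fval x = of_int n" by (blast elim: Ints_cases)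
  then obtain u where u: "\<And>x. x \<noteq> 0 \<Longrightarrow> of_nat N * fval x = of_int (u x)" by metis
  have uN: "u (constQX c) = N" using u[of "constQX c"] c by (simp add: fval_const)
  have u_mult: "u (x * y) = u x + u y" if "x \<noteq> 0" "y \<noteq> 0" for x y
  proof -
    have "real_of_int (u (x * y)) = u x + u y"
      using u[of x] u[of y] u[of "x * y"] that by (simp add: fval_mult algebra_simps)
    then show ?thesis by linarith
  qed
  have u_1: "u 1 = 0" using u_mult[of 1 1] by simp
  have u_inverse: "u (inverse x) = - u x" if "x \<noteq> 0" for x using u_mult[of x "inverse x"] that u_1 by simp
  have u_power: "u (x ^ n) = n * u x" if "x \<noteq> 0" for x n
    using that by (induction n) (simp_all add: u_1 u_mult algebra_simps)
  have u_powi: "u (x powi n) = n * u x" if "x \<noteq> 0" for x n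
    using that by (simp add: power_int_def u_power u_inverse)
  have le_iff: "fval x \<le> fval y \<longleftrightarrow> u x \<le> u y" if "x \<noteq> 0" "y \<noteq> 0" for x y
  proof -
    have "fval x \<le> fval y \<longleftrightarrow> of_nat N * fval x \<le> of_nat N * fval y" using N by simp
    then show ?thesis using u that by simp
  qed
  define D where "D = {n. n > 0 \<and> (\<exists>x. x \<noteq> 0 \<and> u x = int n)}"
  define d where "d = (LEAST n. n \<in> D)"
  have "N \<in> D" using N uN c by (auto simp: D_def intro!: exI[of _ "constQX c"])
  then have "d \<in> D" unfolding d_def by (rule LeastI)
  then obtain y where y: "y \<noteq> 0" "u y = d" "d > 0" by (auto simp: D_def)
  have least: "n \<ge> d" if "n \<in> D" for n using that by (simp add: d_def Least_le)
  have dvd: "int d dvd u x" if "x \<noteq> 0" for x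
  proof (rule ccontr)
    assume no: "\<not> int d dvd u x"
    define z where "z = x * y powi (- (u x div d))"
    have z: "z \<noteq> 0" "u z = u x mod d" using that y
      by (simp_all add: z_def u_mult u_powi minus_div_mult_eq_mod flip: minus_mult_left)
    then have "nat (u x mod d) \<in> D" using no y
      by (auto simp: D_def dvd_eq_mod_eq_0 intro!: exI[of _ z] order_neq_le_trans)
    then show False using least[of "nat (u x mod d)"] pos_mod_bound[of "int d" "u x"] y(3) by linarith
  qed
  define w where "w x = u x div d" for x
  have w: "u x = d * w x" if "x \<noteq> 0" for x using dvd[OF that] by (simp add: w_def)
  have u_le: "u x \<le> u x' \<longleftrightarrow> w x \<le> w x'" if "x \<noteq> 0" "x' \<noteq> 0" for x x' using w that y(3) by simp
  show ?thesis unfolding is_DVR_QX_def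
  proof (intro exI[of _ w] conjI allI impI)
    fix x x' :: QX assume x: "x \<noteq> 0" "x' \<noteq> 0"
    show "w (x * x') = w x + w x'"
    proof -
      have "int d * w (x * x') = int d * (w x + w x')"
        using w[of "x * x'"] w[of x] w[of x'] u_mult x by (simp add: distrib_left)
      then show ?thesis using y(3) by simp
    qed
    assume "x + x' \<noteq> 0"
    then have "fval (x + x') \<ge> fval x \<or> fval (x + x') \<ge> fval x'"
      using fval_add_ge[of x x'] x by (auto simp: min_def split: if_splits)
    then show "w (x + x') \<ge> min (w x) (w x')" using le_iff u_le x \<open>x + x' \<noteq> 0\<close> by (auto simp: min_le_iff_disj)
  next
    fix n
    have "y powi n \<noteq> 0" "w (y powi n) = n" using y by (simp_all add: w_def u_powi)
    then show "\<exists>x. x \<noteq> 0 \<and> w x = n" by blast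
  next
    have "x \<noteq> 0 \<Longrightarrow> fval x \<ge> 0 \<longleftrightarrow> w x \<ge> 0" for x
      using le_iff[of 1 x] u_le[of 1 x] fval_mult[of 1 1] u_1 by (simp add: w_def)
    then show "ring_of m = {x. x = 0 \<or> w x \<ge> 0}"
      unfolding set_eq_iff ring_of_iff mem_Collect_eq by blast
  qed
qed

end

context padic_complex begin

lemma const_in_ring_of:
  assumes "poly_valuation p m" shows "{c. constQX c \<in> ring_of m} = Zloc p"
proof -
  interpret poly_valuation p m by fact
  have "constQX c \<in> ring_of m \<longleftrightarrow> c \<in> Zloc p" for c
    by (cases "c = 0") (simp_all add: ring_of_iff Zloc_iff fval_const)
  then show ?thesis by blast
qed

text \<open>Dividing by the ramification index \<open>e = w(p)\<close> normalises the valuation. Its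
  values on constants are forced: units of the local ring have value 0, \<open>p\<close> has
  positive value, and every nonzero rational is a power of \<open>p\<close> times a unit. The
  element \<open>\<pi>\<close> is a uniformizer.\<close>

lemma DVR_imp_poly_valuation:
  assumes "is_DVR_QX W" "{c. constQX c \<in> W} = Zloc p"
  shows "\<exists>m e \<pi>. poly_valuation p m \<and> W = ring_of m \<and> e > 0 \<and> (\<forall>f. f \<noteq> 0 \<longrightarrow> of_nat e * m f \<in> \<int>) \<and>
    \<pi> \<noteq> 0 \<and> of_nat e * poly_valuation.fval m \<pi> = 1"
proof -
  obtain w :: "QX \<Rightarrow> int" where w_mult: "\<And>x y. x \<noteq> 0 \<Longrightarrow> y \<noteq> 0 \<Longrightarrow> w (x * y) = w x + w y"
    and w_add: "\<And>x y. x \<noteq> 0 \<Longrightarrow> y \<noteq> 0 \<Longrightarrow> x + y \<noteq> 0 \<Longrightarrow> w (x + y) \<ge> min (w x) (w y)"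
    and w_surj: "\<And>n. \<exists>x. x \<noteq> 0 \<and> w x = n" and W: "W = {x. x = 0 \<or> w x \<ge> 0}"
    using assms(1) unfolding is_DVR_QX_def by blast
  define P where "P = constQX (of_nat p)"
  have [simp]: "P \<noteq> 0" by (simp add: P_def)
  have w_1: "w 1 = 0" using w_mult[of 1 1] by simp
  have w_inverse: "w (inverse x) = - w x" if "x \<noteq> 0" for x using w_mult[of x "inverse x"] that w_1 by simp
  have w_power: "w (x ^ n) = n * w x" if "x \<noteq> 0" for x n
    using that by (induction n) (simp_all add: w_1 w_mult algebra_simps)
  have inv: "inverse (constQX c) = constQX (inverse c)" if "c \<noteq> 0" for c
    using constQX.hom_mult[of c "inverse c"] that by (simp add: constQX.hom_1 inverse_unique)
  have Z: "w (constQX c) \<ge> 0 \<longleftrightarrow> padic_val_rat p c \<ge> 0" if "c \<noteq> 0" for c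
    using assms(2) that by (auto simp: W Zloc_iff set_eq_iff)
  have padic_inverse: "padic_val_rat p (inverse c) = - padic_val_rat p c" if "c \<noteq> 0" for c
    using padic_mult[of c "inverse c"] that padic_mult[of 1 1] by simp
  have unit: "w (constQX c) = 0" if "c \<noteq> 0" "padic_val_rat p c = 0" for c
    using Z[of c] Z[of "inverse c"] that by (simp add: padic_inverse w_inverse flip: inv)
  have wP: "w P > 0"
    using Z[of "inverse (of_nat p)"] by (simp add: P_def padic_inverse padic_p w_inverse flip: inv)
  define e where "e = nat (w P)"
  have e: "int e = w P" "e > 0" using wP by (auto simp: e_def)
  have const_pos: "w (constQX c) = e * padic_val_rat p c" if "c \<noteq> 0" "padic_val_rat p c \<ge> 0" for c
  proof -
    define n where "n = nat (padic_val_rat p c)"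
    have pow: "padic_val_rat p (of_nat p ^ k) = int k" for k
      using padic_mult[of 1 1] by (induction k) (simp_all add: padic_mult padic_p)
    define c' where "c' = c / of_nat p ^ n"
    have c: "c = of_nat p ^ n * c'" "c' \<noteq> 0" using that by (simp_all add: c'_def)
    have "padic_val_rat p c' = 0" unfolding c'_def using that by (simp add: padic_divide pow n_def)
    then have "w (constQX c) = n * w P" using unit[OF c(2)] c
      by (simp add: constQX.hom_mult constQX.hom_power w_mult w_power flip: P_def)
    then show ?thesis using that e by (simp add: n_def)
  qed
  have const: "w (constQX c) = e * padic_val_rat p c" if "c \<noteq> 0" for c
  proof (cases "padic_val_rat p c \<ge> 0")
    case False
    then show ?thesis using const_pos[of "inverse c"] that by (simp add: padic_inverse w_inverse flip: inv)
  qed (use const_pos that in auto)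
  define m where "m f = w (Fract f 1) / e" for f
  interpret poly_valuation p m
  proof
    fix f g :: "rat poly" and c :: rat
    assume "f \<noteq> 0" "g \<noteq> 0"
    then show "m (f * g) = m f + m g"
      using w_mult[of "Fract f 1" "Fract g 1"] by (simp add: Fract_eq_0_iff m_def add_divide_distrib)
    assume "f + g \<noteq> 0"
    have "w (Fract f 1 + Fract g 1) \<ge> min (w (Fract f 1)) (w (Fract g 1))"
      by (rule w_add) (use \<open>f \<noteq> 0\<close> \<open>g \<noteq> 0\<close> \<open>f + g \<noteq> 0\<close> in \<open>auto simp: Fract_eq_0_iff\<close>)
    then show "m (f + g) \<ge> min (m f) (m g)" using e
      by (auto simp: m_def min_le_iff_disj divide_right_mono)
  next
    fix c :: rat assume "c \<noteq> 0"
    then show "m [:c:] = padic_val_rat p c" using const[of c] e(2)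
      by (simp add: m_def flip: constQX_def)
  qed
  have fval: "fval x = w x / e" if x: "x \<noteq> 0" for x
  proof -
    obtain f g where fg: "f \<noteq> 0" "g \<noteq> 0" "x = Fract f g" using x by (cases x rule: QX_cases) auto
    have "Fract f 1 = x * Fract g 1" using fg by (simp add: eq_fract)
    then have "w (Fract f 1) = w x + w (Fract g 1)"
      using w_mult[OF x, of "Fract g 1"] fg by (simp add: Fract_eq_0_iff)
    then show ?thesis using fg by (simp add: fval_Fract m_def diff_divide_distrib add_divide_distrib)
  qed
  have "W = ring_of m"
  proof -
    have "x \<noteq> 0 \<Longrightarrow> fval x \<ge> 0 \<longleftrightarrow> w x \<ge> 0" for x using fval[of x] e(2) by (simp add: zero_le_divide_iff)
    then show ?thesis unfolding W set_eq_iff ring_of_iff mem_Collect_eq by blast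
  qed
  moreover obtain \<pi> where "\<pi> \<noteq> 0" "w \<pi> = 1" using w_surj by blast
  moreover have "of_nat e * m f \<in> \<int>" for f using e by (simp add: m_def)
  ultimately show ?thesis using e fval poly_valuation_axioms
    by (intro exI[of _ m] exI[of _ e] exI[of _ \<pi>]) auto
qed

lemma Zpad_eq_ring_of:
  assumes "\<And>f. f \<noteq> 0 \<Longrightarrow> val_pad v a d f = ereal (m f)"
  shows "Zpad v a d = ring_of m"
proof -
  have "val_pad v a d g \<le> val_pad v a d f \<longleftrightarrow> f = 0 \<or> m g \<le> m f" if "g \<noteq> 0" for f g
    using that assms by (cases "f = 0") (auto simp: val_pad_0)
  then show ?thesis unfolding Zpad_def ring_of_def by blast
qed

lemma gauss_poly_valuation: "poly_valuation p (\<lambda>f. gauss \<delta> a (map_poly of_rat f))"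
proof
  fix f g :: "rat poly" assume "f \<noteq> 0" "g \<noteq> 0"
  then show "gauss \<delta> a (map_poly of_rat (f * g)) = gauss \<delta> a (map_poly of_rat f) + gauss \<delta> a (map_poly of_rat g)"
    by (simp add: of_rat_poly.hom_mult gauss_mult)
  assume "f + g \<noteq> 0"
  then show "gauss \<delta> a (map_poly of_rat (f + g)) \<ge> min (gauss \<delta> a (map_poly of_rat f)) (gauss \<delta> a (map_poly of_rat g))"
    using gauss_add_ge[of "map_poly of_rat f" "map_poly of_rat g"] \<open>f \<noteq> 0\<close> \<open>g \<noteq> 0\<close>
    by (simp flip: of_rat_poly.hom_add)
qed (simp add: of_rat_hom.map_poly_hom_const gauss_const vr_of_rat)

lemma Zpad_Some: "Zpad v a (Some \<delta>) = ring_of (\<lambda>f. gauss (of_rat \<delta>) a (map_poly of_rat f))"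
  by (rule Zpad_eq_ring_of) (rule val_pad_Some)

lemma transcendental_eval: "\<not> alg_over_Q a \<Longrightarrow> f \<noteq> 0 \<Longrightarrow> poly (map_poly of_rat f) a \<noteq> 0"
  by (auto simp: alg_over_Q_def)

lemma eval_poly_valuation:
  assumes "\<not> alg_over_Q a" shows "poly_valuation p (\<lambda>f. vr (poly (map_poly of_rat f) a))"
proof
  fix f g :: "rat poly" assume fg: "f \<noteq> 0" "g \<noteq> 0"
  let ?e = "\<lambda>f. poly (map_poly of_rat f) a"
  show "vr (?e (f * g)) = vr (?e f) + vr (?e g)"
    using fg by (simp add: of_rat_poly.hom_mult vr_mult transcendental_eval[OF assms])
  assume s: "f + g \<noteq> 0"
  have "min (v (?e f)) (v (?e g)) \<le> v (?e (f + g))" by (simp add: of_rat_poly.hom_add v_add_ge)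
  then show "vr (?e (f + g)) \<ge> min (vr (?e f)) (vr (?e g))"
    using fg s by (simp add: v_eq_vr transcendental_eval[OF assms] flip: ereal_min)
qed (simp add: of_rat_hom.map_poly_hom_const vr_of_rat)

lemma Zpad_None:
  assumes "\<not> alg_over_Q a" shows "Zpad v a None = ring_of (\<lambda>f. vr (poly (map_poly of_rat f) a))"
  by (rule Zpad_eq_ring_of) (simp add: val_pad_def v_eq_vr transcendental_eval[OF assms])

end

section \<open>Bounded ramification\<close>

text \<open>Among the multiples \<open>0, r, ..., card S * r\<close> two agree modulo \<int>, so
  \<open>r\<close> has a denominator of at most \<open>card S\<close>. The factorial does not depend
  on \<open>r\<close>.\<close>

lemma finite_cosets_imp_bounded_denominator:
  fixes S :: "real set set"
  assumes "finite S" "\<And>i :: nat. (\<lambda>n. i * r + real_of_int n) ` UNIV \<in> S"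
  shows "fact (card S) * r \<in> \<int>"
proof -
  define c where "c i = (\<lambda>n. real i * r + real_of_int n) ` UNIV" for i :: nat
  have "c ` {..card S} \<subseteq> S" using assms(2) by (auto simp: c_def)
  then have "card (c ` {..card S}) < card {..card S}" using card_mono[OF assms(1)] by (simp add: le_imp_less_Suc)
  then have "\<not> inj_on c {..card S}" by (rule pigeonhole)
  then obtain i j where ij: "i < j" "j \<le> card S" "c i = c j"
    unfolding inj_on_def by (metis atMost_iff linorder_neqE_nat)
  have "real j * r \<in> c j" by (auto simp: c_def intro: image_eqI[of _ _ 0])
  then obtain n where "real j * r = real i * r + of_int n" unfolding ij(3)[symmetric] by (auto simp: c_def)
  then have "of_nat (j - i) * r = of_int n" using ij by (simp add: of_nat_diff algebra_simps)
  then have "of_nat (j - i) * r \<in> \<int>" by simp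
  then show ?thesis by (rule fact_mult_Ints) (use ij in auto)
qed

context padic_complex begin

lemma of_rat_in_Qp: "of_rat q \<in> Qp v"
  unfolding Qp_def by (auto intro!: exI[of _ q])

lemma Cp_br_imp_bounded_denominator:
  assumes "a \<in> Cp_br v"
  shows "\<exists>N>0. \<forall>f :: rat poly. poly (map_poly of_rat f) a \<noteq> 0 \<longrightarrow>
    of_nat N * vr (poly (map_poly of_rat f) a) \<in> \<int>"
proof -
  define S where "S = (\<lambda>r. {r + real_of_int n | n. True}) ` {real_of_ereal (v y) | y. y \<in> Qp_adj v a \<and> y \<noteq> 0}"
  have S: "finite S" using assms by (simp add: Cp_br_def S_def)
  have "of_nat (fact (card S)) * vr (poly (map_poly of_rat f) a) \<in> \<int>"
    if nz: "poly (map_poly of_rat f) a \<noteq> 0" for f :: "rat poly"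
  proof -
    define y where "y = poly (map_poly of_rat f) a"
    have "(\<lambda>n. real i * vr y + real_of_int n) ` UNIV \<in> S" for i
    proof -
      have "y ^ i = poly (map_poly of_rat (f ^ i)) a / poly (map_poly of_rat 1) a"
        by (simp add: y_def of_rat_poly.hom_power)
      moreover have "\<forall>j. coeff (map_poly of_rat g) j \<in> Qp v" for g :: "rat poly"
        by (simp add: coeff_map_poly of_rat_in_Qp)
      moreover have "poly (map_poly of_rat 1) a \<noteq> 0" by simp
      ultimately have "y ^ i \<in> Qp_adj v a" unfolding Qp_adj_def by blast
      then have "{real i * vr y + real_of_int n | n. True} \<in> S" unfolding S_def
        using nz by (intro image_eqI[of _ _ "real i * vr y"]) (auto intro!: exI[of _ "y ^ i"] simp: vr_power y_def simp flip: vr_def)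
      moreover have "{real i * vr y + real_of_int n | n. True} = (\<lambda>n. real i * vr y + real_of_int n) ` UNIV"
        by auto
      ultimately show ?thesis by simp
    qed
    then have "fact (card S) * vr y \<in> \<int>" using S by (rule finite_cosets_imp_bounded_denominator[rotated])
    then show ?thesis by (simp add: y_def)
  qed
  then show ?thesis by (intro exI[of _ "fact (card S)"]) auto
qed

lemma Qp_poly_approx:
  assumes "\<And>i. coeff F i \<in> Qp v"
  shows "\<exists>f. v (poly F a - poly (map_poly of_rat f) a) \<ge> ereal M"
  using assms
proof (induction F arbitrary: M)
  case 0
  show ?case by (intro exI[of _ 0]) simp
next
  case (pCons c F)
  have "c \<in> Qp v" using pCons.prems[of 0] by simp
  then obtain q where q: "v (c - of_rat q) \<ge> ereal M" by (auto simp: Qp_def)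
  have "coeff F i \<in> Qp v" for i using pCons.prems[of "Suc i"] by simp
  \<comment> \<open>Multiplication by \<open>a\<close> shifts values by \<open>vr a\<close>, hence
    the precision \<open>M - vr a\<close> for the tail; if \<open>a = 0\<close>, the tail
    contributes nothing.\<close>
  then obtain f where f: "v (poly F a - poly (map_poly of_rat f) a) \<ge> ereal (M - vr a)" 
    using pCons.IH by blast
  define z where "z = poly F a - poly (map_poly of_rat f) a"
  have z: "v (a * z) \<ge> ereal M"
    using f vr_mult[of a z] unfolding z_def[symmetric] v_ge_iff by (cases "a = 0"; cases "z = 0") auto
  have "poly (pCons c F) a - poly (map_poly of_rat (pCons q f)) a = (c - of_rat q) + a * z"
    by (simp add: map_poly_pCons z_def algebra_simps)
  then have "v (poly (pCons c F) a - poly (map_poly of_rat (pCons q f)) a) \<ge> ereal M"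
    using v_add_ge[of "c - of_rat q" "a * z"] q z by (metis min.boundedI order.trans)
  then show ?case by blast
qed

text \<open>An approximation beyond the value of \<open>poly F a\<close> keeps that value. Hence
  Q[a] and Q_p[a] have the same values, and membership in \<open>Cp_br v\<close> can be tested on
  rational polynomials.\<close>

lemma Qp_poly_same_value:
  assumes "\<And>i. coeff F i \<in> Qp v" "poly F a \<noteq> 0"
  shows "\<exists>f. poly (map_poly of_rat f) a \<noteq> 0 \<and> vr (poly F a) = vr (poly (map_poly of_rat f) a)"
proof -
  obtain f where f: "v (poly F a - poly (map_poly of_rat f) a) \<ge> ereal (vr (poly F a) + 1)"
    using Qp_poly_approx[OF assms(1)] by blast
  have "v (poly F a) < ereal (vr (poly F a) + 1)" using assms(2) by (simp add: v_eq_vr)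
  then have "v (poly F a) < v (poly F a - poly (map_poly of_rat f) a)" using f by (rule less_le_trans)
  then have eq: "v (poly (map_poly of_rat f) a) = v (poly F a)"
    using v_diff_eq[of "poly F a" "poly F a - poly (map_poly of_rat f) a"] by simp
  moreover have "v (poly (map_poly of_rat f) a) \<noteq> \<infinity>"
    unfolding eq using assms(2) v_eq_infinity_iff by blast
  ultimately have "poly (map_poly of_rat f) a \<noteq> 0" "vr (poly (map_poly of_rat f) a) = vr (poly F a)"
    by (auto simp: vr_def)
  then show ?thesis by auto
qed

text \<open>Numerator and denominator of an element of Q_p(a) have the values of elements of Q[a].
  All values then lie in (1/N)\<int>, which has \<open>N\<close> cosets modulo \<int>.\<close>

lemma bounded_denominator_imp_Cp_br:
  assumes N: "N > 0" "\<And>f :: rat poly. poly (map_poly of_rat f) a \<noteq> 0 \<Longrightarrow>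
    of_nat N * vr (poly (map_poly of_rat f) a) \<in> \<int>"
  shows "a \<in> Cp_br v"
proof -
  define coset where "coset r = {r + real_of_int n | n. True}" for r
  have coset_eq: "coset r = coset s" if "r = s + of_int k" for r s k
  proof -
    have "r + of_int n \<in> coset s" for n unfolding coset_def that
      by (auto intro!: exI[of _ "k + n"])
    moreover have "s + of_int n \<in> coset r" for n unfolding coset_def that
      by (auto intro!: exI[of _ "n - k"])
    ultimately show ?thesis unfolding coset_def by blast
  qed
  have "coset (vr y) \<in> (\<lambda>j. coset (real j / N)) ` {..<N}" if y: "y \<in> Qp_adj v a" "y \<noteq> 0" for y
  proof -
    obtain F G where FG: "y = poly F a / poly G a" "\<And>i. coeff F i \<in> Qp v" "\<And>i. coeff G i \<in> Qp v" "poly G a \<noteq> 0"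
      using y(1) unfolding Qp_adj_def by blast
    have "poly F a \<noteq> 0" using y FG by auto
    obtain f g where fg: "poly (map_poly of_rat f) a \<noteq> 0" "vr (poly F a) = vr (poly (map_poly of_rat f) a)"
      "poly (map_poly of_rat g) a \<noteq> 0" "vr (poly G a) = vr (poly (map_poly of_rat g) a)"
      using Qp_poly_same_value[OF FG(2) \<open>poly F a \<noteq> 0\<close>] Qp_poly_same_value[OF FG(3,4)] by blast
    have "of_nat N * vr y \<in> \<int>" using N(2)[OF fg(1)] N(2)[OF fg(3)] FG(4) \<open>poly F a \<noteq> 0\<close>
      by (simp add: FG(1) vr_divide fg right_diff_distrib)
    then obtain k where k: "of_nat N * vr y = of_int k" by (auto elim: Ints_cases)
    define j where "j = nat (k mod N)"
    have j: "j < N" "int j = k mod N" using N(1) by (auto simp: j_def nat_less_iff)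
    have "real_of_int k = of_int (int N * (k div N) + int j)" by (simp add: j)
    then have "vr y = real j / N + of_int (k div N)" using k N(1) by (simp add: field_simps)
    then show ?thesis using coset_eq j by blast
  qed
  then have "coset ` {real_of_ereal (v y) | y. y \<in> Qp_adj v a \<and> y \<noteq> 0} \<subseteq> (\<lambda>j. coset (real j / N)) ` {..<N}"
    by (auto simp: vr_def)
  then have "finite (coset ` {real_of_ereal (v y) | y. y \<in> Qp_adj v a \<and> y \<noteq> 0})"
    by (rule finite_subset) simp
  then show ?thesis by (simp add: Cp_br_def coset_def[abs_def])
qed

section \<open>The valuation rings attached to admissible pairs\<close>

lemma eval_embedding:
  assumes "\<not> alg_over_Q a" shows "idom_embedding (\<lambda>f :: rat poly. poly (map_poly of_rat f) a)"
  by unfold_locales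
    (use assms in \<open>auto simp: of_rat_poly.hom_add of_rat_poly.hom_mult transcendental_eval dest: transcendental_eval\<close>)

lemma int_poly_hom_eval:
  assumes "comm_ring_homomorphism h"
  shows "h (poly (map_poly (\<lambda>a. constQX (of_int a)) P) x) = poly (map_poly of_int P) (h x)"
proof -
  interpret comm_ring_homomorphism h by fact
  have "map_poly h (map_poly (\<lambda>a. constQX (of_int a)) P) = map_poly of_int P"
    by (subst map_poly_map_poly) (simp_all add: o_def constQX.hom_of_int hom_of_int hom_0)
  then show ?thesis using poly_map_poly_hom[of "map_poly (\<lambda>a. constQX (of_int a)) P" x] by simp
qed

text \<open>Evaluation at \<open>a\<close> embeds Q(X) into C_p, and the ring is the preimage of
  \<open>Op v\<close>. Its residue field therefore embeds into that of C_p, and bounded ramification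
  gives discreteness.\<close>

lemma Zpad_None_properties:
  assumes a: "a \<in> Cp_br v" "\<not> alg_over_Q a"
  shows "is_DVR_QX (Zpad v a None)" "{c. constQX c \<in> Zpad v a None} = Zloc p" "res_algebraic p (Zpad v a None)"
proof -
  define m where "m f = vr (poly (map_poly of_rat f) a)" for f
  have R: "Zpad v a None = ring_of m" using Zpad_None[OF a(2)] by (simp add: m_def[abs_def])
  interpret m: poly_valuation p m using eval_poly_valuation[OF a(2)] by (simp add: m_def[abs_def])
  interpret ev: idom_embedding "\<lambda>f :: rat poly. poly (map_poly of_rat f) a" using a(2) by (rule eval_embedding)
  obtain N where N: "N > 0" "\<And>f :: rat poly. poly (map_poly of_rat f) a \<noteq> 0 \<Longrightarrow>
    of_nat N * vr (poly (map_poly of_rat f) a) \<in> \<int>"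
    using Cp_br_imp_bounded_denominator[OF a(1)] by blast
  show "is_DVR_QX (Zpad v a None)" unfolding R
    by (rule m.is_DVR_ring_of[of N "of_nat p"]) (use N transcendental_eval[OF a(2)] in \<open>auto simp: m_def padic_p\<close>)
  show "{c. constQX c \<in> Zpad v a None} = Zloc p" unfolding R
    by (rule const_in_ring_of) (rule m.poly_valuation_axioms)
  have fval: "m.fval x = vr (ev.fract_hom x)" if "x \<noteq> 0" for x
    using that by (cases x rule: m.QX_cases)
      (simp_all add: m.fval_Fract ev.fract_hom_Fract m_def vr_divide transcendental_eval[OF a(2)])
  show "res_algebraic p (Zpad v a None)" unfolding R res_algebraic_def
  proof
    fix x assume x: "x \<in> ring_of m"
    have "v (ev.fract_hom x) \<ge> 0"
      using x fval[of x] by (cases "x = 0") (simp_all add: m.ring_of_iff v_nonneg_iff ev.fract_hom_eq_0_iff)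
    then obtain P :: "int poly" where P: "\<exists>i. \<not> int p dvd coeff P i"
      "v (poly (map_poly of_int P) (ev.fract_hom x)) > 0" using residue_algebraic by blast
    define y where "y = poly (map_poly (\<lambda>a. constQX (of_int a)) P) x"
    have "v (ev.fract_hom y) > 0" using P(2) by (simp add: y_def int_poly_hom_eval[OF ev.fract_hom])
    then have "y \<in> max_ideal (ring_of m)" using fval[of y]
      by (cases "y = 0") (simp_all add: m.max_ideal_iff v_pos_iff ev.fract_hom_eq_0_iff)
    then show "\<exists>f :: int poly. (\<exists>i. \<not> int p dvd coeff f i) \<and>
      poly (map_poly (\<lambda>a. constQX (of_int a)) f) x \<in> max_ideal (ring_of m)" using P(1) y_def by blast
  qed
qed

text \<open>The first minima of the powers \<open>F ^ k\<close> sit at the distinct places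
  \<open>k * i\<close>. Let \<open>n\<close> be the first index whose coefficient in
  \<open>P\<close> is prime to \<open>p\<close>. At place \<open>n * i\<close> the term for
  \<open>n\<close> dominates: smaller \<open>k\<close> bring a factor \<open>p\<close>, and larger
  \<open>k\<close> have not reached their first minimum. So no nontrivial relation modulo
  \<open>p\<close> gives \<open>P(F)\<close> positive value.\<close>

lemma int_poly_first_min:
  assumes F: "first_min \<delta> F i 0" "i > 0" and P: "\<exists>k. \<not> int p dvd coeff P k"
  shows "\<exists>k. v (coeff (poly (map_poly (\<lambda>a. [:of_int a:]) P) F) k) = ereal (- \<delta> * k)"
proof -
  define n where "n = (LEAST k. \<not> int p dvd coeff P k)"
  have n: "\<not> int p dvd coeff P n" using P unfolding n_def by (rule LeastI_ex)
  have least: "int p dvd coeff P k" if "k < n" for k using not_less_Least that by (auto simp: n_def)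
  define t where "t k = of_int (coeff P k) * coeff (F ^ k) (n * i)" for k
  have Fk: "first_min \<delta> (F ^ k) (k * i) 0" for k using first_min_power[OF F(1), of k] by simp
  let ?c = "ereal (- \<delta> * (n * i))"
  have "n \<le> degree P" using n by (intro le_degree) auto
  have "coeff (poly (map_poly (\<lambda>a. [:of_int a:]) P) F) (n * i) = (\<Sum>k\<le>degree P. t k)"
    unfolding poly_altdef t_def by (simp add: coeff_sum coeff_map_poly degree_map_poly)
  also have "\<dots> = t n + (\<Sum>k\<in>{..degree P} - {n}. t k)"
    using \<open>n \<le> degree P\<close> by (intro sum.remove) auto
  finally have eq: "coeff (poly (map_poly (\<lambda>a. [:of_int a:]) P) F) (n * i) = t n + (\<Sum>k\<in>{..degree P} - {n}. t k)" .
  have "v (t n) = ?c" using Fk[of n] v_of_int_unit[OF n] by (simp add: t_def v_mult first_min_def)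
  moreover have "v (\<Sum>k\<in>{..degree P} - {n}. t k) > ?c"
  proof (rule v_sum_gt)
    fix k assume k: "k \<in> {..degree P} - {n}"
    have ge: "v (coeff (F ^ k) (n * i)) \<ge> ereal (0 - \<delta> * (n * i))"
      using Fk[of k] unfolding first_min_def by blast
    show "v (t k) > ?c"
    proof (cases "k < n")
      case True
      have "?c < 1 + ?c" by (simp add: one_ereal_def)
      also have "\<dots> \<le> v (t k)" unfolding t_def v_mult
        using v_of_int_pos[OF least[OF True]] ge by (intro add_mono) auto
      finally show ?thesis .
    next
      case False
      then have "n * i < k * i" using k F(2) by auto
      then have "v (coeff (F ^ k) (n * i)) > ereal (0 - \<delta> * (n * i))"
        using Fk[of k] unfolding first_min_def by blast
      then have "?c < v (coeff (F ^ k) (n * i))" by simp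
      also have "\<dots> \<le> v (t k)" unfolding t_def v_mult
        using add_right_mono[OF v_of_int_nonneg[of "coeff P k"], of "v (coeff (F ^ k) (n * i))"] by simp
      finally show ?thesis .
    qed
  qed simp
  ultimately have "v (coeff (poly (map_poly (\<lambda>a. [:of_int a:]) P) F) (n * i)) = ?c"
    unfolding eq by (simp only: v_add_eq)
  then show ?thesis by blast
qed

lemma ring_of_cong: assumes "\<And>f. f \<noteq> 0 \<Longrightarrow> m f = m' f" shows "ring_of m = ring_of m'"
proof -
  have "f = 0 \<or> m g \<le> m f \<longleftrightarrow> f = 0 \<or> m' g \<le> m' f" if "g \<noteq> 0" for f g
    using assms that by (cases "f = 0") simp_all
  then show ?thesis unfolding ring_of_def by blast
qed

lemma Zpad_Some_recenter:
  assumes "v (a - a') \<ge> ereal (of_rat \<delta>)" shows "Zpad v a (Some \<delta>) = Zpad v a' (Some \<delta>)"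
  unfolding Zpad_Some by (rule ring_of_cong) (simp add: gauss_recenter[OF assms])

lemma Zpad_Some_properties:
  "is_DVR_QX (Zpad v a (Some \<delta>))" "{c. constQX c \<in> Zpad v a (Some \<delta>)} = Zloc p"
  "res_transcendental p (Zpad v a (Some \<delta>))"
proof -
  \<comment> \<open>For a centre algebraic over \<rat> the coefficients of the expansion lie in
    Q[a'], where values have bounded denominators.\<close>
  obtain a' where a': "alg_over_Q a'" "v (a - a') \<ge> ereal (of_rat \<delta>)" using dense by blast
  define d :: real where "d = of_rat \<delta>"
  define m where "m f = gauss d a' (map_poly of_rat f)" for f
  have R: "Zpad v a (Some \<delta>) = ring_of m"
    unfolding Zpad_Some_recenter[OF a'(2)] unfolding Zpad_Some m_def[abs_def] d_def ..
  interpret m: poly_valuation p m unfolding m_def[abs_def] by (rule gauss_poly_valuation)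
  obtain N0 where N0: "N0 > 0" "\<And>f :: rat poly. poly (map_poly of_rat f) a' \<noteq> 0 \<Longrightarrow>
    of_nat N0 * vr (poly (map_poly of_rat f) a') \<in> \<int>"
    using algebraic_values_discrete[OF a'(1)] by blast
  obtain num den where nd: "quotient_of \<delta> = (num, den)" by (cases "quotient_of \<delta>")
  have den: "den > 0" "d = of_int num / of_int den"
    using nd quotient_of_denom_pos[OF nd] quotient_of_div[OF nd] by (auto simp: d_def of_rat_divide)
  \<comment> \<open>The factor \<open>N0\<close> clears the values of the coefficients and
    \<open>den\<close> the multiples of \<open>\<delta>\<close>.\<close>
  define N where "N = N0 * nat den"
  have N: "N > 0" using N0 den by (simp add: N_def)
  have disc: "of_nat N * m f \<in> \<int>" if f: "f \<noteq> 0" for f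
  proof -
    let ?F = "pcompose (map_poly of_rat f) [:a', 1:]"
    obtain i where i: "first_min d ?F i (m f)"
      using ex_first_min_gauss[of "map_poly of_rat f"] f by (auto simp: m_def)
    have "coeff ?F i \<in> range (\<lambda>g :: rat poly. poly (map_poly of_rat g) a')"
    proof (rule coeff_pcompose_in_subring[OF poly_eval_range_subring])
      have c: "of_rat c \<in> range (\<lambda>g :: rat poly. poly (map_poly of_rat g) a')" for c
        by (rule range_eqI[of _ _ "[:c:]"]) (simp add: of_rat_hom.map_poly_hom_const)
      show "coeff (map_poly of_rat f) j \<in> range (\<lambda>g :: rat poly. poly (map_poly of_rat g) a')" for j
        using c by (simp add: coeff_map_poly)
      have "a' \<in> range (\<lambda>g :: rat poly. poly (map_poly of_rat g) a')"
        by (rule range_eqI[of _ _ "[:0, 1:]"]) (simp add: map_poly_pCons)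
      then show "coeff [:a', 1:] j \<in> range (\<lambda>g :: rat poly. poly (map_poly of_rat g) a')" for j
        using c[of 0] c[of 1] by (auto simp: coeff_pCons split: nat.splits)
    qed
    then obtain g :: "rat poly" where g: "coeff ?F i = poly (map_poly of_rat g) a'" by auto
    have vi: "v (coeff ?F i) = ereal (m f - d * i)" using i by (simp add: first_min_def)
    then have "coeff ?F i \<noteq> 0" "m f = vr (coeff ?F i) + d * i" by (auto simp: vr_def)
    then have "of_nat N0 * (m f - d * i) \<in> \<int>" using N0(2)[of g] g by simp
    moreover have "of_nat N * m f = of_int den * (of_nat N0 * (m f - d * i)) + of_nat N0 * (of_int num * of_nat i)"
      using den by (simp add: N_def field_simps)
    ultimately show ?thesis by (simp add: Ints_add Ints_mult)
  qed
  show "is_DVR_QX (Zpad v a (Some \<delta>))" unfolding R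
    by (rule m.is_DVR_ring_of[OF N disc, of "of_nat p"]) (auto simp: padic_p)
  show "{c. constQX c \<in> Zpad v a (Some \<delta>)} = Zloc p" unfolding R
    by (rule const_in_ring_of) (rule m.poly_valuation_axioms)
  obtain A :: "rat poly" where A: "A \<noteq> 0" "poly (map_poly of_rat A) a' = 0"
    using a'(1) by (auto simp: alg_over_Q_def)
  obtain s where s: "of_nat N * m A = of_int s" using disc[OF A(1)] by (auto elim: Ints_cases)
  \<comment> \<open>A residually transcendental element is built from \<open>A\<close>: the power
    \<open>N\<close> makes the value an integer and \<open>c\<close> shifts it to 0. Since
    \<open>a'\<close> is a root of \<open>A\<close>, the constant term of the expansion vanishes, so
    the first minimum has positive index.\<close>
  define c :: rat where "c = of_nat p powi (- s)"
  have "(of_rat c :: 'k) = of_nat p powi (- s)"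
    by (simp add: c_def power_int_def of_rat_power of_rat_inverse)
  then have c: "c \<noteq> 0" "vr (of_rat c) = - s" using vr_powi[OF p_nz, of "- s"]
    by (simp_all add: c_def p_nz)
  define h where "h = [:c:] * A ^ N"
  have hnz: "h \<noteq> 0" using c A by (simp add: h_def)
  have mpow: "m (A ^ n) = n * m A" for n
    using A by (induction n) (simp_all add: m.m_1 m.m_mult algebra_simps)
  have "m h = 0"
    using c A s mpow m.m_mult[of "[:c:]" "A ^ N"] vr_of_rat[OF c(1)]
    by (simp add: h_def m.m_const del: mult_pCons_left)
  define F where "F = pcompose (map_poly of_rat h) [:a', 1:]"
  obtain i where i: "first_min d F i 0"
    using ex_first_min_gauss[of "map_poly of_rat h" d a'] hnz \<open>m h = 0\<close> by (auto simp: m_def F_def)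
  have "coeff F 0 = 0" using A N unfolding F_def h_def poly_0_coeff_0[symmetric] poly_pcompose
    by (simp add: of_rat_poly.hom_mult of_rat_poly.hom_power del: mult_pCons_left)
  then have "i > 0" using i by (cases i) (auto simp: first_min_def)
  have "\<not> res_algebraic p (ring_of m)"
  proof
    assume "res_algebraic p (ring_of m)"
    moreover have "Fract h 1 \<in> ring_of m" using \<open>m h = 0\<close> by (simp add: m.Fract_in_ring_of_iff m.m_1)
    ultimately obtain P :: "int poly" where P: "\<exists>k. \<not> int p dvd coeff P k"
      "poly (map_poly (\<lambda>a. constQX (of_int a)) P) (Fract h 1) \<in> max_ideal (ring_of m)"
      unfolding res_algebraic_def by blast
    define R where "R = poly (map_poly (\<lambda>a. [:of_int a:]) P) h"
    interpret toF: comm_ring_homomorphism "\<lambda>f :: rat poly. Fract f 1"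
      by unfold_locales (auto simp: One_fract_def)
    have "poly (map_poly (\<lambda>a. constQX (of_int a)) P) (Fract h 1) = Fract R 1"
      unfolding R_def by (subst toF.poly_map_poly_hom[symmetric], subst map_poly_map_poly)
        (simp_all add: o_def constQX_def Zero_fract_def)
    then have RM: "Fract R 1 \<in> max_ideal (ring_of m)" using P(2) by simp
    interpret shift: comm_ring_homomorphism "\<lambda>f :: rat poly. pcompose (map_poly of_rat f) [:a', 1:]"
      by unfold_locales (auto simp: of_rat_poly.hom_add of_rat_poly.hom_mult pcompose_add pcompose_mult pcompose_1)
    have "pcompose (map_poly of_rat R) [:a', 1:] = poly (map_poly (\<lambda>a. [:of_int a:]) P) F"
      unfolding R_def F_def by (subst shift.poly_map_poly_hom[symmetric], subst map_poly_map_poly)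
        (simp_all add: o_def of_rat_hom.map_poly_hom_const)
    then obtain k where k: "v (coeff (pcompose (map_poly of_rat R) [:a', 1:]) k) = ereal (- d * k)"
      using int_poly_first_min[OF i \<open>i > 0\<close> P(1)] by auto
    then have "R \<noteq> 0" by auto
    then obtain j where "first_min d (pcompose (map_poly of_rat R) [:a', 1:]) j (m R)"
      using ex_first_min_gauss[of "map_poly of_rat R"] by (auto simp: m_def)
    then have "ereal (m R - d * k) \<le> ereal (- d * k)" unfolding first_min_def k[symmetric] by blast
    then have "m R \<le> 0" by simp
    then show False using RM \<open>R \<noteq> 0\<close> by (simp add: m.max_ideal_iff m.fval_Fract m.m_1 Fract_eq_0_iff)
  qed
  then show "res_transcendental p (Zpad v a (Some \<delta>))" by (simp add: res_transcendental_def R)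
qed

end

section \<open>A common extension of the two valuations\<close>

locale padic_poly_valuation = padic_complex p v + poly_valuation p m
  for p :: nat and v :: "'k::field_char_0 \<Rightarrow> ereal" and m :: "rat poly \<Rightarrow> real"
begin

lemma m_sum_ge:
  assumes "\<And>i. i \<in> I \<Longrightarrow> f i = 0 \<or> m (f i) \<ge> c"
  shows "sum f I = 0 \<or> m (sum f I) \<ge> c"
  using assms
proof (induction I rule: infinite_finite_induct)
  case (insert x F)
  then have x: "f x = 0 \<or> m (f x) \<ge> c" and F: "sum f F = 0 \<or> m (sum f F) \<ge> c" by auto
  show ?case
  proof (cases "f x = 0 \<or> sum f F = 0 \<or> f x + sum f F = 0")
    case False
    then have "min (m (f x)) (m (sum f F)) \<le> m (f x + sum f F)" by (intro m_add_ge) auto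
    moreover have "c \<le> min (m (f x)) (m (sum f F))" using x F False by simp
    ultimately have "c \<le> m (f x + sum f F)" by linarith
    then show ?thesis using insert by simp
  qed (use x F insert.hyps in auto)
qed auto

lemma m_smult: "c \<noteq> 0 \<Longrightarrow> f \<noteq> 0 \<Longrightarrow> m (smult c f) = padic_val_rat p c + m f"
  using m_mult[of "[:c:]" f] by (simp add: m_const)

lemma smult_sum_right: "smult (a :: 'a::comm_ring_1) (sum f I) = (\<Sum>i\<in>I. smult a (f i))"
  by (induction I rule: infinite_finite_induct) (simp_all add: smult_add_right)

text \<open>This says that \<open>p\<close> is not invertible in \<open>O \<otimes> W\<close>. A relation of minimal length is shortened by
  a \<open>\<rat>\<close>-linear functional \<open>l\<close> with \<open>l 1 = 1\<close>: it produces a relation over \<open>\<rat>\<close>, which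
  eliminates the \<open>h\<^sub>j\<close> whose coefficient has the smallest value.\<close>

lemma no_relation:
  assumes "finite I" "\<And>i. i \<in> I \<Longrightarrow> v (c i) \<ge> 1" "\<And>i. i \<in> I \<Longrightarrow> h i = 0 \<or> m (h i) \<ge> m G"
    "G \<noteq> 0" "map_poly of_rat G = (\<Sum>i\<in>I. smult (c i) (map_poly of_rat (h i)))"
  shows False
  using assms
proof (induction "card I" arbitrary: I c rule: less_induct)
  case less
  obtain l :: "'k \<Rightarrow> rat" where l_add: "\<And>x y. l (x + y) = l x + l y"
    and l_scale: "\<And>q x. l (of_rat q * x) = q * l x" and l_1: "l 1 = 1"
    using ex_rat_linear_functional by metis
  have l_0: "l 0 = 0" using l_scale[of 0 0] by simp
  have l_sum: "l (sum f J) = (\<Sum>i\<in>J. l (f i))" for f :: "'b \<Rightarrow> 'k" and J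
    by (induction J rule: infinite_finite_induct) (simp_all add: l_0 l_add)
  \<comment> \<open>Apply \<open>l\<close> to each coefficient: the rational coefficients of
    \<open>h i\<close> come out, and \<open>l 1 = 1\<close> preserves those of
    \<open>G\<close>.\<close>
  have G: "G = (\<Sum>i\<in>I. smult (l (c i)) (h i))"
  proof (rule poly_eqI)
    fix n
    have "of_rat (coeff G n) = (\<Sum>i\<in>I. of_rat (coeff (h i) n) * c i)"
      using arg_cong[OF less.prems(5), of "\<lambda>f. coeff f n"] by (simp add: coeff_sum coeff_map_poly mult.commute)
    then have "l (of_rat (coeff G n) * 1) = (\<Sum>i\<in>I. l (of_rat (coeff (h i) n) * c i))"
      by (simp add: l_sum)
    then show "coeff G n = coeff (\<Sum>i\<in>I. smult (l (c i)) (h i)) n"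
      by (simp only: l_scale l_1) (simp add: coeff_sum mult.commute)
  qed
  define J where "J = {i \<in> I. l (c i) \<noteq> 0}"
  define w where "w i = padic_val_rat p (l (c i))" for i
  have J: "finite J" "J \<subseteq> I" using less.prems(1) by (auto simp: J_def)
  show False
  proof (cases "\<forall>i\<in>J. w i \<ge> 1")
    \<comment> \<open>If every nonzero \<open>l (c i)\<close> has value at least 1, the rational
      relation already gives \<open>G\<close> a value above its own.\<close>
    case True
    have "G = 0 \<or> m G \<ge> 1 + m G"
      unfolding G
    proof (rule m_sum_ge, unfold G[symmetric])
      fix i assume "i \<in> I"
      then show "smult (l (c i)) (h i) = 0 \<or> m (smult (l (c i)) (h i)) \<ge> 1 + m G"
      proof (cases "l (c i) = 0 \<or> h i = 0")
        case False
        then have "real_of_int (w i) \<ge> 1" using True \<open>i \<in> I\<close> by (auto simp: J_def)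
        then show ?thesis using False less.prems(3)[OF \<open>i \<in> I\<close>] by (simp add: m_smult w_def)
      qed auto
    qed
    then show False using less.prems(4) by simp
  next
    case False
    define j where "j = arg_min_on w J"
    have "J \<noteq> {}" using False by auto
    then have j: "j \<in> J" "\<And>i. i \<in> J \<Longrightarrow> w j \<le> w i"
      using arg_min_if_finite(1)[OF J(1)] arg_min_least[OF J(1)] by (auto simp: j_def)
    have wj: "w j \<le> 0" using False j(2) by (meson int_one_le_iff_zero_less leI order.trans)
    define q where "q = l (c j)"
    have q: "q \<noteq> 0" using j(1) by (simp add: J_def q_def)
    define r where "r i = l (c i) / q" for i
    have vr_r: "v (of_rat (r i)) \<ge> 0" if "i \<in> I" for i
    proof (cases "l (c i) = 0")
      case False
      then have "padic_val_rat p (r i) \<ge> 0" using j(2)[of i] that q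
        by (simp add: r_def padic_divide J_def w_def q_def)
      then show ?thesis using False q by (simp add: v_of_rat r_def)
    qed (simp add: r_def)
    have jI: "j \<in> I" using j J by auto
    define I' where "I' = I - {j}"
    have I': "finite I'" "card I' < card I" "j \<notin> I'" "I' \<subseteq> I"
      using less.prems(1) jI card_Diff1_less[of I j] by (auto simp: I'_def)
    have split: "sum f I = f j + sum f I'" for f :: "_ \<Rightarrow> 'z::comm_monoid_add"
      unfolding I'_def using less.prems(1) jI by (rule sum.remove)
    have "smult (1 / q) G = smult (1 / q) (smult q (h j) + (\<Sum>i\<in>I'. smult (l (c i)) (h i)))"
      using G unfolding split q_def by simp
    also have "\<dots> = h j + (\<Sum>i\<in>I'. smult (r i) (h i))"
      using q by (simp add: smult_add_right smult_sum_right r_def)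
    finally have hj: "h j = smult (1 / q) G - (\<Sum>i\<in>I'. smult (r i) (h i))" by simp
    let ?e = "map_poly (of_rat :: rat \<Rightarrow> 'k)"
    have e_smult: "?e (smult a f) = smult (of_rat a) (?e f)" for a f
      by (rule map_poly_smult) (simp_all add: of_rat_mult)
    have "?e G = smult (c j) (?e (h j)) + (\<Sum>i\<in>I'. smult (c i) (?e (h i)))"
      using less.prems(5) unfolding split .
    also have "?e (h j) = smult (of_rat (1 / q)) (?e G) - (\<Sum>i\<in>I'. smult (of_rat (r i)) (?e (h i)))"
      by (subst hj) (simp add: of_rat_poly.hom_diff of_rat_poly.hom_sum e_smult)
    also have "smult (c j) (smult (of_rat (1 / q)) (?e G) - (\<Sum>i\<in>I'. smult (of_rat (r i)) (?e (h i))))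
        + (\<Sum>i\<in>I'. smult (c i) (?e (h i)))
      = smult (c j / of_rat q) (?e G) + (\<Sum>i\<in>I'. smult (c i - c j * of_rat (r i)) (?e (h i)))"
      by (simp add: smult_diff_right smult_sum_right smult_diff_left sum_subtractf of_rat_divide)
    finally have E: "?e G = smult (c j / of_rat q) (?e G) + (\<Sum>i\<in>I'. smult (c i - c j * of_rat (r i)) (?e (h i)))" .
    have rel: "smult (1 - c j / of_rat q) (?e G) = (\<Sum>i\<in>I'. smult (c i - c j * of_rat (r i)) (?e (h i)))"
      by (subst smult_diff_left, subst smult_1_left, rule diff_eq_eq[THEN iffD2], subst add.commute)
        (rule E)
    \<comment> \<open>Since \<open>c j\<close> has value at least 1 and \<open>q\<close> at most 0,
      this is 1 minus an element of positive value, so dividing by \<open>u\<close> changes no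
      values. The new coefficients still have value at least 1 because minimality of
      \<open>w j\<close> makes the \<open>r i\<close> integral.\<close>
    define u where "u = 1 - c j / of_rat q"
    have "v (c j / of_rat q) \<ge> 1"
    proof (cases "c j = 0")
      case False
      have "vr (c j) \<ge> 1" using less.prems(2)[OF jI] False by (simp add: v_eq_vr one_ereal_def)
      then have "vr (c j / of_rat q) \<ge> 1" using False q wj by (simp add: vr_divide vr_of_rat w_def q_def)
      then show ?thesis using False q by (simp add: v_eq_vr one_ereal_def)
    qed auto
    then have "v 1 < v (c j / of_rat q)" by (simp add: less_le_trans[of 0 1])
    then have u: "v u = 0" unfolding u_def using v_diff_eq[of 1] by simp
    then have u0: "u \<noteq> 0" "vr u = 0" by (simp_all add: v_eq_0_iff)
    show False
    proof (rule less.hyps[OF I'(2,1), of "\<lambda>i. (c i - c j * of_rat (r i)) / u"])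
      have "?e G = smult (1 / u) (smult u (?e G))" using u0 by simp
      also have "\<dots> = (\<Sum>i\<in>I'. smult ((c i - c j * of_rat (r i)) / u) (?e (h i)))"
        unfolding rel[folded u_def] by (simp add: smult_sum_right)
      finally show "?e G = (\<Sum>i\<in>I'. smult ((c i - c j * of_rat (r i)) / u) (?e (h i)))" .
      show "1 \<le> v ((c i - c j * of_rat (r i)) / u)" if "i \<in> I'" for i
      proof -
        have iI: "i \<in> I" using that I' by auto
        have "1 + 0 \<le> v (c j * of_rat (r i))"
          unfolding v_mult using less.prems(2)[OF jI] vr_r[OF iI] by (rule add_mono)
        then have "1 \<le> min (v (c i)) (v (c j * of_rat (r i)))" using less.prems(2)[OF iI] by simp
        also have "\<dots> \<le> v (c i - c j * of_rat (r i))" by (rule v_diff_ge)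
        finally have 1: "1 \<le> v (c i - c j * of_rat (r i))" .
        have "v (inverse u) = 0" using u0 by (simp add: v_eq_0_iff vr_inverse)
        then show ?thesis using 1 by (simp add: divide_inverse v_mult)
      qed
    qed (use less.prems I' in auto)
  qed
qed

end

section \<open>Embedding constants and Q(X) into C_p(X)\<close>

lemma common_denominator:
  assumes "finite I" shows "\<exists>G::'a::idom. G \<noteq> 0 \<and> (\<forall>i\<in>I. \<exists>h. x i = Fract h G)"
  using assms
proof (induction I)
  case (insert i I)
  then obtain G where G: "G \<noteq> 0" "\<forall>i\<in>I. \<exists>h. x i = Fract h G" by auto
  obtain f g where fg: "x i = Fract f g" "g \<noteq> 0" by (cases "x i")
  have "\<exists>h. x j = Fract h (g * G)" if j: "j \<in> insert i I" for j
  proof (cases "j = i")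
    case True
    then show ?thesis using fg G by (intro exI[of _ "f * G"]) (simp add: eq_fract)
  next
    case False
    then have "j \<in> I" using j by simp
    then obtain h where "x j = Fract h G" using G by blast
    then show ?thesis using fg G by (intro exI[of _ "g * h"]) (simp add: eq_fract)
  qed
  then show ?case using fg G by (intro exI[of _ "g * G"]) auto
qed (auto intro: exI[of _ 1])

definition const_fract :: "'a::idom \<Rightarrow> 'a poly fract" where "const_fract c = Fract [:c:] 1"

interpretation const_fract: comm_ring_homomorphism "const_fract :: 'a::idom \<Rightarrow> 'a poly fract"
  by unfold_locales (simp_all add: const_fract_def One_fract_def one_pCons mult.commute)

lemma const_fract_eq_0_iff [simp]: "const_fract c = 0 \<longleftrightarrow> c = 0"
  by (simp add: const_fract_def Fract_eq_0_iff)

lemma const_fract_inverse: "const_fract (inverse c) = inverse (const_fract (c :: 'a::field))"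
proof (cases "c = 0")
  case False
  then have "const_fract c * const_fract (inverse c) = 1"
    using const_fract.hom_mult[of c "inverse c"] by (simp add: const_fract.hom_1)
  then show ?thesis by (simp add: inverse_unique)
qed (simp add: const_fract.hom_0)

interpretation emb: idom_embedding "\<lambda>f :: rat poly. Fract (map_poly of_rat f) (1 :: 'k::field_char_0 poly)"
  by unfold_locales (simp_all add: of_rat_poly.hom_add of_rat_poly.hom_mult One_fract_def Fract_eq_0_iff)

abbreviation base_change :: "QX \<Rightarrow> 'k::field_char_0 poly fract" where
  "base_change \<equiv> emb.fract_hom"

interpretation base_change: comm_ring_homomorphism "base_change :: QX \<Rightarrow> 'k::field_char_0 poly fract"
  by (rule emb.fract_hom)

lemma base_change_inverse: "base_change (inverse x) = inverse (base_change x)"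
proof (cases "x = 0")
  case False
  then show ?thesis
    by (intro inverse_unique[symmetric]) (simp add: base_change.hom_1 flip: base_change.hom_mult)
qed (simp add: base_change.hom_0)

context padic_poly_valuation begin

text \<open>The image of the tensor product of \<open>O_p\<close> and \<open>W\<close> in C_p(X). As
  both factors are rings, sums of products are closed under multiplication.\<close>

inductive_set compositum :: "'k poly fract set" where
  compositum_base: "v c \<ge> 0 \<Longrightarrow> x \<in> ring_of m \<Longrightarrow> const_fract c * base_change x \<in> compositum"
| compositum_add: "y \<in> compositum \<Longrightarrow> z \<in> compositum \<Longrightarrow> y + z \<in> compositum"

lemma ring_of_mult: "x \<in> ring_of m \<Longrightarrow> y \<in> ring_of m \<Longrightarrow> x * y \<in> ring_of m"
  by (cases "x = 0"; cases "y = 0") (auto simp: ring_of_iff fval_mult)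

lemma fval_1: "fval 1 = 0" using fval_mult[of 1 1] by simp

lemma ring_of_1: "1 \<in> ring_of m" by (simp add: ring_of_iff fval_1)

lemma subring_compositum: "subring_set compositum"
  unfolding subring_set_def
proof (intro conjI ballI)
  show "1 \<in> compositum"
    using compositum_base[of 1 1] ring_of_1 by (simp add: const_fract.hom_1 base_change.hom_1)
  have uminus: "- y \<in> compositum" if "y \<in> compositum" for y
    using that
  proof induction
    case (compositum_base c x)
    then show ?case using compositum.compositum_base[of "- c" x] by (simp add: const_fract.hom_uminus)
  next
    case (compositum_add y z)
    then show ?case using compositum.compositum_add[of "- y" "- z"] by (simp add: add.commute)
  qed
  fix y z assume y: "y \<in> compositum" and z: "z \<in> compositum"
  show "y - z \<in> compositum" using compositum_add[OF y uminus[OF z]] by simp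
  have base: "const_fract c * base_change x * z \<in> compositum" if "v c \<ge> 0" "x \<in> ring_of m" for c x
    using z
  proof induction
    case (compositum_base d y)
    have "const_fract (c * d) * base_change (x * y) \<in> compositum"
      using that compositum_base by (intro compositum.compositum_base) (auto simp: v_mult ring_of_mult)
    then show ?case by (simp add: const_fract.hom_mult base_change.hom_mult mult_ac)
  next
    case (compositum_add y z)
    then show ?case using compositum.compositum_add by (simp add: distrib_left)
  qed
  show "y * z \<in> compositum" using y
    by induction (auto simp: base distrib_right intro: compositum.compositum_add)
qed

lemma compositum_sum:
  "y \<in> compositum \<Longrightarrow> \<exists>xs. (\<forall>(c, x)\<in>set xs. v c \<ge> 0 \<and> x \<in> ring_of m) \<and>
     y = (\<Sum>(c, x)\<leftarrow>xs. const_fract c * base_change x)"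
proof (induction rule: compositum.induct)
  case (compositum_base c x)
  then show ?case by (intro exI[of _ "[(c, x)]"]) auto
next
  case (compositum_add y z)
  then obtain xs ys where "\<forall>(c, x)\<in>set xs. v c \<ge> 0 \<and> x \<in> ring_of m"
     "y = (\<Sum>(c, x)\<leftarrow>xs. const_fract c * base_change x)" 
     "\<forall>(c, x)\<in>set ys. v c \<ge> 0 \<and> x \<in> ring_of m"
     "z = (\<Sum>(c, x)\<leftarrow>ys. const_fract c * base_change x)" by blast
  then show ?case by (intro exI[of _ "xs @ ys"]) auto
qed

text \<open>Multiplied by \<open>p\<close> and by a common denominator \<open>G\<close>, an
  expression for \<open>inverse p\<close> becomes a relation
  \<open>G = \<Sum> (p * c i) * h i\<close> of the kind excluded by \<open>no_relation\<close>: the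
  factor \<open>p\<close> raises the values of the coefficients to at least 1.\<close>

lemma inverse_p_notin_compositum: "inverse (of_nat p) \<notin> compositum"
proof
  assume "inverse (of_nat p) \<in> compositum"
  then obtain xs where xs: "\<forall>(c, x)\<in>set xs. v c \<ge> 0 \<and> x \<in> ring_of m"
     "inverse (of_nat p) = (\<Sum>(c, x)\<leftarrow>xs. const_fract c * base_change x)" using compositum_sum by blast
  define I where "I = {..<length xs}"
  define c where "c i = fst (xs ! i)" for i
  define x where "x i = snd (xs ! i)" for i
  have cx: "v (c i) \<ge> 0" "x i \<in> ring_of m" if "i \<in> I" for i
    using xs(1) that nth_mem[of i xs] by (auto simp: I_def c_def x_def case_prod_beta)
  have sum: "inverse (of_nat p) = (\<Sum>i\<in>I. const_fract (c i) * base_change (x i))"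
    unfolding xs(2) by (simp add: sum_list_sum_nth I_def c_def x_def case_prod_beta atLeast0LessThan)
  obtain G where G: "G \<noteq> 0" "\<forall>i\<in>I. \<exists>h. x i = Fract h G"
    using common_denominator[of I x] by (auto simp: I_def)
  then obtain h where h: "\<And>i. i \<in> I \<Longrightarrow> x i = Fract (h i) G" by metis
  let ?e = "map_poly (of_rat :: rat \<Rightarrow> 'k)"
  let ?F = "\<lambda>f :: 'k poly. Fract f 1"
  interpret F: comm_ring_homomorphism ?F
    by unfold_locales (simp_all add: One_fract_def)
  have bc: "base_change (x i) * ?F (?e G) = ?F (?e (h i))" if "i \<in> I" for i
    using G(1) by (simp add: h[OF that] emb.fract_hom_Fract eq_fract)
  have "(of_nat p :: 'k poly fract) \<noteq> 0"
    using const_fract_eq_0_iff[of "of_nat p :: 'k"] p_nz by (simp add: const_fract.hom_of_nat)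
  then have "?F (?e G) = of_nat p * (inverse (of_nat p) * ?F (?e G))" by simp
  also have "\<dots> = (\<Sum>i\<in>I. of_nat p * (const_fract (c i) * (base_change (x i) * ?F (?e G))))"
    unfolding sum by (simp add: sum_distrib_left sum_distrib_right mult.assoc)
  also have "\<dots> = (\<Sum>i\<in>I. ?F (smult (of_nat p * c i) (?e (h i))))"
  proof (rule sum.cong)
    fix i assume "i \<in> I"
    have "of_nat p * (const_fract (c i) * ?F (?e (h i))) = const_fract (of_nat p * c i) * ?F (?e (h i))"
      by (simp add: const_fract.hom_mult const_fract.hom_of_nat mult.assoc del: mult_fract)
    then show "of_nat p * (const_fract (c i) * (base_change (x i) * ?F (?e G))) = ?F (smult (of_nat p * c i) (?e (h i)))"
      unfolding bc[OF \<open>i \<in> I\<close>] by (simp add: const_fract_def)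
  qed simp
  also have "\<dots> = ?F (\<Sum>i\<in>I. smult (of_nat p * c i) (?e (h i)))" by (rule F.hom_sum[symmetric])
  finally have "?e G = (\<Sum>i\<in>I. smult (of_nat p * c i) (?e (h i)))" by (simp add: eq_fract)
  moreover have "v (of_nat p * c i) \<ge> 1" if "i \<in> I" for i
    using add_left_mono[OF cx(1)[OF that], of 1] by (simp add: v_mult v_p)
  moreover have "h i = 0 \<or> m (h i) \<ge> m G" if "i \<in> I" for i
    using cx(2)[OF that] by (simp add: h[OF that] Fract_in_ring_of_iff G(1))
  ultimately show False using no_relation[of I "\<lambda>i. of_nat p * c i" h G] G(1) by (simp add: I_def)
qed

lemma ex_common_extension:
  "\<exists>V. valuation_ring V (of_nat p :: 'k poly fract) \<and>
     (\<forall>c. v c \<ge> 0 \<longrightarrow> const_fract c \<in> V) \<and> (\<forall>x\<in>ring_of m. base_change x \<in> V)"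
proof -
  have "(of_nat p :: 'k poly fract) \<noteq> 0"
    using const_fract_eq_0_iff[of "of_nat p :: 'k"] p_nz by (simp add: const_fract.hom_of_nat)
  moreover have c: "const_fract c \<in> compositum" if "v c \<ge> 0" for c
    using compositum_base[OF that ring_of_1] by (simp add: base_change.hom_1)
  moreover have "base_change x \<in> compositum" if "x \<in> ring_of m" for x
    using compositum_base[OF _ that, of 1] by (simp add: const_fract.hom_1)
  moreover have "of_nat p \<in> compositum"
    using c[of "of_nat p"] by (simp add: v_p const_fract.hom_of_nat)
  ultimately show ?thesis
    using valuation_ring_extension[OF subring_compositum _ _ inverse_p_notin_compositum] by blast
qed

end

locale common_extension = padic_poly_valuation p v m + V: valuation_ring V "of_nat p"
  for p :: nat and v :: "'k::field_char_0 \<Rightarrow> ereal" and m :: "rat poly \<Rightarrow> real" and V :: "'k poly fract set" +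
  fixes e :: nat
  assumes const_in_V: "v c \<ge> 0 \<Longrightarrow> const_fract c \<in> V"
    and base_change_in_V: "x \<in> ring_of m \<Longrightarrow> base_change x \<in> V"
    and e_pos: "e > 0" and discrete: "f \<noteq> 0 \<Longrightarrow> of_nat e * m f \<in> \<int>"
begin

text \<open>Units of \<open>O_p\<close> remain units in \<open>V\<close>, so an equation between
  \<open>c ^ t\<close> and \<open>p ^ s\<close> up to a unit carries over.\<close>

lemma has_val_const: assumes "c \<noteq> 0" shows "V.has_val (const_fract c) (vr c)"
proof -
  obtain t s where ts: "t > 0" "O.unit (c ^ t * of_nat p powi (- s))" "vr c = of_int s / of_nat t"
    using O_has_val_all[OF assms] by (auto simp: O.has_val_def)
  let ?u = "c ^ t * of_nat p powi (- s)"
  have u: "v ?u = 0" "v (inverse ?u) = 0" "?u \<noteq> 0"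
    using ts(2) O.unit_inverse[OF ts(2)] by (simp_all only: O_unit_iff) (auto simp: v_eq_0_iff)
  have powi: "const_fract (x powi n) = const_fract x powi n" for x :: 'k and n
    by (simp add: power_int_def const_fract.hom_power const_fract_inverse)
  have "const_fract ?u = const_fract c ^ t * of_nat p powi (- s)"
    by (simp only: const_fract.hom_mult const_fract.hom_power powi const_fract.hom_of_nat)
  moreover have "V.unit (const_fract ?u)"
    using const_in_V[of ?u] const_in_V[of "inverse ?u"] u
    by (simp add: V.unit_def const_fract_inverse del: inverse_mult_distrib)
  ultimately show ?thesis using ts by (intro V.has_valI[of t _ s]) auto
qed

lemma discrete_fval: assumes "x \<noteq> 0" shows "of_nat e * fval x \<in> \<int>"
  using discrete assms by (cases x rule: QX_cases) (simp_all add: fval_Fract right_diff_distrib)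

lemma fval_power: "x \<noteq> 0 \<Longrightarrow> fval (x ^ n) = n * fval x"
  by (induction n) (simp_all add: fval_1 fval_mult algebra_simps)

lemma of_nat_p_QX: "of_nat p = constQX (of_nat p)" by (rule constQX.hom_of_nat[symmetric])
lemma p_QX_nz: "(of_nat p :: QX) \<noteq> 0" unfolding of_nat_p_QX using p_nz[where 'a = rat] by simp
lemma fval_p: "fval (of_nat p) = 1" unfolding of_nat_p_QX by (simp add: fval_const p_nz padic_p)
lemma fval_p_powi: "fval (of_nat p powi n) = n"
  using p_QX_nz by (simp add: power_int_def fval_power fval_p fval_inverse)

text \<open>Discreteness supplies the exponent: with \<open>s = e * fval x\<close>, the elements
  \<open>x ^ e\<close> and \<open>p ^ s\<close> differ by a unit of \<open>W\<close>, which stays a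
  unit in \<open>V\<close>.\<close>

lemma has_val_base_change: assumes "x \<noteq> 0" shows "V.has_val (base_change x) (fval x)"
proof -
  obtain s where s: "of_nat e * fval x = of_int s" using discrete_fval[OF assms] by (auto elim: Ints_cases)
  define u where "u = x ^ e * of_nat p powi (- s)"
  have u: "u \<noteq> 0" "fval u = 0" using assms p_QX_nz s
    by (simp_all add: u_def fval_mult fval_power fval_p_powi)
  then have "u \<in> ring_of m" "inverse u \<in> ring_of m" by (auto simp: ring_of_iff fval_inverse)
  then have "V.unit (base_change u)" using u base_change_in_V[of u] base_change_in_V[of "inverse u"]
    by (simp add: V.unit_def base_change_inverse emb.fract_hom_eq_0_iff)
  moreover have "base_change u = (base_change x ^ e * of_nat p powi (- s) :: 'k poly fract)"
    by (simp add: u_def base_change.hom_mult base_change.hom_power power_int_def base_change_inverse base_change.hom_of_nat)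
  ultimately show ?thesis using e_pos s
    by (intro V.has_valI[of e _ s]) (simp_all add: eq_divide_eq mult.commute)
qed

section \<open>The distance from X to algebraic constants\<close>

definition lin :: "'k \<Rightarrow> 'k poly fract" where "lin a = Fract [:- a, 1:] 1"

lemma lin_nz: "lin a \<noteq> 0" by (simp add: lin_def Fract_eq_0_iff)

lemma lin_conv: "lin a = base_change varX - const_fract a"
  by (simp add: lin_def varX_def emb.fract_hom_Fract const_fract_def map_poly_pCons One_fract_def[symmetric])

lemma lin_diff: "lin a - lin b = const_fract (b - a)"
  by (simp add: lin_conv const_fract.hom_diff)

text \<open>If \<open>A(a) = 0\<close>, then \<open>T = X - a\<close> is a root of
  \<open>A(X - T)\<close>, whose coefficients as a polynomial in \<open>T\<close> lie in Q[X]. Those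
  coefficients have values because \<open>V\<close> lies over \<open>W\<close>.\<close>

lemma ex_has_val_lin: assumes "alg_over_Q a" shows "\<exists>r. V.has_val (lin a) r"
proof -
  obtain A :: "rat poly" where A: "A \<noteq> 0" "poly (map_poly of_rat A) a = 0"
    using assms by (auto simp: alg_over_Q_def)
  define C where "C c = const_fract (of_rat c :: 'k)" for c
  define H where "H = pcompose (map_poly C A) [:base_change varX, -1:]"
  have C0: "C c = 0 \<longleftrightarrow> c = 0" for c by (simp add: C_def)
  have "map_poly C A = map_poly const_fract (map_poly of_rat A)"
    by (simp add: map_poly_map_poly o_def C_def[abs_def] const_fract.hom_0)
  then have "poly (map_poly C A) (const_fract a) = 0"
    by (simp add: const_fract.poly_map_poly_hom A const_fract.hom_0)
  then have root: "poly H (lin a) = 0" by (simp add: H_def poly_pcompose lin_conv)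
  have "map_poly C A \<noteq> 0" using A(1) by (simp add: map_poly_eq_0_iff C0)
  then have "H \<noteq> 0" unfolding H_def by (auto simp: pcompose_eq_0)
  let ?E = "\<lambda>f :: rat poly. Fract (map_poly of_rat f) (1 :: 'k poly)"
  have coeffs: "coeff H i \<in> range ?E" for i
    unfolding H_def
  proof (rule coeff_pcompose_in_subring[OF emb.subring_set_range])
    have c: "C c \<in> range ?E" for c
      by (rule range_eqI[of _ _ "[:c:]"]) (simp add: C_def const_fract_def of_rat_hom.map_poly_hom_const)
    show "coeff (map_poly C A) j \<in> range ?E" for j using c by (simp add: coeff_map_poly C0)
    have "base_change varX \<in> range ?E"
      by (rule range_eqI[of _ _ "[:0, 1:]"]) (simp add: varX_def emb.fract_hom_Fract One_fract_def[symmetric])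
    moreover have "C 0 = 0" "C (- 1) = - 1"
      by (simp_all add: C_def const_fract.hom_0 const_fract.hom_uminus const_fract.hom_1)
    ultimately show "coeff [:base_change varX, -1:] j \<in> range ?E" for j
      using c[of 0] c[of "-1"] by (auto simp: coeff_pCons split: nat.splits)
  qed
  show ?thesis
  proof (rule V.root_has_val[OF root \<open>H \<noteq> 0\<close> lin_nz])
    fix i assume nz: "coeff H i \<noteq> 0"
    obtain f where "coeff H i = ?E f" using coeffs by blast
    then have "coeff H i = base_change (Fract f 1)" by (simp add: emb.fract_hom_Fract One_fract_def[symmetric])
    moreover from this have "Fract f 1 \<noteq> 0" using nz by (auto simp: base_change.hom_0)
    ultimately show "\<exists>r. V.has_val (coeff H i) r" using has_val_base_change[of "Fract f 1"] by auto
  qed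
qed

text \<open>The distance from \<open>a\<close> to X on the valuation scale: larger means closer. It
  is well defined for \<open>a\<close> algebraic over \<rat>, where the value exists.\<close>

definition D :: "'k \<Rightarrow> real" where "D a = (THE r. V.has_val (lin a) r)"

lemma has_val_lin: "alg_over_Q a \<Longrightarrow> V.has_val (lin a) (D a)"
  unfolding D_def using ex_has_val_lin V.has_val_unique by (metis theI)

text \<open>A nonzero polynomial over \<rat> has algebraic roots only, so its value is a sum of
  values \<open>D b\<close> plus that of a constant. The function \<open>\<mu>\<close> is left open
  to cover both the monomial valuation and evaluation at a limit.\<close>

lemma determined_by_D:
  fixes \<mu> :: "'k poly \<Rightarrow> ereal"
  assumes \<mu>: "\<And>b G. G \<noteq> 0 \<Longrightarrow> \<mu> ([:- b, 1:] * G) = \<mu> [:- b, 1:] + \<mu> G" "\<And>c. c \<noteq> 0 \<Longrightarrow> \<mu> [:c:] = v c"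
    "\<And>b. alg_over_Q b \<Longrightarrow> \<mu> [:- b, 1:] = ereal (D b)" and "f \<noteq> 0"
  shows "\<mu> (map_poly of_rat f) = ereal (m f)"
proof -
  have "(\<forall>b. poly F b = 0 \<longrightarrow> alg_over_Q b) \<longrightarrow> (\<exists>r. V.has_val (Fract F 1) r \<and> \<mu> F = ereal r)"
    if "F \<noteq> 0" for F using that
  proof (induction F rule: split_induct)
    case (const c)
    then show ?case using has_val_const[of c] \<mu>(2) by (auto simp: const_fract_def v_eq_vr)
  next
    case (linear b G)
    show ?case
    proof
      assume a: "\<forall>x. poly ([:- b, 1:] * G) x = 0 \<longrightarrow> alg_over_Q x"
      then obtain r where r: "V.has_val (Fract G 1) r" "\<mu> G = ereal r" using linear by auto
      have "poly ([:- b, 1:] * G) b = 0" by simp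
      then have b: "alg_over_Q b" using a by blast
      have "V.has_val (lin b * Fract G 1) (D b + r)" by (intro V.has_val_mult has_val_lin b r)
      then have "V.has_val (Fract ([:- b, 1:] * G) 1) (D b + r)" by (simp only: lin_def mult_fract mult_1_right)
      moreover have "\<mu> ([:- b, 1:] * G) = ereal (D b + r)"
        using \<mu>(1)[OF linear(1)] \<mu>(3)[OF b] r by simp
      ultimately show "\<exists>r. V.has_val (Fract ([:- b, 1:] * G) 1) r \<and> \<mu> ([:- b, 1:] * G) = ereal r" by blast
    qed
  qed
  moreover have "\<forall>b. poly (map_poly of_rat f) b = 0 \<longrightarrow> alg_over_Q b" using \<open>f \<noteq> 0\<close> by (auto simp: alg_over_Q_def)
  ultimately obtain r where r: "V.has_val (Fract (map_poly of_rat f) 1) r" "\<mu> (map_poly of_rat f) = ereal r"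
    using \<open>f \<noteq> 0\<close> by (metis map_poly_of_rat_eq_0_iff)
  have "V.has_val (base_change (Fract f 1)) (m f)"
    using has_val_base_change[of "Fract f 1"] \<open>f \<noteq> 0\<close> by (simp add: Fract_eq_0_iff fval_Fract m_1)
  then have "r = m f" using r(1) V.has_val_unique
    by (simp add: emb.fract_hom_Fract One_fract_def[symmetric])
  then show ?thesis using r(2) by simp
qed

lemma const_in_V_iff: "const_fract c \<in> V \<longleftrightarrow> v c \<ge> 0"
  using has_val_const[of c] V.has_val_in_iff[of "const_fract c"] V.zero_in
  by (cases "c = 0") (auto simp: v_nonneg_iff const_fract.hom_0)

lemma const_nonunit_iff: "const_fract c \<in> V.nonunits \<longleftrightarrow> v c > 0"
  using has_val_const[of c] V.has_val_nonunits_iff[of "const_fract c"] V.nonunits_0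
  by (cases "c = 0") (auto simp: v_pos_iff const_fract.hom_0)

lemma base_change_in_V_iff: "base_change x \<in> V \<longleftrightarrow> x \<in> ring_of m"
  using has_val_base_change[of x] V.has_val_in_iff[of "base_change x"] V.zero_in
  by (cases "x = 0") (auto simp: ring_of_iff base_change.hom_0)

lemma base_change_nonunit_iff: "base_change x \<in> V.nonunits \<longleftrightarrow> x \<in> max_ideal (ring_of m)"
  using has_val_base_change[of x] V.has_val_nonunits_iff[of "base_change x"] V.nonunits_0
  by (cases "x = 0") (auto simp: max_ideal_iff base_change.hom_0)

text \<open>The ultrametric triangle formed by X, \<open>a\<close> and \<open>b\<close>: from
  \<open>b\<close>, the closer point \<open>a\<close> looks like X up to distance
  \<open>D a\<close>.\<close>

lemma D_min:
  assumes "alg_over_Q a" "alg_over_Q b" "D b \<le> D a" shows "ereal (D b) = min (ereal (D a)) (v (a - b))"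
proof (cases "a = b")
  case False
  have sum: "lin b = lin a + const_fract (a - b)" using lin_diff[of b a] by (simp add: algebra_simps)
  have c: "V.has_val (const_fract (a - b)) (vr (a - b))" using False by (intro has_val_const) simp
  have ge: "D b \<ge> min (D a) (vr (a - b))"
    using V.has_val_add_ge[OF has_val_lin[OF assms(1)] c] has_val_lin[OF assms(2)] sum by simp
  have "D b = vr (a - b)" if "vr (a - b) < D a"
    using V.has_val_add_strict[OF c has_val_lin[OF assms(1)] that] has_val_lin[OF assms(2)] sum
    by (simp add: add.commute V.has_val_unique)
  then show ?thesis using ge assms(3) False by (auto simp: v_eq_vr min_def)
qed simp

lemma maximum_imp_monomial:
  assumes a: "alg_over_Q a" and max: "\<And>b. alg_over_Q b \<Longrightarrow> D b \<le> D a"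
  shows "\<exists>\<delta>. ring_of m = Zpad v a (Some \<delta>)"
proof -
  obtain \<delta> :: rat where \<delta>: "D a = of_rat \<delta>"
    using V.has_val_rat[OF has_val_lin[OF a]] by (auto elim: Rats_cases)
  have "ereal (gauss (D a) a (map_poly of_rat f)) = ereal (m f)" if "f \<noteq> 0" for f
  proof (rule determined_by_D[where \<mu> = "\<lambda>F. ereal (gauss (D a) a F)", OF _ _ _ that])
    show "ereal (gauss (D a) a ([:- b, 1:] * G)) = ereal (gauss (D a) a [:- b, 1:]) + ereal (gauss (D a) a G)"
      if "G \<noteq> 0" for b G using gauss_mult[of "[:- b, 1:]" G] that by simp
    show "ereal (gauss (D a) a [:c:]) = v c" if "c \<noteq> 0" for c using that by (simp add: gauss_const v_eq_vr)
    show "ereal (gauss (D a) a [:- b, 1:]) = ereal (D b)" if "alg_over_Q b" for b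
      unfolding gauss_linear using D_min[OF a that max[OF that]] by simp
  qed
  then have "ring_of m = Zpad v a (Some \<delta>)" unfolding Zpad_Some \<delta>[symmetric] by (intro ring_of_cong) simp
  then show ?thesis ..
qed

text \<open>If \<open>a\<close> is closer to X than a root \<open>b\<close>, then
  \<open>v (a - b) = D b < D a\<close>, so \<open>X - b = (a - b) * (1 + y)\<close> with
  \<open>y = (X - a) / (a - b)\<close> a nonunit. Multiplying over all roots, \<open>F\<close>
  differs from \<open>F(a)\<close> by a factor congruent to 1.\<close>

lemma near_constant:
  assumes a: "alg_over_Q a" and "F \<noteq> 0"
  shows "(\<forall>b. poly F b = 0 \<longrightarrow> alg_over_Q b \<and> D b < D a) \<longrightarrow>
    poly F a \<noteq> 0 \<and> (\<exists>z\<in>V.nonunits. Fract F 1 = const_fract (poly F a) * (1 + z))"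
  using assms(2)
proof (induction F rule: split_induct)
  case (const c)
  then show ?case by (auto simp: const_fract_def intro!: bexI[of _ 0] V.nonunits_0)
next
  case (linear b G)
  show ?case
  proof
    assume r: "\<forall>x. poly ([:- b, 1:] * G) x = 0 \<longrightarrow> alg_over_Q x \<and> D x < D a"
    then obtain z where z: "poly G a \<noteq> 0" "z \<in> V.nonunits" "Fract G 1 = const_fract (poly G a) * (1 + z)"
      using linear(3) by auto
    have "poly ([:- b, 1:] * G) b = 0" by simp
    then have b: "alg_over_Q b" "D b < D a" using r by blast+
    then have "a \<noteq> b" by auto
    then have vab: "vr (a - b) = D b" using D_min[OF a b(1)] b(2) by (auto simp: v_eq_vr min_def split: if_splits)
    define y where "y = lin a / const_fract (a - b)"
    have y: "y \<in> V.nonunits"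
      using V.has_val_nonunits_iff[OF V.has_val_divide[OF has_val_lin[OF a] has_val_const[of "a - b"]]] \<open>a \<noteq> b\<close> vab b
      by (simp add: y_def)
    have "lin b = lin a + const_fract (a - b)" using lin_diff[of b a] by (simp add: algebra_simps)
    also have "\<dots> = const_fract (a - b) * (1 + y)" using \<open>a \<noteq> b\<close> by (simp add: y_def distrib_left)
    finally have lb: "lin b = const_fract (a - b) * (1 + y)" .
    have "Fract ([:- b, 1:] * G) 1 = lin b * Fract G 1" by (simp only: lin_def mult_fract mult_1_right)
    also have "\<dots> = const_fract (poly ([:- b, 1:] * G) a) * (1 + (y + z + y * z))"
      unfolding lb z(3) by (simp add: const_fract.hom_mult const_fract.hom_diff algebra_simps)
    finally have "Fract ([:- b, 1:] * G) 1 = const_fract (poly ([:- b, 1:] * G) a) * (1 + (y + z + y * z))" .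
    moreover have "y + z + y * z \<in> V.nonunits"
      using y z by (auto intro!: V.nonunits_add V.nonunits_mult V.nonunits_in)
    ultimately show "poly ([:- b, 1:] * G) a \<noteq> 0 \<and>
      (\<exists>z\<in>V.nonunits. Fract ([:- b, 1:] * G) 1 = const_fract (poly ([:- b, 1:] * G) a) * (1 + z))"
      using \<open>a \<noteq> b\<close> z(1) by auto
  qed
qed

text \<open>Without a maximum some \<open>a\<close> is closer to X than all the finitely many roots
  of numerator and denominator. Then \<open>x\<close> has the residue class of the constant
  \<open>f(a) / g(a)\<close>, and residue classes of constants are algebraic over the prime
  field.\<close>

lemma no_maximum_imp_res_algebraic:
  assumes "\<And>a. alg_over_Q a \<Longrightarrow> \<exists>b. alg_over_Q b \<and> D b > D a"
  shows "res_algebraic p (ring_of m)"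
  unfolding res_algebraic_def
proof
  fix x assume x: "x \<in> ring_of m"
  have "\<exists>c. v c \<ge> 0 \<and> base_change x - const_fract c \<in> V.nonunits"
  proof (cases x rule: QX_cases)
    case 1
    then show ?thesis by (intro exI[of _ 0]) (simp add: base_change.hom_0 const_fract.hom_0 V.nonunits_0)
  next
    case (2 f g)
    let ?e = "map_poly (of_rat :: rat \<Rightarrow> 'k)"
    define S where "S = {b. poly (?e (f * g)) b = 0}"
    have S: "finite S" unfolding S_def using 2 by (intro poly_roots_finite) simp
    have Salg: "alg_over_Q b" if "b \<in> S" for b
      using that 2 unfolding S_def alg_over_Q_def by (intro exI[of _ "f * g"]) auto
    have "\<exists>a. alg_over_Q a \<and> (\<forall>b\<in>S. D b < D a)" using S Salg
    proof (induction S)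
      case empty
      show ?case using dense[of 0 0] by auto
    next
      case (insert b S)
      then obtain a where a: "alg_over_Q a" "\<forall>b\<in>S. D b < D a" by auto
      define a' where "a' = (if D a \<ge> D b then a else b)"
      have "alg_over_Q a'" "D a' \<ge> D a" "D a' \<ge> D b" using a insert by (auto simp: a'_def)
      moreover obtain a'' where "alg_over_Q a''" "D a'' > D a'" using assms \<open>alg_over_Q a'\<close> by blast
      ultimately show ?case using a by (intro exI[of _ a'']) (auto intro: less_trans le_less_trans)
    qed
    then obtain a where a: "alg_over_Q a" "\<forall>b\<in>S. D b < D a" by blast
    have roots: "poly (?e f) b = 0 \<Longrightarrow> alg_over_Q b \<and> D b < D a"
      "poly (?e g) b = 0 \<Longrightarrow> alg_over_Q b \<and> D b < D a" for b
      using a(2) Salg[of b] by (auto simp: S_def of_rat_poly.hom_mult)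
    obtain z where z: "poly (?e f) a \<noteq> 0" "z \<in> V.nonunits" "Fract (?e f) 1 = const_fract (poly (?e f) a) * (1 + z)"
      using near_constant[OF a(1), of "?e f"] roots(1) 2 by auto
    obtain y where y: "poly (?e g) a \<noteq> 0" "y \<in> V.nonunits" "Fract (?e g) 1 = const_fract (poly (?e g) a) * (1 + y)"
      using near_constant[OF a(1), of "?e g"] roots(2) 2 by auto
    define c where "c = poly (?e f) a / poly (?e g) a"
    define w where "w = (1 + z) / (1 + y)"
    have u: "V.unit w" "V.unit (1 + y)" using y z by (auto simp: w_def intro!: V.unit_divide V.unit_1_add_nonunit)
    have bx: "base_change x = const_fract c * w"
      using 2 y z by (simp add: emb.fract_hom_Fract c_def w_def divide_inverse const_fract.hom_mult const_fract_inverse)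
    have "const_fract c = base_change x * inverse w" using u unfolding bx by (simp add: V.unit_def)
    moreover have "\<dots> \<in> V" using u base_change_in_V[OF x] by (auto simp: V.unit_def intro: V.mult_in)
    ultimately have cV: "const_fract c \<in> V" by simp
    have "w - 1 = (z - y) * inverse (1 + y)" using u by (simp add: w_def V.unit_def field_simps)
    then have "w - 1 \<in> V.nonunits" using u y z by (auto simp: V.unit_def intro!: V.nonunits_mult V.nonunits_diff)
    then have "(w - 1) * const_fract c \<in> V.nonunits" using cV by (rule V.nonunits_mult)
    moreover have "base_change x - const_fract c = (w - 1) * const_fract c" unfolding bx by (simp add: algebra_simps)
    ultimately show ?thesis using cV by (auto simp: const_in_V_iff)
  qed
  then obtain c where c: "v c \<ge> 0" "base_change x - const_fract c \<in> V.nonunits" by blast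
  obtain P :: "int poly" where P: "\<exists>i. \<not> int p dvd coeff P i" "v (poly (map_poly of_int P) c) > 0"
    using residue_algebraic[OF c(1)] by blast
  have "poly (map_poly of_int P) (const_fract c) = const_fract (poly (map_poly of_int P) c)"
    using const_fract.poly_map_poly_hom[of "map_poly of_int P" c]
    by (simp add: map_poly_map_poly o_def const_fract.hom_of_int)
  then have "poly (map_poly of_int P) (const_fract c) \<in> V.nonunits" using P(2) by (simp add: const_nonunit_iff)
  then have "poly (map_poly of_int P) (base_change x) \<in> V.nonunits"
    by (subst V.poly_eq_mod_nonunits[where y = "const_fract c"])
      (use c base_change_in_V[OF x] in \<open>auto simp: coeff_map_poly V.of_int_in const_in_V_iff\<close>)
  then have "poly (map_poly (\<lambda>a. constQX (of_int a)) P) x \<in> max_ideal (ring_of m)"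
    by (simp flip: base_change_nonunit_iff add: int_poly_hom_eval[OF base_change.comm_ring_homomorphism_axioms])
  then show "\<exists>f :: int poly. (\<exists>i. \<not> int p dvd coeff f i) \<and>
      poly (map_poly (\<lambda>a. constQX (of_int a)) f) x \<in> max_ideal (ring_of m)" using P(1) by blast
qed

lemma unbounded_imp_evaluation:
  assumes unb: "\<And>M :: nat. \<exists>b. lin b / of_nat p ^ M \<in> V"
  shows "\<exists>a. \<not> alg_over_Q a \<and> a \<in> Cp_br v \<and> ring_of m = Zpad v a None"
proof -
  have pn: "V.has_val (of_nat p ^ M) (of_nat M)" for M using V.has_val_pi[of "int M"] by simp
  \<comment> \<open>The given \<open>b\<close> is an arbitrary constant, while \<open>D\<close> is
    controlled at algebraic ones; an algebraic \<open>b'\<close> close to \<open>b\<close> is just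
    as close to X.\<close>
  have big: "\<exists>b. alg_over_Q b \<and> D b \<ge> of_nat M" for M :: nat
  proof -
    obtain b where b: "lin b / of_nat p ^ M \<in> V" using unb by blast
    obtain b' where b': "alg_over_Q b'" "v (b - b') \<ge> ereal (of_nat M)" using dense by blast
    have "const_fract (b - b') / of_nat p ^ M \<in> V"
    proof (cases "b = b'")
      case False
      then have "V.has_val (const_fract (b - b') / of_nat p ^ M) (vr (b - b') - of_nat M)"
        by (intro V.has_val_divide has_val_const pn) simp
      then show ?thesis using b'(2) False by (subst V.has_val_in_iff) (auto simp: v_ge_iff)
    qed (simp add: const_fract.hom_0 V.zero_in)
    then have "lin b / of_nat p ^ M + const_fract (b - b') / of_nat p ^ M \<in> V" using b by (intro V.add_in)
    moreover have "lin b' = lin b + const_fract (b - b')" using lin_diff[of b' b] by (simp add: algebra_simps)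
    ultimately have "lin b' / of_nat p ^ M \<in> V" by (simp add: add_divide_distrib)
    then have "D b' \<ge> of_nat M"
      using V.has_val_in_iff[OF V.has_val_divide[OF has_val_lin[OF b'(1)] pn]] by simp
    then show ?thesis using b'(1) by blast
  qed
  then obtain s where s: "\<And>n :: nat. alg_over_Q (s n)" "\<And>n. D (s n) \<ge> of_nat n" by metis
  have diff: "v (s i - s j) \<ge> ereal (min (D (s i)) (D (s j)))" for i j
  proof (cases "s i = s j")
    case False
    have eq: "const_fract (s i - s j) = lin (s j) + (- lin (s i))" using lin_diff[of "s j" "s i"] by simp
    have "vr (s i - s j) \<ge> min (D (s j)) (D (s i))"
      by (rule V.has_val_add_ge[OF has_val_lin[OF s(1)] V.has_val_uminus[OF has_val_lin[OF s(1)]]])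
        (use False has_val_const[of "s i - s j"] eq in auto)
    then show ?thesis using False by (simp add: v_eq_vr min.commute del: ereal_min)
  qed simp
  have "\<exists>l. \<forall>M::real. \<exists>N. \<forall>n\<ge>N. v (s n - l) \<ge> ereal M"
  proof (rule v_complete)
    fix M :: real
    obtain N :: nat where N: "M \<le> N" using real_arch_simple by blast
    have "v (s i - s j) \<ge> ereal M" if "i \<ge> N" "j \<ge> N" for i j
    proof -
      have "M \<le> min (D (s i)) (D (s j))" using s(2)[of i] s(2)[of j] N that by simp
      then have "ereal M \<le> ereal (min (D (s i)) (D (s j)))" by simp
      then show ?thesis using diff order.trans by blast
    qed
    then show "\<exists>N. \<forall>m\<ge>N. \<forall>n\<ge>N. v (s m - s n) \<ge> ereal M" by blast
  qed
  then obtain a where a: "\<And>M::real. \<exists>N. \<forall>n\<ge>N. v (s n - a) \<ge> ereal M" by blast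
  \<comment> \<open>For large \<open>n\<close> the point \<open>s n\<close> is closer to X than
    \<open>b\<close> is, so \<open>s n - b\<close> has value \<open>D b\<close>; the limit lies
    closer still to \<open>s n\<close>.\<close>
  have Db: "v (a - b) = ereal (D b)" if b: "alg_over_Q b" for b
  proof -
    obtain N where N: "\<And>n. n \<ge> N \<Longrightarrow> v (s n - a) \<ge> ereal (D b + 1)" using a by blast
    obtain N' :: nat where N': "D b < N'" using reals_Archimedean2 by blast
    define n where "n = max N N'"
    have n: "v (s n - a) \<ge> ereal (D b + 1)" "D b < D (s n)" using N[of n] N' s(2)[of n] by (auto simp: n_def)
    have eq: "const_fract (s n - b) = lin b + (- lin (s n))" using lin_diff[of b "s n"] by simp
    have "V.has_val (const_fract (s n - b)) (D b)" unfolding eq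
      by (rule V.has_val_add_strict[OF has_val_lin[OF b] V.has_val_uminus[OF has_val_lin[OF s(1)]] n(2)])
    moreover have "s n - b \<noteq> 0" using n by auto
    ultimately have "v (s n - b) = ereal (D b)" using has_val_const V.has_val_unique by (metis v_eq_vr)
    moreover have "ereal (D b) < v (s n - a)" using n(1) by (rule less_le_trans[rotated]) simp
    ultimately show ?thesis using v_diff_eq[of "s n - b" "s n - a"] by simp
  qed
  \<comment> \<open>For algebraic \<open>a\<close> the infinite value of \<open>a - a\<close> would
    equal the real number \<open>D a\<close>.\<close>
  have trans: "\<not> alg_over_Q a" using Db[of a] by auto
  have val: "v (poly (map_poly of_rat f) a) = ereal (m f)" if "f \<noteq> 0" for f
    by (rule determined_by_D[where \<mu> = "\<lambda>F. v (poly F a)", OF _ _ _ that]) (auto simp: v_mult Db simp del: mult_pCons_left)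
  then have m: "vr (poly (map_poly of_rat f) a) = m f" if "f \<noteq> 0" for f using that by (simp add: vr_def)
  have "a \<in> Cp_br v"
  proof (rule bounded_denominator_imp_Cp_br[OF e_pos])
    fix f :: "rat poly" assume "poly (map_poly of_rat f) a \<noteq> 0"
    then have "f \<noteq> 0" by auto
    then show "of_nat e * vr (poly (map_poly of_rat f) a) \<in> \<int>" using discrete by (simp add: m)
  qed
  moreover have "ring_of m = Zpad v a None" unfolding Zpad_None[OF trans] by (rule ring_of_cong) (simp add: m)
  ultimately show ?thesis using trans by blast
qed

end

section \<open>Residually algebraic valuations\<close>

context valuation_ring begin

lemma nonunits_prime: assumes "x ^ n \<in> nonunits" "x \<in> V" shows "x \<in> nonunits"
  using assms unit_power[of x n] by (auto simp: nonunits_def)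

lemma nonunits_diff_trans: "x - y \<in> nonunits \<Longrightarrow> y - z \<in> nonunits \<Longrightarrow> x - z \<in> nonunits"
  using nonunits_add[of "x - y" "y - z"] by simp

lemma nonunits_diff_sym: "x - y \<in> nonunits \<Longrightarrow> y - x \<in> nonunits"
  using nonunits_uminus[of "x - y"] by simp

lemma power_diff_nonunits:
  assumes "x - y \<in> nonunits" "x \<in> V" "y \<in> V" shows "x ^ n - y ^ n \<in> nonunits"
  unfolding power_diff_sumr2 using assms
  by (intro nonunits_mult sum_in mult_in power_in) auto

end

locale mixed_valuation_ring = valuation_ring V "of_nat p" for V :: "'l::field set" and p :: nat +
  assumes prime: "prime p"
begin

lemma binomial_power_diff: assumes "b \<in> V" "t \<in> V" shows "(b + t) ^ p - b ^ p - t ^ p \<in> nonunits"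
proof -
  have p: "p > 1" by (rule prime_gt_1_nat[OF prime])
  let ?f = "\<lambda>k. of_nat (p choose k) * b ^ k * t ^ (p - k)"
  have I: "{..p} = insert 0 (insert p {1..<p})" using p by auto
  have "(b + t) ^ p - b ^ p - t ^ p = (\<Sum>k\<in>{1..<p}. ?f k)"
    unfolding binomial_ring I using p by simp
  also have "\<dots> \<in> nonunits"
  proof (rule nonunits_sum)
    fix k assume "k \<in> {1..<p}"
    then have "p dvd p choose k" using prime by (intro dvd_choose_prime) auto
    then obtain r where "p choose k = p * r" by auto
    then have "?f k = of_nat p * (of_nat r * b ^ k * t ^ (p - k))" by simp
    also have "\<dots> \<in> nonunits" using assms
      by (intro nonunits_mult[OF pi_nonunit] mult_in power_in of_nat_in)
    finally show "?f k \<in> nonunits" .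
  qed
  finally show ?thesis .
qed

text \<open>By \<open>binomial_power_diff\<close> the p-th power map is additive on the residue
  field, and a p-th power vanishes there only for the zero class.\<close>

lemma Frobenius_inj:
  assumes "a ^ (p ^ i) - b ^ (p ^ i) \<in> nonunits" "a \<in> V" "b \<in> V" shows "a - b \<in> nonunits"
  using assms
proof (induction i arbitrary: a b)
  case (Suc i)
  have "(a ^ p) ^ (p ^ i) - (b ^ p) ^ (p ^ i) \<in> nonunits"
    using Suc.prems(1) by (simp only: power_mult[symmetric] power_Suc)
  then have "a ^ p - b ^ p \<in> nonunits"
    by (rule Suc.IH) (use Suc.prems(2,3) in \<open>simp_all add: power_in\<close>)
  moreover have "a ^ p - b ^ p - (a - b) ^ p \<in> nonunits"
    using binomial_power_diff[of b "a - b"] Suc.prems diff_in by simp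
  ultimately have "a ^ p - b ^ p - (a ^ p - b ^ p - (a - b) ^ p) \<in> nonunits" by (rule nonunits_diff)
  then have "(a - b) ^ p \<in> nonunits" by simp
  moreover have "a - b \<in> V" using Suc.prems(2,3) by (rule diff_in)
  ultimately show ?case by (rule nonunits_prime)
qed simp

lemma int_poly_cong:
  assumes "\<And>k. int p dvd coeff P k - coeff Q k" "x \<in> V"
  shows "poly (map_poly of_int P) x - poly (map_poly of_int Q) x \<in> nonunits"
proof -
  interpret ev: comm_ring_homomorphism "\<lambda>P. poly (map_poly of_int P) x"
  proof -
    interpret of_int: comm_ring_homomorphism "of_int :: int \<Rightarrow> 'l" by unfold_locales auto
    show "comm_ring_homomorphism (\<lambda>P. poly (map_poly of_int P) x)"
      by unfold_locales (simp_all add: of_int.map_poly_hom_add of_int.map_poly_hom_mult)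
  qed
  have "[:int p:] dvd P - Q" using assms(1) by (simp add: const_poly_dvd_iff)
  then obtain R where "P - Q = [:int p:] * R" by auto
  then have "poly (map_poly of_int P) x - poly (map_poly of_int Q) x
      = poly (map_poly of_int [:int p:]) x * poly (map_poly of_int R) x"
    using ev.hom_diff[of P Q] ev.hom_mult[of "[:int p:]" R] by simp
  also have "\<dots> = of_nat p * poly (map_poly of_int R) x" by (simp add: map_poly_pCons)
  also have "\<dots> \<in> nonunits" using assms(2)
    by (intro nonunits_mult[OF pi_nonunit] poly_in) (auto simp: coeff_map_poly of_int_in)
  finally show ?thesis .
qed

text \<open>The residue of \<open>x\<close> generates a finite ring over the prime field, so two of
  the powers \<open>x ^ (p ^ i)\<close> have the same class. Injectivity of Frobenius cancels the
  smaller exponent and leaves a period that returns to \<open>x\<close> itself.\<close>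

lemma residue_Frobenius_periodic:
  assumes x: "x \<in> V" and P: "\<exists>i. \<not> int p dvd coeff P i" "poly (map_poly of_int P) x \<in> nonunits"
  shows "\<exists>k>0. x ^ (p ^ k) - x \<in> nonunits"
proof -
  let ?ev = "\<lambda>P. poly (map_poly of_int P) x"
  interpret of_int: comm_ring_homomorphism "of_int :: int \<Rightarrow> 'l" by unfold_locales auto
  interpret ev: comm_ring_homomorphism ?ev
    by unfold_locales (simp_all add: of_int.map_poly_hom_add of_int.map_poly_hom_mult)
  have ev_in: "?ev Q \<in> V" for Q using x by (intro poly_in) (auto simp: coeff_map_poly of_int_in)
  define S where "S = {i. \<not> int p dvd coeff P i}"
  have S: "finite S" "S \<noteq> {}"
    using P(1) by (auto simp: S_def intro!: finite_subset[of _ "{..degree P}"] le_degree)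
  define d where "d = Max S"
  have d: "\<not> int p dvd coeff P d" using Max_in[OF S] by (simp add: S_def d_def)
  have above: "int p dvd coeff P k" if "k > d" for k using Max_ge[OF S(1), of k] that by (auto simp: S_def d_def)
  have "prime (int p)" using prime by simp
  then have "coprime (coeff P d) (int p)" using d by (simp add: prime_imp_coprime coprime_commute)
  then obtain u w where "u * coeff P d + w * int p = 1" using bezout_int[of "coeff P d" "int p"] by auto
  then have u: "u * coeff P d - 1 = int p * (- w)" by (simp add: algebra_simps)
  \<comment> \<open>The monic integer polynomial congruent to \<open>u * P\<close> modulo
    \<open>p\<close>: \<open>d\<close> is the last index with coefficient prime to \<open>p\<close>,
    and \<open>u\<close> inverts that coefficient. Being monic permits division with remainder over
    the integers.\<close>
  define Q where "Q = (\<Sum>k<d. monom (u * coeff P k) k) + monom 1 d"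
  have cQ: "coeff Q k = (if k < d then u * coeff P k else if k = d then 1 else 0)" for k
    by (simp add: Q_def coeff_sum)
  have "degree Q = d" by (intro antisym degree_le le_degree) (auto simp: cQ)
  then have lead: "lead_coeff Q = 1" by (simp add: cQ)
  then have "Q \<noteq> 0" by auto
  have "int p dvd coeff Q k - coeff (smult u P) k" for k
    using above[of k] u by (auto simp: cQ dvd_diff_commute[of _ 1] not_less_iff_gr_or_eq)
  then have "?ev Q - ?ev (smult u P) \<in> nonunits" using x by (rule int_poly_cong)
  moreover have "?ev (smult u P) \<in> nonunits"
    using nonunits_mult[OF P(2) of_int_in[of u]] ev.hom_mult[of "[:u:]" P]
    by (simp add: map_poly_pCons mult.commute)
  ultimately have Qx: "?ev Q \<in> nonunits" using nonunits_add by fastforce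
  have "\<exists>R. (\<forall>k\<ge>d. coeff R k = 0) \<and> x ^ n - ?ev R \<in> nonunits" for n
  proof -
    obtain q R where qR: "pseudo_divmod (monom 1 n) Q = (q, R)" by (cases "pseudo_divmod (monom 1 n) Q")
    have 1: "monom 1 n = Q * q + R" "R = 0 \<or> degree R < d"
      using pseudo_divmod[OF \<open>Q \<noteq> 0\<close> qR] lead \<open>degree Q = d\<close> by auto
    have "x ^ n = ?ev (monom 1 n)" by (simp add: map_poly_monom poly_monom)
    also have "\<dots> = ?ev Q * ?ev q + ?ev R" unfolding 1(1) by (simp only: ev.hom_add ev.hom_mult)
    finally have "x ^ n - ?ev R = ?ev Q * ?ev q" by simp
    then have "x ^ n - ?ev R \<in> nonunits" using nonunits_mult[OF Qx ev_in] by simp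
    then show ?thesis using 1(2) by (intro exI[of _ R]) (auto simp: coeff_eq_0)
  qed
  then obtain R where R: "\<And>n k. k \<ge> d \<Longrightarrow> coeff (R n) k = 0" "\<And>n. x ^ n - ?ev (R n) \<in> nonunits" by metis
  \<comment> \<open>Remainders modulo \<open>Q\<close> and \<open>p\<close> are recorded as lists of
    length \<open>d\<close> with entries below \<open>p\<close>, of which there are finitely
    many.\<close>
  define rep where "rep n = map (\<lambda>k. coeff (R n) k mod int p) [0..<d]" for n
  have "range rep \<subseteq> {xs. set xs \<subseteq> {0..<int p} \<and> length xs = d}"
    using prime_gt_0_nat[OF prime] by (auto simp: rep_def)
  then have "finite (range rep)" using finite_lists_length_eq[of "{0..<int p}" d] finite_subset by blast
  then have "finite (range (\<lambda>i :: nat. rep (p ^ i)))" by (rule finite_subset[rotated]) auto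
  then have "\<not> inj (\<lambda>i :: nat. rep (p ^ i))" using finite_imageD infinite_UNIV_nat by blast
  then obtain i j where ij: "i < j" "rep (p ^ i) = rep (p ^ j)"
    unfolding inj_def by (metis linorder_neqE_nat)
  have "int p dvd coeff (R (p ^ i)) k - coeff (R (p ^ j)) k" for k
  proof (cases "k < d")
    case True
    then have "coeff (R (p ^ i)) k mod int p = coeff (R (p ^ j)) k mod int p"
      using arg_cong[OF ij(2), of "\<lambda>xs. xs ! k"] by (simp add: rep_def)
    then show ?thesis by (simp add: mod_eq_dvd_iff)
  qed (simp add: R(1))
  then have "?ev (R (p ^ i)) - ?ev (R (p ^ j)) \<in> nonunits" using x by (rule int_poly_cong)
  then have "x ^ p ^ i - x ^ p ^ j \<in> nonunits"
    using R(2)[of "p ^ i"] nonunits_diff_sym[OF R(2)[of "p ^ j"]] nonunits_diff_trans by blast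
  moreover have "x ^ p ^ j = (x ^ p ^ (j - i)) ^ p ^ i"
    using ij(1) by (simp flip: power_mult power_add)
  ultimately have "x - x ^ p ^ (j - i) \<in> nonunits" using x by (intro Frobenius_inj[of x i]) (auto intro: power_in)
  then show ?thesis using ij(1) nonunits_diff_sym by (intro exI[of _ "j - i"]) auto
qed

end

locale mixed_DVR = mixed_valuation_ring V p for V :: "'l::field set" and p :: nat +
  fixes \<omega> :: 'l
  assumes \<omega>_nz: "\<omega> \<noteq> 0" and uniformizer: "z \<in> nonunits \<Longrightarrow> z / \<omega> \<in> V" and \<omega>_nonunit: "\<omega> \<in> nonunits"
begin

text \<open>The quotient \<open>S\<close> of \<open>a ^ p - b ^ p\<close> by \<open>a - b\<close> is
  congruent to \<open>p * b ^ (p - 1)\<close>, hence a nonunit, and contributes one more factor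
  \<open>\<omega>\<close>.\<close>

lemma Frobenius_lift:
  assumes "(a - b) / \<omega> ^ Suc s \<in> V" "a \<in> V" "b \<in> V"
  shows "(a ^ p - b ^ p) / \<omega> ^ Suc (Suc s) \<in> V"
proof -
  define S where "S = (\<Sum>i<p. b ^ (p - Suc i) * a ^ i)"
  have "a - b = (a - b) / \<omega> ^ Suc s * \<omega> ^ Suc s" using \<omega>_nz by simp
  also have "\<dots> = \<omega> * ((a - b) / \<omega> ^ Suc s * \<omega> ^ s)" by simp
  also have "\<dots> \<in> nonunits" using assms(1) \<omega>_nonunit
    by (intro nonunits_mult mult_in power_in) (auto intro: nonunits_in)
  finally have ab: "a - b \<in> nonunits" .
  have "S - of_nat p * b ^ (p - 1) = (\<Sum>i<p. b ^ (p - Suc i) * a ^ i - b ^ (p - Suc i) * b ^ i)"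
    unfolding S_def sum_subtractf by (simp flip: power_add)
  also have "\<dots> = (\<Sum>i<p. (a ^ i - b ^ i) * b ^ (p - Suc i))" by (simp add: algebra_simps)
  also have "\<dots> \<in> nonunits"
    using ab assms by (intro nonunits_sum nonunits_mult power_diff_nonunits power_in) auto
  finally have "S - of_nat p * b ^ (p - 1) + of_nat p * b ^ (p - 1) \<in> nonunits"
    using assms by (intro nonunits_add nonunits_mult[OF pi_nonunit] power_in) auto
  then have "S / \<omega> \<in> V" using uniformizer by simp
  then have "(a - b) / \<omega> ^ Suc s * (S / \<omega>) \<in> V" using assms by (intro mult_in)
  moreover have "a ^ p - b ^ p = (a - b) * S" unfolding S_def by (rule power_diff_sumr2)
  ultimately show ?thesis by (simp add: mult_ac)
qed

lemma Frobenius_lift_iter: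
  assumes "(a - b) / \<omega> \<in> V" "a \<in> V" "b \<in> V"
  shows "(a ^ (p ^ k) - b ^ (p ^ k)) / \<omega> ^ Suc k \<in> V"
proof (induction k)
  case (Suc k)
  have "((a ^ (p ^ k)) ^ p - (b ^ (p ^ k)) ^ p) / \<omega> ^ Suc (Suc k) \<in> V"
    using Suc assms by (intro Frobenius_lift power_in) auto
  then show ?case by (simp add: mult.commute flip: power_mult)
qed (use assms in simp)

text \<open>Repeated p-th powers keep returning to the class of \<open>x\<close> while
  \<open>y ^ q - y\<close> becomes ever more divisible. The ring is not complete, so there are only
  approximations. The exponent \<open>q\<close> is fixed before \<open>s\<close> because the
  precision requested later depends on \<open>q\<close>.\<close>

lemma Teichmueller_approx:
  assumes x: "x \<in> V" and P: "\<exists>i. \<not> int p dvd coeff P i" "poly (map_poly of_int P) x \<in> nonunits"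
  shows "\<exists>q>1. \<forall>s. \<exists>y\<in>V. y - x \<in> nonunits \<and> (y ^ q - y) / \<omega> ^ s \<in> V"
proof -
  obtain k where k: "k > 0" "x ^ (p ^ k) - x \<in> nonunits" using residue_Frobenius_periodic[OF assms] by blast
  have \<omega>V: "\<omega> \<in> V" using \<omega>_nonunit by (rule nonunits_in)
  show ?thesis
  proof (intro exI[of _ "p ^ k"] conjI allI)
    show "1 < p ^ k" using prime_gt_1_nat[OF prime] k(1) by (rule one_less_power)
    fix s
    \<comment> \<open>Each of the \<open>k * s\<close> Frobenius steps gains one factor
      \<open>\<omega>\<close> over the initial congruence of \<open>x ^ q\<close> and
      \<open>x\<close>, with \<open>q = p ^ k\<close>. This gives \<open>Suc (k * s)\<close>
      factors, at least \<open>s\<close> as \<open>k > 0\<close>.\<close>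
    define y where "y = x ^ (p ^ (k * s))"
    have "y \<in> V" using x by (simp add: y_def power_in)
    moreover have "x ^ (p ^ (k * r)) - x \<in> nonunits" for r
    proof (induction r)
      case (Suc r)
      have "(x ^ p ^ (k * r)) ^ p ^ k - x ^ p ^ k \<in> nonunits"
        using Suc x by (intro power_diff_nonunits power_in)
      then have "x ^ p ^ (k * Suc r) - x ^ p ^ k \<in> nonunits"
        by (simp add: mult.commute flip: power_mult power_add)
      then show ?case using k(2) nonunits_diff_trans by blast
    qed (use nonunits_0 in simp)
    then have "y - x \<in> nonunits" by (simp add: y_def)
    moreover have "(y ^ (p ^ k) - y) / \<omega> ^ s \<in> V"
    proof -
      have "((x ^ p ^ k) ^ p ^ (k * s) - x ^ p ^ (k * s)) / \<omega> ^ Suc (k * s) \<in> V"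
        using uniformizer[OF k(2)] x by (intro Frobenius_lift_iter power_in)
      moreover have "(x ^ p ^ k) ^ p ^ (k * s) = y ^ (p ^ k)"
        by (simp add: y_def mult.commute flip: power_mult)
      ultimately have "(y ^ (p ^ k) - y) / \<omega> ^ Suc (k * s) \<in> V" by (simp add: y_def)
      then have "(y ^ (p ^ k) - y) / \<omega> ^ Suc (k * s) * \<omega> ^ (Suc (k * s) - s) \<in> V"
        using \<omega>V by (intro mult_in power_in)
      moreover have "s + (Suc (k * s) - s) = Suc (k * s)" using k(1) by (cases k) auto
      then have "\<omega> ^ Suc (k * s) = \<omega> ^ s * \<omega> ^ (Suc (k * s) - s)" by (simp only: power_add[symmetric])
      ultimately show ?thesis using \<omega>_nz by simp
    qed
    ultimately show "\<exists>y\<in>V. y - x \<in> nonunits \<and> (y ^ (p ^ k) - y) / \<omega> ^ s \<in> V" by blast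
  qed
qed

end

section \<open>Approximation by constants modulo powers of p\<close>

context common_extension begin

lemma ring_of_valuation_ring: "valuation_ring (ring_of m) (of_nat p :: QX)"
proof
  fix x y :: QX
  show "1 \<in> ring_of m" by (rule ring_of_1)
  show "x - y \<in> ring_of m" if "x \<in> ring_of m" "y \<in> ring_of m"
    using that V.diff_in[of "base_change x" "base_change y"]
    by (simp add: base_change.hom_diff flip: base_change_in_V_iff)
  show "x * y \<in> ring_of m" if "x \<in> ring_of m" "y \<in> ring_of m" using that by (rule ring_of_mult)
  show "x \<in> ring_of m \<or> inverse x \<in> ring_of m" by (cases "x = 0") (auto simp: ring_of_iff fval_inverse)
  show "of_nat p \<in> ring_of m" "inverse (of_nat p) \<notin> ring_of m"
    using p_QX_nz by (auto simp: ring_of_iff fval_p fval_inverse)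
qed (rule p_QX_nz)

sublocale W: valuation_ring "ring_of m" "of_nat p :: QX" by (rule ring_of_valuation_ring)

lemma W_nonunits: "W.nonunits = max_ideal (ring_of m)"
  by (auto simp: W.nonunits_def W.unit_def max_ideal_def)

text \<open>If no difference \<open>y - \<rho>\<close> were divisible by \<open>\<theta>\<close>,
  each would divide \<open>\<theta>\<close> properly, and their product \<open>F(y)\<close> could
  not be divisible by \<open>\<theta> ^ degree F\<close>. Roots that are not close are split off one
  at a time.\<close>

lemma monic_root_close:
  assumes "lead_coeff F = 1" "degree F > 0" "poly (map_poly const_fract F) y / \<theta> ^ degree F \<in> V" "\<theta> \<noteq> 0"
  shows "\<exists>\<rho>. poly F \<rho> = 0 \<and> (y - const_fract \<rho>) / \<theta> \<in> V"
  using assms(1-3)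
proof (induction "degree F" arbitrary: F)
  case (Suc n)
  obtain b where b: "poly F b = 0" using alg_closed Suc.prems by blast
  then obtain G where G: "F = [:- b, 1:] * G" by (metis poly_eq_0_iff_dvd dvdE)
  then have "G \<noteq> 0" using Suc by auto
  then have deg: "degree F = Suc (degree G)" by (subst G, subst degree_mult_eq) auto
  have lead: "lead_coeff G = 1" using Suc.prems(1) unfolding G lead_coeff_mult by simp
  let ?e = "map_poly const_fract :: _ \<Rightarrow> 'k poly fract poly"
  have ev: "poly (?e F) y = (y - const_fract b) * poly (?e G) y"
    unfolding G const_fract.map_poly_hom_mult poly_mult
    by (simp add: map_poly_pCons const_fract.hom_0 const_fract.hom_1 const_fract.hom_uminus)
  show ?case
  proof (cases "(y - const_fract b) / \<theta> \<in> V")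
    case True
    then show ?thesis using b by blast
  next
    case False
    then have inv: "\<theta> / (y - const_fract b) \<in> V" and nz: "y - const_fract b \<noteq> 0"
      using V.total[of "(y - const_fract b) / \<theta>"] V.zero_in by auto
    have "poly (?e G) y / \<theta> ^ degree G = (\<theta> / (y - const_fract b)) * (poly (?e F) y / \<theta> ^ degree F)"
      using nz \<open>\<theta> \<noteq> 0\<close> unfolding deg ev by simp
    then have *: "poly (?e G) y / \<theta> ^ degree G \<in> V" using V.mult_in[OF inv Suc.prems(3)] by simp
    have "degree G > 0"
    proof (rule ccontr)
      assume "\<not> degree G > 0"
      then obtain c where c: "G = [:c:]" by (metis degree_eq_zeroE gr0I)
      then have "G = 1" using lead by (simp add: one_pCons)
      then have "(y - const_fract b) / \<theta> \<in> V" using Suc.prems(3) unfolding deg ev by (simp add: const_fract.hom_1)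
      then show False using False by simp
    qed
    then obtain \<rho> where "poly G \<rho> = 0" "(y - const_fract \<rho>) / \<theta> \<in> V"
      using Suc.hyps(1)[of G] Suc.hyps(2) deg * lead by auto
    then show ?thesis unfolding G by auto
  qed
qed simp

lemma of_nat_p_V_nz: "(of_nat p :: 'k poly fract) \<noteq> 0" by (rule V.pi_nz)

definition close :: "nat \<Rightarrow> 'k poly fract \<Rightarrow> 'k poly fract \<Rightarrow> bool" where
  "close M x y \<longleftrightarrow> (x - y) / of_nat p ^ M \<in> V"

lemma close_refl: "close M x x" by (simp add: close_def V.zero_in)
lemma close_trans: "close M x y \<Longrightarrow> close M y z \<Longrightarrow> close M x z"
  using V.add_in[of "(x - y) / of_nat p ^ M" "(y - z) / of_nat p ^ M"]
  by (simp add: close_def flip: add_divide_distrib)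
lemma close_add: "close M x y \<Longrightarrow> close M x' y' \<Longrightarrow> close M (x + x') (y + y')"
  using V.add_in[of "(x - y) / of_nat p ^ M" "(x' - y') / of_nat p ^ M"]
  by (simp add: close_def add_diff_add flip: add_divide_distrib)
lemma close_mult: "close M x y \<Longrightarrow> c \<in> V \<Longrightarrow> close M (c * x) (c * y)"
  using V.mult_in[of c "(x - y) / of_nat p ^ M"]
  by (simp add: close_def right_diff_distrib)
lemma close_in: assumes "close M x y" shows "x \<in> V \<longleftrightarrow> y \<in> V"
proof -
  have "x - y = (x - y) / of_nat p ^ M * of_nat p ^ M" using of_nat_p_V_nz by simp
  moreover have "\<dots> \<in> V" using assms unfolding close_def by (intro V.mult_in V.power_in V.pi_in)
  ultimately have d: "x - y \<in> V" by simp
  show ?thesis using V.add_in[OF d, of y] V.diff_in[OF _ d, of x] by auto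
qed

lemma res_algebraic_approx:
  assumes alg: "res_algebraic p (ring_of m)" and \<pi>: "\<pi> \<noteq> 0" "of_nat e * fval \<pi> = 1"
  shows "\<exists>b. lin b / of_nat p ^ M \<in> V"
proof -
  have fval_\<pi>: "fval \<pi> = 1 / e" using \<pi>(2) e_pos by (simp add: field_simps)
  interpret W: mixed_DVR "ring_of m" p \<pi>
  proof
    show "prime p" by (rule prime_p)
    show "\<pi> \<noteq> 0" by fact
    show "\<pi> \<in> W.nonunits" using fval_\<pi> e_pos by (simp add: W_nonunits max_ideal_iff)
    fix z assume z: "z \<in> W.nonunits"
    show "z / \<pi> \<in> ring_of m"
    proof (cases "z = 0")
      case False
      then have "fval z > 0" using z by (simp add: W_nonunits max_ideal_iff)
      moreover obtain n where n: "of_nat e * fval z = of_int n" using discrete_fval[OF False] by (auto elim: Ints_cases)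
      ultimately have "real_of_int n > 0" using e_pos by (metis mult_pos_pos of_nat_0_less_iff)
      then have "of_nat e * fval z \<ge> 1" unfolding n by simp
      then have "of_nat e * fval \<pi> \<le> of_nat e * fval z" using \<pi>(2) by simp
      then have "fval z \<ge> fval \<pi>" using e_pos by simp
      then show ?thesis using False \<pi>(1) by (simp add: ring_of_iff divide_inverse fval_mult fval_inverse)
    qed (simp add: W.zero_in)
  qed
  let ?P = "base_change \<pi>"
  have PV: "?P \<in> V" using base_change_in_V W.nonunits_in[OF W.\<omega>_nonunit] .
  let ?e = "map_poly const_fract :: _ \<Rightarrow> 'k poly fract poly"
  \<comment> \<open>Each class gets a representative close to a root \<open>\<zeta>\<close> of
    \<open>X ^ q - X\<close>. To come within \<open>p ^ N\<close> of a root of this polynomial of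
    degree \<open>q\<close>, its value at \<open>y\<close> must be divisible by
    \<open>p ^ (N * q)\<close>; the power \<open>e * (N * q)\<close> of \<open>\<pi>\<close>
    achieves that, since \<open>\<pi> ^ e\<close> is \<open>p\<close> times a unit.\<close>
  have Teich: "\<exists>y\<in>ring_of m. \<exists>\<zeta>. v \<zeta> \<ge> 0 \<and> x - y \<in> W.nonunits \<and> close N (base_change y) (const_fract \<zeta>)"
    if x: "x \<in> ring_of m" for x N
  proof -
    obtain P where P: "\<exists>i. \<not> int p dvd coeff P i"
      "poly (map_poly (\<lambda>a. constQX (of_int a)) P) x \<in> max_ideal (ring_of m)"
      using alg x unfolding res_algebraic_def by blast
    have "poly (map_poly of_int P) x \<in> W.nonunits" using P(2) by (simp add: W_nonunits constQX.hom_of_int)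
    then obtain q where q: "q > 1" "\<And>s. \<exists>y\<in>ring_of m. y - x \<in> W.nonunits \<and> (y ^ q - y) / \<pi> ^ s \<in> ring_of m"
      using W.Teichmueller_approx[OF x P(1)] by blast
    obtain y where y: "y \<in> ring_of m" "y - x \<in> W.nonunits" "(y ^ q - y) / \<pi> ^ (e * (N * q)) \<in> ring_of m"
      using q(2) by blast
    have "fval (\<pi> ^ (e * (N * q)) / of_nat p ^ (N * q)) = 0"
      using \<pi> p_QX_nz e_pos by (simp add: divide_inverse fval_mult fval_inverse fval_power fval_p fval_\<pi>)
    then have "\<pi> ^ (e * (N * q)) / of_nat p ^ (N * q) \<in> ring_of m" by (simp add: ring_of_iff)
    then have "(y ^ q - y) / \<pi> ^ (e * (N * q)) * (\<pi> ^ (e * (N * q)) / of_nat p ^ (N * q)) \<in> ring_of m"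
      using y(3) by (intro W.mult_in)
    then have yq: "(y ^ q - y) / of_nat p ^ (N * q) \<in> ring_of m" using \<pi>(1) by simp
    define F :: "'k poly" where "F = monom 1 q - monom 1 1"
    have cF: "coeff F k = (if k = q then 1 else if k = 1 then - 1 else 0)" for k
      using q(1) by (auto simp: F_def)
    have "degree F = q" by (intro antisym degree_le le_degree) (use q(1) in \<open>auto simp: cF\<close>)
    moreover have "poly (?e F) (base_change y) = base_change (y ^ q - y)"
      by (simp add: F_def const_fract.map_poly_homomorphism[THEN comm_ring_homomorphism.hom_diff] map_poly_monom
        const_fract.hom_0 const_fract.hom_1 poly_monom base_change.hom_diff base_change.hom_power)
    moreover have "base_change (y ^ q - y) / (of_nat p ^ N) ^ q
        = (base_change ((y ^ q - y) / of_nat p ^ (N * q)) :: 'k poly fract)"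
      by (simp add: divide_inverse base_change.hom_mult base_change_inverse base_change.hom_power
        base_change.hom_of_nat power_mult)
    ultimately obtain \<zeta> where \<zeta>: "(base_change y - const_fract \<zeta>) / of_nat p ^ N \<in> V"
      using monic_root_close[of F "base_change y" "of_nat p ^ N"] q(1) base_change_in_V[OF yq] of_nat_p_V_nz
      by (auto simp: cF)
    then have cl: "close N (base_change y) (const_fract \<zeta>)" by (simp add: close_def)
    then have "v \<zeta> \<ge> 0" using close_in base_change_in_V[OF y(1)] const_in_V_iff by blast
    then show ?thesis using cl y(1) W.nonunits_diff_sym[OF y(2)] by blast
  qed
  define good where "good n F \<longleftrightarrow> (\<forall>i. v (coeff F i) \<ge> 0) \<and> (\<forall>i\<ge>n. coeff F i = 0)" for n :: nat and F :: "'k poly"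
  \<comment> \<open>Expansion in \<open>\<pi>\<close> with \<open>n\<close> digits: subtract the
    representative of \<open>x\<close>, divide by \<open>\<pi>\<close>, and repeat. The digits are
    constants up to precision \<open>N\<close>.\<close>
  have expand: "\<exists>F x'. good n F \<and> x' \<in> ring_of m \<and> close N (base_change x) (poly (?e F) ?P + ?P ^ n * base_change x')"
    if "x \<in> ring_of m" for x n N
    using that
  proof (induction n arbitrary: x)
    case 0
    then show ?case by (intro exI[of _ 0] exI[of _ x]) (simp add: good_def close_refl)
  next
    case (Suc n)
    obtain y \<zeta> where y: "y \<in> ring_of m" "v \<zeta> \<ge> 0" "x - y \<in> W.nonunits" "close N (base_change y) (const_fract \<zeta>)"
      using Teich[OF Suc.prems] by blast
    define x1 where "x1 = (x - y) / \<pi>"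
    have "x1 \<in> ring_of m" unfolding x1_def using y(3) by (rule W.uniformizer)
    then obtain F x' where F: "good n F" "x' \<in> ring_of m"
      "close N (base_change x1) (poly (?e F) ?P + ?P ^ n * base_change x')" using Suc.IH by blast
    have "base_change x = (base_change y + ?P * base_change x1 :: 'k poly fract)"
      using \<pi>(1) by (simp add: x1_def flip: base_change.hom_mult base_change.hom_add)
    moreover have "poly (?e (pCons \<zeta> F)) ?P + ?P ^ Suc n * base_change x'
        = const_fract \<zeta> + ?P * (poly (?e F) ?P + ?P ^ n * base_change x')"
      by (simp add: map_poly_pCons const_fract.hom_0 algebra_simps)
    ultimately have "close N (base_change x) (poly (?e (pCons \<zeta> F)) ?P + ?P ^ Suc n * base_change x')"
      using close_add[OF y(4) close_mult[OF F(3) PV]] by simp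
    moreover have "good (Suc n) (pCons \<zeta> F)" using F(1) y(2) by (auto simp: good_def coeff_pCons split: nat.splits)
    ultimately show ?case using F(2) by blast
  qed
  define w where "w = \<pi> ^ e / of_nat p"
  have w: "w \<in> ring_of m"
    using \<pi> p_QX_nz by (simp add: w_def ring_of_iff divide_inverse fval_mult fval_inverse fval_power fval_p)
  have P_e: "?P ^ e = of_nat p * base_change w"
  proof -
    have "\<pi> ^ e = of_nat p * w" using p_QX_nz by (simp add: w_def)
    then show ?thesis by (simp flip: base_change.hom_power add: base_change.hom_mult base_change.hom_of_nat)
  qed
  \<comment> \<open>After \<open>e\<close> digits the remainder carries
    \<open>\<pi> ^ e = p * w\<close>. Absorbing \<open>w\<close> into the next element to expand
    keeps the degree in \<open>\<pi>\<close> below \<open>e\<close> while the power of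
    \<open>p\<close> grows.\<close>
  have expand_p: "\<exists>F x'. good e F \<and> x' \<in> ring_of m \<and>
      close N (base_change x) (poly (?e F) ?P + of_nat p ^ j * base_change x')"
    if "x \<in> ring_of m" for x j N
  proof (induction j)
    case 0
    show ?case using that by (intro exI[of _ 0] exI[of _ x]) (simp add: good_def close_refl)
  next
    case (Suc j)
    then obtain F x' where F: "good e F" "x' \<in> ring_of m"
      "close N (base_change x) (poly (?e F) ?P + of_nat p ^ j * base_change x')" by blast
    obtain F' x'' where F': "good e F'" "x'' \<in> ring_of m"
      "close N (base_change x') (poly (?e F') ?P + ?P ^ e * base_change x'')" using expand[OF F(2)] by blast
    define H where "H = F + smult (of_nat p ^ j) F'"
    have "?e (smult (of_nat p ^ j) F') = smult (of_nat p ^ j) (?e F')"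
      by (subst map_poly_smult) (simp_all add: const_fract.hom_0 const_fract.hom_mult const_fract.hom_power const_fract.hom_of_nat)
    then have eq: "poly (?e H) ?P + of_nat p ^ Suc j * base_change (w * x'')
       = poly (?e F) ?P + of_nat p ^ j * (poly (?e F') ?P + ?P ^ e * base_change x'')"
      unfolding P_e by (simp add: H_def const_fract.map_poly_hom_add base_change.hom_mult algebra_simps)
    have "close N (poly (?e F) ?P + of_nat p ^ j * base_change x')
        (poly (?e F) ?P + of_nat p ^ j * (poly (?e F') ?P + ?P ^ e * base_change x''))"
      by (intro close_add close_mult F'(3) close_refl V.power_in V.pi_in)
    then have "close N (base_change x) (poly (?e H) ?P + of_nat p ^ Suc j * base_change (w * x''))"
      unfolding eq using F(3) close_trans by blast
    moreover have "good e H" unfolding good_def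
    proof (intro conjI allI impI)
      fix i
      have "0 \<le> v (of_nat p ^ j * coeff F' i)" 
        using F'(1) O.mult_in[OF O.power_in[OF O.pi_in], of "coeff F' i" j] by (simp add: good_def mem_Op)
      then show "0 \<le> v (coeff H i)" using F(1) O.add_in[of "coeff F i" "of_nat p ^ j * coeff F' i"]
        by (simp add: H_def good_def mem_Op)
    qed (use F(1) F'(1) in \<open>simp add: H_def good_def\<close>)
    ultimately show ?case using F'(2) w W.mult_in by blast
  qed
  have approx: "\<exists>F. good e F \<and> close N (base_change x) (poly (?e F) ?P)" if xW: "x \<in> ring_of m" for x N
  proof -
    obtain F x' where F: "good e F" "x' \<in> ring_of m"
      "close N (base_change x) (poly (?e F) ?P + of_nat p ^ N * base_change x')" using expand_p[OF xW] by blast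
    have "close N (poly (?e F) ?P + of_nat p ^ N * base_change x') (poly (?e F) ?P)"
      using base_change_in_V[OF F(2)] of_nat_p_V_nz by (simp add: close_def)
    then show ?thesis using F close_trans by blast
  qed
  obtain k :: nat where k: "- fval varX \<le> k" using real_arch_simple by blast
  define x where "x = of_nat p ^ k * varX"
  have X_nz: "varX \<noteq> 0" by (simp add: varX_def Fract_eq_0_iff)
  have x: "x \<in> ring_of m" using k p_QX_nz X_nz by (simp add: x_def ring_of_iff fval_mult fval_power fval_p)
  \<comment> \<open>Integrality of \<open>p ^ k * X\<close> allows it to be expanded; dividing by
    \<open>p ^ k\<close> afterwards costs \<open>k\<close> digits.\<close>
  define N where "N = M + k"
  have "\<pi> ^ e \<in> ring_of m" by (intro W.power_in W.nonunits_in W.\<omega>_nonunit)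
  then obtain F where F: "good e F" "close (N * e) (base_change (\<pi> ^ e)) (poly (?e F) ?P)" using approx by blast
  \<comment> \<open>Because \<open>F\<close> has degree below \<open>e\<close>, this polynomial is
    monic of degree \<open>e\<close>, and its value at \<open>\<pi>\<close> is divisible by
    \<open>(p ^ N) ^ e\<close>. So one of its roots, a constant, lies within \<open>p ^ N\<close> of
    \<open>\<pi>\<close>.\<close>
  define Q where "Q = monom 1 e - F"
  have cQ: "coeff Q i = (if i < e then - coeff F i else if i = e then 1 else 0)" for i
    using F(1) by (auto simp: Q_def good_def)
  have degQ: "degree Q = e" by (intro antisym degree_le le_degree) (auto simp: cQ)
  have "poly (?e Q) ?P = base_change (\<pi> ^ e) - poly (?e F) ?P"
    by (simp add: Q_def const_fract.map_poly_homomorphism[THEN comm_ring_homomorphism.hom_diff] map_poly_monom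
        const_fract.hom_0 const_fract.hom_1 poly_monom base_change.hom_power)
  then have "poly (?e Q) ?P / (of_nat p ^ N) ^ degree Q \<in> V"
    using F(2) unfolding degQ by (simp add: close_def power_mult)
  then obtain \<rho> where "(?P - const_fract \<rho>) / of_nat p ^ N \<in> V"
    using monic_root_close[of Q ?P "of_nat p ^ N"] degQ e_pos of_nat_p_V_nz by (auto simp: cQ)
  then have \<rho>: "close N ?P (const_fract \<rho>)" by (simp add: close_def)
  then have \<rho>V: "const_fract \<rho> \<in> V" using close_in PV by blast
  \<comment> \<open>Now \<open>p ^ k * X\<close> is close to \<open>H(\<pi>)\<close>, and
    integrality of \<open>H\<close> lets \<open>\<pi>\<close> be replaced by the constant
    \<open>\<rho>\<close> without loss of precision.\<close>
  obtain H where H: "good e H" "close N (base_change x) (poly (?e H) ?P)" using approx[OF x] by blast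
  have HV: "coeff (?e H) i \<in> V" for i using H(1) by (simp add: coeff_map_poly good_def const_in_V)
  obtain c where c: "c \<in> V" "poly (?e H) ?P - poly (?e H) (const_fract \<rho>) = (?P - const_fract \<rho>) * c"
    using V.poly_diff_dvd[OF HV PV \<rho>V] by blast
  have "close N (poly (?e H) ?P) (poly (?e H) (const_fract \<rho>))"
    using V.mult_in[OF \<rho>[unfolded close_def] c(1)] by (simp add: close_def c(2))
  then have "close N (base_change x) (poly (?e H) (const_fract \<rho>))" using H(2) close_trans by blast
  then have "close N (base_change x) (const_fract (poly H \<rho>))" by (simp add: const_fract.poly_map_poly_hom)
  then have "(of_nat p ^ k * base_change varX - const_fract (poly H \<rho>)) / of_nat p ^ N \<in> V"
    by (simp add: close_def x_def base_change.hom_mult base_change.hom_power base_change.hom_of_nat)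
  moreover have "lin (poly H \<rho> / of_nat p ^ k) / of_nat p ^ M
      = (of_nat p ^ k * base_change varX - const_fract (poly H \<rho>)) / of_nat p ^ N"
  proof -
    have "const_fract (poly H \<rho> / of_nat p ^ k) = const_fract (poly H \<rho>) / (of_nat p ^ k :: 'k poly fract)"
      by (simp add: divide_inverse const_fract.hom_mult const_fract_inverse const_fract.hom_power
          const_fract.hom_of_nat)
    then have "lin (poly H \<rho> / of_nat p ^ k)
        = (of_nat p ^ k * base_change varX - const_fract (poly H \<rho>)) / of_nat p ^ k"
      using of_nat_p_V_nz by (simp add: lin_conv diff_divide_distrib)
    then show ?thesis by (simp add: N_def power_add mult.commute)
  qed
  ultimately show ?thesis by metis
qed

end

section \<open>The classification\<close>

context padic_complex begin

lemma algebraic_in_Cp_br: "alg_over_Q a \<Longrightarrow> a \<in> Cp_br v"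
  using algebraic_values_discrete bounded_denominator_imp_Cp_br by metis

lemma algebraic_in_Qp_bar: assumes "alg_over_Q a" shows "a \<in> Qp_bar v"
proof -
  obtain f :: "rat poly" where "f \<noteq> 0" "poly (map_poly of_rat f) a = 0"
    using assms by (auto simp: alg_over_Q_def)
  then show ?thesis unfolding Qp_bar_def
    by (intro CollectI exI[of _ "map_poly of_rat f"]) (auto simp: coeff_map_poly of_rat_in_Qp)
qed

lemma DVR_classification:
  assumes "is_DVR_QX W" "{c. constQX c \<in> W} = Zloc p"
  shows "(\<exists>a\<in>Cp_br v. \<not> alg_over_Q a \<and> W = Zpad v a None) \<or> (\<exists>a \<delta>. alg_over_Q a \<and> W = Zpad v a (Some \<delta>))"
proof -
  obtain m e \<pi> where m: "poly_valuation p m" "W = ring_of m" "e > 0" "\<forall>f. f \<noteq> 0 \<longrightarrow> of_nat e * m f \<in> \<int>"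
    "\<pi> \<noteq> 0" "of_nat e * poly_valuation.fval m \<pi> = 1"
    using DVR_imp_poly_valuation[OF assms] by blast
  interpret m: poly_valuation p m by (rule m(1))
  interpret padic_poly_valuation p v m ..
  obtain V where V: "valuation_ring V (of_nat p :: 'k poly fract)"
    "\<forall>c. v c \<ge> 0 \<longrightarrow> const_fract c \<in> V" "\<forall>x\<in>ring_of m. base_change x \<in> V"
    using ex_common_extension by blast
  interpret V: valuation_ring V "of_nat p :: 'k poly fract" by (rule V(1))
  interpret common_extension p v m V e
    by unfold_locales (use V m in auto)
  show ?thesis
  proof (cases "\<exists>a. alg_over_Q a \<and> (\<forall>b. alg_over_Q b \<longrightarrow> D b \<le> D a)")
    case True
    then show ?thesis using maximum_imp_monomial m(2) by blast
  next
    case False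
    then have "res_algebraic p (ring_of m)"
      by (intro no_maximum_imp_res_algebraic) (metis not_le)
    then show ?thesis using unbounded_imp_evaluation[OF res_algebraic_approx[OF _ m(5,6)]] m(2) by blast
  qed
qed

text \<open>The value of X is \<open>v a\<close> for evaluation and
  \<open>min \<delta> (v a)\<close> for a monomial valuation, the case \<open>b = 0\<close> of
  \<open>gauss_linear\<close>.\<close>

lemma varX_in_Zpad_iff:
  assumes "admissible v a d"
  shows "varX \<in> Zpad v a d \<longleftrightarrow> a \<in> Op v \<and> (d = None \<or> (\<exists>\<delta>. d = Some \<delta> \<and> \<delta> \<ge> 0))"
proof (cases d)
  case None
  then have a: "\<not> alg_over_Q a" using assms by (simp add: admissible_def)
  interpret poly_valuation p "\<lambda>f. vr (poly (map_poly of_rat f) a)" using a by (rule eval_poly_valuation)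
  have "a \<noteq> 0" using transcendental_eval[OF a, of "[:0, 1:]"] by (auto simp: map_poly_pCons)
  then show ?thesis unfolding None Zpad_None[OF a] varX_def
    by (subst Fract_in_ring_of_iff) (auto simp: map_poly_pCons mem_Op v_nonneg_iff)
next
  case (Some \<delta>)
  interpret poly_valuation p "\<lambda>f. gauss (of_rat \<delta>) a (map_poly of_rat f)" by (rule gauss_poly_valuation)
  have "varX \<in> Zpad v a d \<longleftrightarrow> gauss (of_rat \<delta>) a [:0, 1:] \<ge> 0"
    unfolding Some Zpad_Some varX_def
    using gauss_const[of 1 "of_rat \<delta>" a] by (subst Fract_in_ring_of_iff) (auto simp: map_poly_pCons one_pCons)
  also have "\<dots> \<longleftrightarrow> ereal 0 \<le> ereal (gauss (of_rat \<delta>) a [:- 0, 1:])" by simp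
  also have "\<dots> \<longleftrightarrow> \<delta> \<ge> 0 \<and> v a \<ge> 0"
    unfolding gauss_linear by (simp add: zero_ereal_def[symmetric])
  finally show ?thesis by (auto simp: Some mem_Op)
qed

end

theorem mainTheorem5:
  fixes p :: nat and v :: "'k::field_char_0 \<Rightarrow> ereal" and W :: "QX set"
  assumes "prime p"
    and "is_Cp p v"
    and "is_DVR_QX W"
    and "{c. constQX c \<in> W} = Zloc p"
  shows
    "(\<exists>a d. a \<in> Cp_br v \<and> admissible v a d \<and> W = Zpad v a d) \<and>
     (\<forall>a d. a \<in> Cp_br v \<and> admissible v a d \<and> W = Zpad v a d \<longrightarrow>
        (varX \<in> W \<longleftrightarrow> a \<in> Op v \<and> (d = None \<or> (\<exists>\<delta>. d = Some \<delta> \<and> \<delta> \<ge> 0))) \<and>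
        (res_transcendental p W \<longleftrightarrow> d \<noteq> None) \<and>
        (res_algebraic p W \<longleftrightarrow> d = None \<and> \<not> alg_over_Q a)) \<and>
     {U. is_DVR_QX U \<and> {c. constQX c \<in> U} = Zloc p \<and> res_algebraic p U}
       = {Zpad v a None | a. a \<in> Cp_br v \<and> \<not> alg_over_Q a} \<and>
     {U. is_DVR_QX U \<and> {c. constQX c \<in> U} = Zloc p \<and> res_transcendental p U}
       = {Zpad v a (Some \<delta>) | a \<delta>. a \<in> Qp_bar v}"
proof -
  interpret padic_complex p v using assms(1,2) by unfold_locales
  have transc: "\<not> res_algebraic p (Zpad v a (Some \<delta>))" for a \<delta>
    using Zpad_Some_properties(3)[of a \<delta>] by (simp add: res_transcendental_def)
  have "\<exists>a d. a \<in> Cp_br v \<and> admissible v a d \<and> W = Zpad v a d"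
    using DVR_classification[OF assms(3,4)] algebraic_in_Cp_br algebraic_in_Qp_bar
    by (auto simp: admissible_def split: option.splits)
  moreover have "(varX \<in> W \<longleftrightarrow> a \<in> Op v \<and> (d = None \<or> (\<exists>\<delta>. d = Some \<delta> \<and> \<delta> \<ge> 0))) \<and>
        (res_transcendental p W \<longleftrightarrow> d \<noteq> None) \<and> (res_algebraic p W \<longleftrightarrow> d = None \<and> \<not> alg_over_Q a)"
    if a: "a \<in> Cp_br v" "admissible v a d" "W = Zpad v a d" for a d
  proof (cases d)
    case None
    then have "\<not> alg_over_Q a" using a(2) by (simp add: admissible_def)
    then show ?thesis using varX_in_Zpad_iff[OF a(2)] Zpad_None_properties(3)[OF a(1)] a(3) None
      by (simp add: res_transcendental_def)
  next
    case (Some \<delta>)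
    then show ?thesis using varX_in_Zpad_iff[OF a(2)] transc[of a \<delta>] a(3)
      by (simp add: res_transcendental_def)
  qed
  moreover have "{U. is_DVR_QX U \<and> {c. constQX c \<in> U} = Zloc p \<and> res_algebraic p U}
       = {Zpad v a None | a. a \<in> Cp_br v \<and> \<not> alg_over_Q a}"
  proof (intro equalityI subsetI)
    fix U assume U: "U \<in> {U. is_DVR_QX U \<and> {c. constQX c \<in> U} = Zloc p \<and> res_algebraic p U}"
    then show "U \<in> {Zpad v a None | a. a \<in> Cp_br v \<and> \<not> alg_over_Q a}"
      using DVR_classification[of U] transc by auto
  next
    fix U assume "U \<in> {Zpad v a None | a. a \<in> Cp_br v \<and> \<not> alg_over_Q a}"
    then obtain a where "a \<in> Cp_br v" "\<not> alg_over_Q a" "U = Zpad v a None" by blast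
    then show "U \<in> {U. is_DVR_QX U \<and> {c. constQX c \<in> U} = Zloc p \<and> res_algebraic p U}"
      using Zpad_None_properties[of a] by blast
  qed
  moreover have "{U. is_DVR_QX U \<and> {c. constQX c \<in> U} = Zloc p \<and> res_transcendental p U}
       = {Zpad v a (Some \<delta>) | a \<delta>. a \<in> Qp_bar v}"
  proof (intro equalityI subsetI)
    fix U assume U: "U \<in> {U. is_DVR_QX U \<and> {c. constQX c \<in> U} = Zloc p \<and> res_transcendental p U}"
    then show "U \<in> {Zpad v a (Some \<delta>) | a \<delta>. a \<in> Qp_bar v}"
      using DVR_classification[of U] Zpad_None_properties(3) algebraic_in_Qp_bar
      by (auto simp: res_transcendental_def)
  next
    fix U assume "U \<in> {Zpad v a (Some \<delta>) | a \<delta>. a \<in> Qp_bar v}"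
    then obtain a \<delta> where "U = Zpad v a (Some \<delta>)" by blast
    then show "U \<in> {U. is_DVR_QX U \<and> {c. constQX c \<in> U} = Zloc p \<and> res_transcendental p U}"
      using Zpad_Some_properties[of a \<delta>] by blast
  qed
  ultimately show ?thesis by blast
qed

end
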